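(* Suppose Assumptions 1, 2 and 3 below all hold, and that the conditional sampling mechanism $\widetilde{P}_M$ satisfies the exchangeability condition (E) below. Let $X\sim P_{\theta_0}$ for some $\theta_0\in\Theta$, and generate copies $\widetilde{X}^{(1)},\dots,\widetilde{X}^{(M)}$ by the aCSS procedure below. Then \[\mathsf{d}_{\mathsf{exch}}(X,\widetilde{X}^{(1)},\dots,\widetilde{X}^{(M)}) \le 3\sigma\, r(\theta_0)+\delta(\theta_0)+\varepsilon(\theta_0).\] Consequently, for every measurable test statistic $T:\mathcal{X}\to\mathbb{R}$ (fixed in advance) and every $\alpha\in[0,1]$, \[\mathbb{P}\big(\mathrm{pval}_T(X,\widetilde{X}^{(1)},\dots,\widetilde{X}^{(M)})\le\alpha\big)\le \alpha+3\sigma\, r(\theta_0)+\delta(\theta_0)+\varepsilon(\theta_0).\]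
   Context: Setting: $(\mathcal{X},\nu_\mathcal{X})$ is a measurable space with base measure $\nu_\mathcal{X}$, $\{P_\theta:\theta\in\Theta\}$ is a parametric family with $\Theta\subseteq\mathbb{R}^d$, $\mathcal{R}:\Theta\to\mathbb{R}$ is a regularization function, and $\sigma>0$ is a fixed noise level. All functions below are assumed measurable. Assumption 1 (regularity): $\Theta$ is a convex open subset of $\mathbb{R}^d$; each $P_\theta$ has a density $f(x;\theta)>0$ with respect to $\nu_\mathcal{X}$; and for each $x\in\mathcal{X}$ the map $\theta\mapsto\mathcal{L}(\theta;x):=-\log f(x;\theta)+\mathcal{R}(\theta)$ is continuously twice differentiable. For $w\in\mathbb{R}^d$ write $\mathcal{L}(\theta;x,w):=\mathcal{L}(\theta;x)+\sigma w^\top\theta$. Let $\widehat{\theta}:\mathcal{X}\times\mathbb{R}^d\to\Theta$ be a measurable map (the estimator). A point $\theta$ is a strict second-order stationary point (SSOSP) of $\mathcal{L}(\cdot;x,w)$ if $\nabla_\theta\mathcal{L}(\theta;x,w)=0$ and $\nabla^2_\theta\mathcal{L}(\theta;x,w)\succ0$ (equivalently $\nabla^2_\theta\mathcal{L}(\theta;x)\succ0$). For $\theta\in\Theta$ let $\mathcal{X}_\theta=\{x\in\mathcal{X}:\text{for some }w\in\mathbb{R}^d,\ \theta=\widehat{\theta}(x,w)\text{ and }\theta\text{ is a SSOSP of }\mathcal{L}(\cdot;x,w)\}$. For $\vartheta,\theta\in\Theta$ let $p_{\vartheta}(\cdot\mid\theta)$ be the density w.r.t. $\nu_\mathcal{X}$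 given by \[p_{\vartheta}(x\mid\theta)\propto f(x;\vartheta)\exp\Big\{-\frac{\|\nabla_\theta\mathcal{L}(\theta;x)\|^2}{2\sigma^2/d}\Big\}\det\big(\nabla^2_\theta\mathcal{L}(\theta;x)\big)\mathbf{1}\{x\in\mathcal{X}_\theta\}.\] aCSS procedure: given $X$, draw $W\sim\mathcal{N}(0,\tfrac1d\mathbf{I}_d)$ independently of $X$ and set $\widehat{\theta}=\widehat{\theta}(X,W)$. If $\widehat{\theta}$ is a SSOSP of $\mathcal{L}(\cdot;X,W)$, draw $(\widetilde{X}^{(1)},\dots,\widetilde{X}^{(M)})\sim\widetilde{P}_M(\cdot;X,\widehat{\theta})$, where $\widetilde{P}_M(\cdot;x,\theta)$ is a Markov kernel from $\mathcal{X}\times\Theta$ to $\mathcal{X}^M$; otherwise set $\widetilde{X}^{(1)}=\dots=\widetilde{X}^{(M)}=X$. Condition (E): for every $\theta\in\Theta$ with $\nu_\mathcal{X}(\mathcal{X}_\theta)>0$, if $X\sim p_\theta(\cdot\mid\theta)$ and $(\widetilde{X}^{(1)},\dots,\widetilde{X}^{(M)})\mid X\sim\widetilde{P}_M(\cdot;X,\theta)$, then $(X,\widetilde{X}^{(1)},\dots,\widetilde{X}^{(M)})$ is exchangeable. Assumption 2: there are functions $r:\Theta\to(0,\infty)$ and $\delta:\Theta\to[0,\infty)$ such that for every $\theta_0\in\Theta$, with $(X,W)\sim P_{\theta_0}\times\mathcal{N}(0,\tfrac1d\mathbf{I}_d)$, $\mathbb{P}\big(\|\widehat{\theta}(X,W)-\theta_0\|\le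 r(\theta_0)\text{ and }\widehat{\theta}(X,W)\text{ is a SSOSP of }\mathcal{L}(\cdot;X,W)\big)\ge1-\delta(\theta_0).$ Assumption 3: Let $H(\theta;x)=-\nabla^2_\theta\log f(x;\theta)$ and, for fixed $\theta_0$, $H(\theta)=\mathbb{E}_{\theta_0}[H(\theta;X)]$ ($X\sim P_{\theta_0}$). There is $\varepsilon:\Theta\to[0,\infty)$ such that for every $\theta_0\in\Theta$, $H(\theta)$ exists for all $\theta\in\mathbb{B}(\theta_0,r(\theta_0))\cap\Theta$, and \[\mathbb{E}_{\theta_0}\Big[\sup_{\theta\in\mathbb{B}(\theta_0,r(\theta_0))\cap\Theta}r(\theta_0)^2\big(\lambda_{\max}(H(\theta)-H(\theta;X))\big)_+\Big]\le\varepsilon(\theta_0),\] \[\mathbb{E}_{\theta_0}\Big[\exp\Big\{\sup_{\theta\in\mathbb{B}(\theta_0,r(\theta_0))\cap\Theta}r(\theta_0)^2\big(\lambda_{\max}(H(\theta;X)-H(\theta))\big)_+\Big\}\Big]\le e^{\varepsilon(\theta_0)},\] where $\lambda_{\max}$ is the largest eigenvalue, $(t)_+=\max\{t,0\}$, $\mathbb{B}(\theta,r)$ is the Euclidean ball. Distance to exchangeability: for random variables $A_1,\dots,A_k$, $\mathsf{d}_{\mathsf{exch}}(A_1,\dots,A_k)=\inf\{\mathsf{d}_{\mathsf{TV}}((A_1,\dots,A_k),(B_1,\dots,B_k)): (B_1,\dots,B_k)\text{ exchangeable}\}$, with $\mathsf{d}_{\mathsf{TV}}$ the total variation distance between laws.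 p-value: $\mathrm{pval}_T(X,\widetilde{X}^{(1)},\dots,\widetilde{X}^{(M)})=\frac{1}{M+1}\big(1+\sum_{m=1}^M\mathbf{1}\{T(\widetilde{X}^{(m)})\ge T(X)\}\big)$. *)

theory Defs
  imports "HOL-Analysis.Analysis" "HOL-Probability.Probability"
begin

definition posdef :: "real^'n^'n \<Rightarrow> bool" where
  "posdef A \<longleftrightarrow> (\<forall>v. v \<noteq> 0 \<longrightarrow> 0 < v \<bullet> (A *v v))"

text \<open>Largest (real) eigenvalue of a square matrix (used for symmetric matrices).\<close>
definition lmax :: "real^'n^'n \<Rightarrow> real" where
  "lmax A = Max {l. \<exists>v. v \<noteq> 0 \<and> A *v v = l *\<^sub>R v}"

text \<open>Strict second-order stationary point of L(.;x,w) = L(.;x) + sigma w^T theta,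
  where gL x and hL x are the gradient and Hessian of L(.;x).\<close>
definition is_SSOSP ::
  "('x \<Rightarrow> real^'n \<Rightarrow> real^'n) \<Rightarrow> ('x \<Rightarrow> real^'n \<Rightarrow> real^'n^'n) \<Rightarrow> real
   \<Rightarrow> 'x \<Rightarrow> real^'n \<Rightarrow> real^'n \<Rightarrow> bool" where
  "is_SSOSP gL hL \<sigma> x w \<theta> \<longleftrightarrow> gL x \<theta> + \<sigma> *\<^sub>R w = 0 \<and> posdef (hL x \<theta>)"

definition Xset ::
  "'x measure \<Rightarrow> ('x \<Rightarrow> real^'n \<Rightarrow> real^'n) \<Rightarrow> ('x \<Rightarrow> real^'n \<Rightarrow> real^'n^'n) \<Rightarrow> real
   \<Rightarrow> ('x \<Rightarrow> real^'n \<Rightarrow> real^'n) \<Rightarrow> real^'n \<Rightarrow> 'x set" where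
  "Xset MX gL hL \<sigma> \<theta>hat \<theta> =
     {x \<in> space MX. \<exists>w. \<theta> = \<theta>hat x w \<and> is_SSOSP gL hL \<sigma> x w \<theta>}"

definition cond_dens_un ::
  "'x measure \<Rightarrow> ('x \<Rightarrow> real^'n \<Rightarrow> real) \<Rightarrow> ('x \<Rightarrow> real^'n \<Rightarrow> real^'n)
   \<Rightarrow> ('x \<Rightarrow> real^'n \<Rightarrow> real^'n^'n) \<Rightarrow> real \<Rightarrow> ('x \<Rightarrow> real^'n \<Rightarrow> real^'n)
   \<Rightarrow> real^'n \<Rightarrow> real^'n \<Rightarrow> 'x \<Rightarrow> ennreal" where
  "cond_dens_un MX f gL hL \<sigma> \<theta>hat \<theta>\<^sub>v \<theta> x =
     ennreal (f x \<theta>\<^sub>v * exp (- (norm (gL x \<theta>))\<^sup>2 / (2 * \<sigma>\<^sup>2 / real CARD('n)))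
              * det (hL x \<theta>))
     * indicator (Xset MX gL hL \<sigma> \<theta>hat \<theta>) x"

definition cond_law ::
  "'x measure \<Rightarrow> ('x \<Rightarrow> real^'n \<Rightarrow> real) \<Rightarrow> ('x \<Rightarrow> real^'n \<Rightarrow> real^'n)
   \<Rightarrow> ('x \<Rightarrow> real^'n \<Rightarrow> real^'n^'n) \<Rightarrow> real \<Rightarrow> ('x \<Rightarrow> real^'n \<Rightarrow> real^'n)
   \<Rightarrow> real^'n \<Rightarrow> real^'n \<Rightarrow> 'x measure" where
  "cond_law MX f gL hL \<sigma> \<theta>hat \<theta>\<^sub>v \<theta> =
     density MX (\<lambda>x. cond_dens_un MX f gL hL \<sigma> \<theta>hat \<theta>\<^sub>v \<theta> x
                     / (\<integral>\<^sup>+ y. cond_dens_un MX f gL hL \<sigma> \<theta>hat \<theta>\<^sub>v \<theta> y \<partial>MX))"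

definition gauss_vec :: "(real^'n) measure" where
  "gauss_vec = density lborel
     (\<lambda>w. \<Prod>i\<in>UNIV. ennreal (normal_density 0 (sqrt (1 / real CARD('n))) (w $ i)))"

text \<open>The space X^{M+1} of tuples (index 0 = X, index m = the m-th copy).\<close>
definition tuple_space :: "'x measure \<Rightarrow> nat \<Rightarrow> (nat \<Rightarrow> 'x) measure" where
  "tuple_space MX M = PiM {..M} (\<lambda>_. MX)"

definition join_tuple :: "nat \<Rightarrow> 'x \<Rightarrow> (nat \<Rightarrow> 'x) \<Rightarrow> (nat \<Rightarrow> 'x)" where
  "join_tuple M x xs = (\<lambda>i\<in>{..M}. if i = 0 then x else xs (i - 1))"

definition exchangeable_law :: "'x measure \<Rightarrow> nat \<Rightarrow> (nat \<Rightarrow> 'x) measure \<Rightarrow> bool" where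
  "exchangeable_law MX M B \<longleftrightarrow>
     prob_space B \<and> sets B = sets (tuple_space MX M) \<and>
     (\<forall>\<pi>. \<pi> permutes {..M} \<longrightarrow>
        distr B (tuple_space MX M) (\<lambda>z. \<lambda>i\<in>{..M}. z (\<pi> i)) = B)"

definition dTV :: "'a measure \<Rightarrow> 'a measure \<Rightarrow> real" where
  "dTV \<mu> \<nu> = (SUP A\<in>sets \<mu>. \<bar>measure \<mu> A - measure \<nu> A\<bar>)"

definition dexch :: "'x measure \<Rightarrow> nat \<Rightarrow> (nat \<Rightarrow> 'x) measure \<Rightarrow> real" where
  "dexch MX M \<mu> = (INF B\<in>{B. exchangeable_law MX M B}. dTV \<mu> B)"

definition aCSS_law ::
  "'x measure \<Rightarrow> nat \<Rightarrow> real \<Rightarrow> ('x \<Rightarrow> real^'n \<Rightarrow> real^'n) \<Rightarrow> ('x \<Rightarrow> real^'n \<Rightarrow> real^'n^'n)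
   \<Rightarrow> ('x \<Rightarrow> real^'n \<Rightarrow> real^'n) \<Rightarrow> ('x \<times> (real^'n) \<Rightarrow> (nat \<Rightarrow> 'x) measure)
   \<Rightarrow> 'x measure \<Rightarrow> (nat \<Rightarrow> 'x) measure" where
  "aCSS_law MX M \<sigma> gL hL \<theta>hat Ptil \<mu>X =
     \<mu>X \<bind> (\<lambda>x. gauss_vec \<bind> (\<lambda>w.
        if is_SSOSP gL hL \<sigma> x w (\<theta>hat x w)
        then distr (Ptil (x, \<theta>hat x w)) (tuple_space MX M) (join_tuple M x)
        else return (tuple_space MX M) (\<lambda>i\<in>{..M}. x)))"

definition pval :: "('x \<Rightarrow> real) \<Rightarrow> nat \<Rightarrow> (nat \<Rightarrow> 'x) \<Rightarrow> real" where
  "pval T M z = (1 + real (card {m \<in> {1..M}. T (z 0) \<le> T (z m)})) / real (M + 1)"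

end

theory Submission
  imports Defs
begin

text \<open>
  On the event that the estimator is a strict second-order stationary point, the noise is
  \<open>w = - \<nabla>L(\<theta>; x) / \<sigma>\<close>, so the change of variables from \<open>w\<close> to \<open>\<theta>\<close> shows that the
  pair of data and estimate has a joint density proportional to the unnormalised \<open>p\<close> of the true
  parameter at \<open>(x, \<theta>)\<close>. The comparison law keeps the distribution of the estimate, but redraws
  the data from the conditional law with \<open>\<theta>\<close> itself as parameter; by condition (E) it is a mixture
  of exchangeable laws. Given \<open>\<theta>\<close>, the two conditional laws differ by a factor
  proportional to \<open>exp (- g)\<close>, and Taylor expansion gives
  \<open>- \<sigma> r |w| - b / 2 \<le> g \<le> \<sigma> r |w| + a / 2\<close> up to a constant depending on \<open>\<theta>\<close>
  only, where \<open>a\<close> and \<open>b\<close> are the two suprema in Assumption 3. The total variation distance is at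
  most the mean of the upper bound plus the logarithm of the exponential moment of the other one,
  averaged over \<open>\<theta>\<close>; each is at most \<open>3 \<sigma> r / 2 + \<epsilon> / 2\<close> as soon as \<open>\<sigma> r \<le> 1/3\<close>, and for larger
  \<open>\<sigma> r\<close> the claimed bound exceeds 1.
\<close>

text \<open>The logarithm of the conditional exponential moment is never averaged over \<theta>. It
  is replaced by its tangent line at one constant \<open>K\<close>, the same for all parameters, so
  that the comparison is linear in the masses: it can be made for fixed \<theta> and then
  integrated. Inequalities are arranged without subtraction, to stay in the nonnegative extended
  reals. The factor 3/2 comes from 2|w| \<le> 1 + |w|^2: the 1 costs s/2, and the Gaussian moment of
  s|W|^2/2 costs s, free of the dimension because the noise has variance 1/d per coordinate. Three
  obstacles shape the rest: sigma-finiteness of the base measure has to be derived, the suprema over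
  parameters may be non-measurable, and the estimator is merely measurable, so that the substitution
  has to differentiate its inverse, the map from \<theta> to the noise.\<close>

subsection \<open>Positive definite matrices and the Rayleigh quotient\<close>

text \<open>The segment from the identity to \<open>A\<close> consists of positive definite, hence
  invertible matrices, so the determinant cannot change sign along it. This lets the Jacobian lose
  its absolute value.\<close>

lemma posdef_det_pos:
  fixes A :: "real^'n^'n"
  assumes "posdef A"
  shows "det A > 0"
proof -
  define B where "B t = (1 - t) *\<^sub>R mat 1 + t *\<^sub>R A" for t :: real
  have pd: "0 < v \<bullet> (B t *v v)" if "v \<noteq> 0" "0 \<le> t" "t \<le> 1" for v t
  proof -
    have "v \<bullet> (B t *v v) = (1 - t) * (v \<bullet> v) + t * (v \<bullet> (A *v v))"
      by (simp add: B_def matrix_vector_mult_add_rdistrib scaleR_matrix_vector_assoc[symmetric] inner_add_right)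
    moreover have "0 < v \<bullet> v" "0 < v \<bullet> (A *v v)" using assms that by (auto simp: posdef_def)
    ultimately show ?thesis using that
      by (cases "t = 0") (auto intro!: add_nonneg_pos)
  qed
  have nz: "det (B t) \<noteq> 0" if "0 \<le> t" "t \<le> 1" for t
  proof
    assume "det (B t) = 0"
    then have "\<not> invertible (B t)" by (simp add: invertible_det_nz)
    then obtain v where "v \<noteq> 0" "B t *v v = 0"
      using matrix_left_invertible_ker[of "B t"] invertible_left_inverse[of "B t"] by auto
    then show False using pd[of v t] that by simp
  qed
  have cont: "continuous_on {0..1} (\<lambda>t. det (B t))"
    unfolding B_def det_def mat_def by (intro continuous_intros)
  show ?thesis
  proof (rule ccontr)
    assume "\<not> det A > 0"
    then have "det (B 1) \<le> 0" by (simp add: B_def)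
    moreover have "0 \<le> det (B 0)" by (simp add: B_def)
    ultimately obtain t where "0 \<le> t" "t \<le> 1" "det (B t) = 0"
      using IVT2'[of "\<lambda>t. det (B t)" 1 0 0] cont by auto
    then show False using nz by auto
  qed
qed

text \<open>The quadratic form attains its minimum on the compact unit sphere. Countably many
  constants \<open>inverse (Suc k)\<close> suffice, which turns the set of positive definite
  matrices into a countable union of closed sets.\<close>

lemma posdef_coercive:
  fixes A :: "real^'n^'n"
  shows "posdef A \<longleftrightarrow> (\<exists>k::nat. \<forall>v. v \<bullet> (A *v v) \<ge> inverse (Suc k) * (v \<bullet> v))"
proof
  assume A: "posdef A"
  let ?q = "\<lambda>v. v \<bullet> (A *v v)"
  have "continuous_on (sphere 0 1) ?q"
    by (intro continuous_intros)
  moreover have "axis undefined 1 \<in> sphere (0::real^'n) 1" by (simp add: norm_axis_1)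
  then have "sphere (0::real^'n) 1 \<noteq> {}" by blast
  ultimately obtain u where u: "norm u = 1" "\<And>v. norm v = 1 \<Longrightarrow> ?q u \<le> ?q v"
    using continuous_attains_inf[of "sphere 0 1" ?q] by auto
  have "u \<noteq> 0" using u(1) by auto
  then have "?q u > 0" using A by (simp add: posdef_def)
  then obtain k :: nat where k: "inverse (Suc k) < ?q u" using reals_Archimedean by blast
  have "?q v \<ge> inverse (Suc k) * (v \<bullet> v)" for v
  proof (cases "v = 0")
    case False
    define e where "e = v /\<^sub>R norm v"
    have v: "v = norm v *\<^sub>R e" and e: "norm e = 1" using False by (auto simp: e_def)
    have "?q v = (norm v)\<^sup>2 * ?q e"
      by (subst (1 2) v) (simp add: matrix_vector_mult_scaleR power2_eq_square)
    moreover have "inverse (Suc k) \<le> ?q e" using k u(2)[OF e] by linarith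
    ultimately show ?thesis
      by (simp add: power2_norm_eq_inner[symmetric] mult.commute mult_right_mono)
  qed simp
  then show "\<exists>k::nat. \<forall>v. ?q v \<ge> inverse (Suc k) * (v \<bullet> v)" by blast
next
  assume "\<exists>k::nat. \<forall>v. v \<bullet> (A *v v) \<ge> inverse (Suc k) * (v \<bullet> v)"
  then obtain k :: nat where "\<forall>v. v \<bullet> (A *v v) \<ge> inverse (Suc k) * (v \<bullet> v)" by blast
  moreover have "inverse (Suc k) * (v \<bullet> v) > 0" if "v \<noteq> 0" for v :: "real^'n"
    using that by simp
  ultimately show "posdef A" unfolding posdef_def by (meson less_le_trans)
qed

lemma posdef_borel [measurable]: "Measurable.pred borel (posdef :: real^'n^'n \<Rightarrow> bool)"
proof -
  have "closed {A::real^'n^'n. inverse (Suc k) * (v \<bullet> v) \<le> v \<bullet> (A *v v)}" for k :: nat and v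
    unfolding matrix_vector_mult_def by (intro closed_Collect_le continuous_intros)
  then have "closed (\<Inter>v. {A::real^'n^'n. inverse (Suc k) * (v \<bullet> v) \<le> v \<bullet> (A *v v)})" for k :: nat
    by blast
  moreover have "{A::real^'n^'n. posdef A}
      = (\<Union>k::nat. \<Inter>v. {A. inverse (Suc k) * (v \<bullet> v) \<le> v \<bullet> (A *v v)})"
    by (auto simp: posdef_coercive)
  ultimately have "{A::real^'n^'n. posdef A} \<in> sets borel" by auto
  then show ?thesis by (simp add: pred_def)
qed

lemma det_borel [measurable]: "(det :: real^'n^'n \<Rightarrow> real) \<in> borel_measurable borel"
  unfolding det_def by (intro borel_measurable_continuous_onI continuous_intros)

text \<open>\<open>lmax\<close> is a \<open>Max\<close>, meaningful only on a finite set.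
  Eigenvectors of distinct eigenvalues are orthogonal, hence independent, which bounds their
  number.\<close>

lemma finite_eigenvalues_symmetric:
  fixes A :: "real^'n^'n"
  assumes "transpose A = A"
  shows "finite {l. \<exists>v. v \<noteq> 0 \<and> A *v v = l *\<^sub>R v}" (is "finite ?E")
proof -
  define e where "e l = (SOME v. v \<noteq> 0 \<and> A *v v = l *\<^sub>R v)" for l
  have e: "e l \<noteq> 0" "A *v e l = l *\<^sub>R e l" if "l \<in> ?E" for l
    using someI_ex[of "\<lambda>v. v \<noteq> 0 \<and> A *v v = l *\<^sub>R v"] that unfolding e_def by auto
  have orth: "e l \<bullet> e m = 0" if "l \<in> ?E" "m \<in> ?E" "l \<noteq> m" for l m
  proof -
    have "l * (e l \<bullet> e m) = (A *v e l) \<bullet> e m" using e[OF that(1)] by simp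
    also have "\<dots> = e l \<bullet> (A *v e m)" by (metis assms dot_lmul_matrix vector_transpose_matrix)
    also have "\<dots> = m * (e l \<bullet> e m)" using e[OF that(2)] by simp
    finally show ?thesis using that by simp
  qed
  have "independent (e ` ?E)"
    by (rule pairwise_orthogonal_independent)
      (use orth e(1) in \<open>force simp: pairwise_def orthogonal_def\<close>)+
  then have "finite (e ` ?E)" using independent_bound by blast
  moreover have "inj_on e ?E"
  proof (rule inj_onI)
    fix l m assume lm: "l \<in> ?E" "m \<in> ?E" "e l = e m"
    then have "e l \<bullet> e m \<noteq> 0" using e(1)[of m] by auto
    then show "l = m" using orth[OF lm(1,2)] by blast
  qed
  ultimately show ?thesis using finite_imageD by blast
qed

text \<open>The maximum of the quadratic form over the unit sphere is itself an eigenvalue. In this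
  form the suprema of \<open>lmax\<close> in the hypotheses bound Taylor remainders.\<close>

lemma rayleigh_le_lmax:
  fixes A :: "real^'n^'n"
  assumes sym: "transpose A = A"
  shows "v \<bullet> (A *v v) \<le> lmax A * (v \<bullet> v)"
proof -
  let ?q = "\<lambda>v. v \<bullet> (A *v v)"
  have sw: "x \<bullet> (A *v y) = y \<bullet> (A *v x)" for x y
    by (metis sym dot_lmul_matrix vector_transpose_matrix inner_commute)
  have "continuous_on (sphere 0 1) ?q"
    by (intro continuous_intros)
  moreover have "axis undefined 1 \<in> sphere (0::real^'n) 1" by (simp add: norm_axis_1)
  then have "sphere (0::real^'n) 1 \<noteq> {}" by blast
  ultimately obtain u where u: "norm u = 1" "\<And>v. norm v = 1 \<Longrightarrow> ?q v \<le> ?q u"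
    using continuous_attains_sup[of "sphere 0 1" ?q] by auto
  define l where "l = ?q u"
  have le: "?q v \<le> l * (v \<bullet> v)" for v
  proof (cases "v = 0")
    case False
    define e where "e = v /\<^sub>R norm v"
    have v: "v = norm v *\<^sub>R e" and e: "norm e = 1" using False by (auto simp: e_def)
    have "?q v = (norm v)\<^sup>2 * ?q e"
      by (subst (1 2) v) (simp add: matrix_vector_mult_scaleR power2_eq_square)
    then show ?thesis using u(2)[OF e]
      by (simp add: power2_norm_eq_inner[symmetric] l_def mult.commute mult_right_mono)
  qed simp
  \<comment> \<open>A maximiser of the Rayleigh quotient is an eigenvector: first-order condition.\<close>
  have "A *v u = l *\<^sub>R u"
  proof -
    \<comment> \<open>The residual is the direction in which the eigenvalue equation fails. A small
      step from \<open>u\<close> against it would lift the Rayleigh quotient above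
      \<open>l\<close>.\<close>
    define y where "y = l *\<^sub>R u - A *v u"
    define c where "c = l * (y \<bullet> y) - ?q y"
    have uu: "u \<bullet> u = 1" using u(1) by (simp add: norm_eq_1)
    have ineq: "0 \<le> 2 * t * (y \<bullet> y) + t\<^sup>2 * c" for t
    proof -
      have "?q (u + t *\<^sub>R y) \<le> l * ((u + t *\<^sub>R y) \<bullet> (u + t *\<^sub>R y))" by (rule le)
      moreover have "?q (u + t *\<^sub>R y) = l + 2 * t * (y \<bullet> (A *v u)) + t\<^sup>2 * ?q y"
        unfolding matrix_vector_right_distrib matrix_vector_mult_scaleR inner_add_left inner_add_right
          inner_scaleR_left inner_scaleR_right l_def sw[of u y] power2_eq_square
        by (simp add: distrib_left)
      moreover have "(u + t *\<^sub>R y) \<bullet> (u + t *\<^sub>R y) = 1 + 2 * t * (y \<bullet> u) + t\<^sup>2 * (y \<bullet> y)"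
        unfolding inner_add_left inner_add_right inner_scaleR_left inner_scaleR_right
          inner_commute[of u y] uu power2_eq_square
        by (simp add: distrib_left)
      ultimately have "l + 2 * t * (y \<bullet> (A *v u)) + t\<^sup>2 * ?q y
          \<le> l * (1 + 2 * t * (y \<bullet> u) + t\<^sup>2 * (y \<bullet> y))" by simp
      moreover have yy: "y \<bullet> (A *v u) = l * (y \<bullet> u) - y \<bullet> y"
        by (subst (3) y_def) (simp add: inner_diff_right)
      ultimately show ?thesis unfolding yy c_def by (simp add: algebra_simps)
    qed
    have "y \<bullet> y = 0"
    proof (rule ccontr)
      assume "y \<bullet> y \<noteq> 0"
      then have pos: "y \<bullet> y > 0" by (simp add: order_less_le)
      have c: "c \<ge> 0" using le[of y] by (simp add: c_def)
      \<comment> \<open>\<open>c\<close> may vanish, hence the denominator \<open>c + 1\<close>.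
        This \<open>t\<close> gives 2|y|^2 + t c = |y|^2 - t > 0, so the linear term wins.\<close>
      define t where "t = - (y \<bullet> y) / (c + 1)"
      have t: "t < 0" "t * (c + 1) = - (y \<bullet> y)" using pos c by (auto simp: t_def divide_neg_pos)
      have "2 * (y \<bullet> y) + t * c = (y \<bullet> y) - t" using t(2) by (simp add: algebra_simps)
      then have "2 * (y \<bullet> y) + t * c > 0" using t(1) pos by linarith
      then have "t * (2 * (y \<bullet> y) + t * c) < 0" using t(1) by (rule mult_neg_pos[rotated])
      with ineq[of t] show False by (simp add: algebra_simps power2_eq_square)
    qed
    then show ?thesis by (simp add: y_def)
  qed
  then have "l \<le> lmax A" unfolding lmax_def
    using finite_eigenvalues_symmetric[OF sym] u(1) by (intro Max_ge) (auto intro!: exI[of _ u])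
  then show ?thesis using le[of v] by (meson inner_ge_zero mult_right_mono order_trans)
qed

subsection \<open>Symmetry of second derivatives\<close>

lemma has_derivative_expansion:
  fixes g :: "'a::euclidean_space \<Rightarrow> 'a"
  assumes "(g has_derivative h) (at \<theta>)" "e > 0"
  shows "\<exists>d>0. \<forall>y. norm y < d \<longrightarrow> norm (g (\<theta> + y) - g \<theta> - h y) \<le> e * norm y"
proof -
  from assms obtain d where "d > 0" "\<forall>x. norm (x - \<theta>) < d \<longrightarrow>
      norm (g x - g \<theta> - h (x - \<theta>)) \<le> e * norm (x - \<theta>)"
    unfolding has_derivative_at_alt by blast
  then show ?thesis by (intro exI[of _ d]) (metis add_diff_cancel_left')
qed

text \<open>The mean value theorem along \<open>v\<close> turns the second difference into
  \<open>t\<close> times an increment of the gradient. Both gradient values are expanded about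
  \<open>\<theta>\<close> with error rate \<open>e\<close>, which explains the factor 2.\<close>

lemma second_difference_bound:
  fixes f :: "'a::euclidean_space \<Rightarrow> real" and g :: "'a \<Rightarrow> 'a"
  assumes f: "\<And>x. x \<in> ball \<theta> \<rho> \<Longrightarrow> (f has_derivative (\<lambda>k. g x \<bullet> k)) (at x)"
    and lin: "linear h"
    and g: "\<And>y. norm y < d \<Longrightarrow> norm (g (\<theta> + y) - g \<theta> - h y) \<le> e * norm y"
    and t: "0 < t" "t * (norm u + norm v) < d" "t * (norm u + norm v) < \<rho>" and e: "e \<ge> 0"
  shows "\<bar>(f (\<theta> + t *\<^sub>R u + t *\<^sub>R v) - f (\<theta> + t *\<^sub>R u) - f (\<theta> + t *\<^sub>R v) + f \<theta>)
           - t\<^sup>2 * (h u \<bullet> v)\<bar> \<le> 2 * e * t\<^sup>2 * (norm u + norm v) * norm v"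
proof -
  define \<phi> where "\<phi> s = f (\<theta> + t *\<^sub>R u + s *\<^sub>R v) - f (\<theta> + s *\<^sub>R v)" for s
  have small: "norm (t *\<^sub>R u + s *\<^sub>R v) \<le> t * (norm u + norm v)" 
    "norm (s *\<^sub>R v) \<le> t * (norm u + norm v)" if "0 \<le> s" "s \<le> t" for s
  proof -
    have "s * norm v \<le> t * norm v" using that by (simp add: mult_right_mono)
    moreover have "0 \<le> t * norm u" using t(1) by simp
    moreover have "norm (t *\<^sub>R u) = t * norm u" "norm (s *\<^sub>R v) = s * norm v" using t(1) that by auto
    ultimately show "norm (t *\<^sub>R u + s *\<^sub>R v) \<le> t * (norm u + norm v)"
      "norm (s *\<^sub>R v) \<le> t * (norm u + norm v)"
      using norm_triangle_ineq[of "t *\<^sub>R u" "s *\<^sub>R v"] by (simp_all only: distrib_left)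
  qed
  have der: "(\<phi> has_real_derivative ((g (\<theta> + t *\<^sub>R u + s *\<^sub>R v) - g (\<theta> + s *\<^sub>R v)) \<bullet> v)) (at s)"
    if s: "0 \<le> s" "s \<le> t" for s
  proof -
    have "\<theta> + y \<in> ball \<theta> \<rho>" if "norm y < \<rho>" for y using that by (simp add: dist_norm)
    from this[OF le_less_trans, OF small(1)[OF s] t(3)] this[OF le_less_trans, OF small(2)[OF s] t(3)]
    have b: "\<theta> + t *\<^sub>R u + s *\<^sub>R v \<in> ball \<theta> \<rho>" "\<theta> + s *\<^sub>R v \<in> ball \<theta> \<rho>"
      by (simp_all only: add.assoc)
    have "((\<lambda>s. f (\<theta> + t *\<^sub>R u + s *\<^sub>R v)) has_derivative
        (\<lambda>k. g (\<theta> + t *\<^sub>R u + s *\<^sub>R v) \<bullet> (k *\<^sub>R v))) (at s)"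
      by (rule has_derivative_compose[where f = "\<lambda>s. \<theta> + t *\<^sub>R u + s *\<^sub>R v" and g = f, OF _ f[OF b(1)]]) (auto intro!: derivative_eq_intros)
    moreover have "((\<lambda>s. f (\<theta> + s *\<^sub>R v)) has_derivative (\<lambda>k. g (\<theta> + s *\<^sub>R v) \<bullet> (k *\<^sub>R v))) (at s)"
      by (rule has_derivative_compose[where f = "\<lambda>s. \<theta> + s *\<^sub>R v" and g = f, OF _ f[OF b(2)]]) (auto intro!: derivative_eq_intros)
    ultimately have "(\<phi> has_derivative (\<lambda>k. g (\<theta> + t *\<^sub>R u + s *\<^sub>R v) \<bullet> (k *\<^sub>R v)
        - g (\<theta> + s *\<^sub>R v) \<bullet> (k *\<^sub>R v))) (at s)"
      unfolding \<phi>_def by (rule has_derivative_diff)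
    then show ?thesis unfolding has_field_derivative_def
      by (rule has_derivative_eq_rhs) (auto simp: inner_diff_left algebra_simps)
  qed
  obtain s where s: "0 < s" "s < t"
    and eq: "\<phi> t - \<phi> 0 = (t - 0) * ((g (\<theta> + t *\<^sub>R u + s *\<^sub>R v) - g (\<theta> + s *\<^sub>R v)) \<bullet> v)"
    using MVT2[OF t(1), of \<phi> "\<lambda>s. (g (\<theta> + t *\<^sub>R u + s *\<^sub>R v) - g (\<theta> + s *\<^sub>R v)) \<bullet> v"] der
    by auto
  let ?r = "\<lambda>y. g (\<theta> + y) - g \<theta> - h y"
  have sm: "norm (t *\<^sub>R u + s *\<^sub>R v) \<le> t * (norm u + norm v)" 
    "norm (s *\<^sub>R v) \<le> t * (norm u + norm v)" using small s by auto
  have r: "norm (?r y) \<le> e * (t * (norm u + norm v))" if "norm y \<le> t * (norm u + norm v)" for y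
    using g[of y] that t(2) e by (meson mult_left_mono order_trans le_less_trans)
  have "g (\<theta> + t *\<^sub>R u + s *\<^sub>R v) - g (\<theta> + s *\<^sub>R v)
      = t *\<^sub>R h u + (?r (t *\<^sub>R u + s *\<^sub>R v) - ?r (s *\<^sub>R v))"
    using lin by (simp add: linear_add linear_scale algebra_simps)
  then have "\<phi> t - \<phi> 0 - t\<^sup>2 * (h u \<bullet> v) = t * ((?r (t *\<^sub>R u + s *\<^sub>R v) - ?r (s *\<^sub>R v)) \<bullet> v)"
    unfolding eq by (simp only: inner_add_left power2_eq_square) (simp add: algebra_simps)
  also have "\<bar>\<dots>\<bar> \<le> t * (norm (?r (t *\<^sub>R u + s *\<^sub>R v) - ?r (s *\<^sub>R v)) * norm v)"
    using t(1) by (simp only: abs_mult) (intro mult_mono Cauchy_Schwarz_ineq2, auto)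
  also have "\<dots> \<le> t * ((e * (t * (norm u + norm v)) + e * (t * (norm u + norm v))) * norm v)"
    using t(1) norm_triangle_ineq4[of "?r (t *\<^sub>R u + s *\<^sub>R v)" "?r (s *\<^sub>R v)"] r[OF sm(1)] r[OF sm(2)]
    by (intro mult_left_mono mult_right_mono) (auto simp del: norm_scaleR)
  finally show ?thesis by (simp add: \<phi>_def power2_eq_square algebra_simps)
qed

text \<open>The second difference is symmetric in \<open>u\<close> and \<open>v\<close>, while t^2
  (Hu . v) and t^2 (Hv . u) both approximate it up to an arbitrarily small multiple of t^2. Symmetry
  makes Hessians accessible to \<open>rayleigh_le_lmax\<close>.\<close>

lemma second_derivative_symmetric:
  fixes f :: "real^'n \<Rightarrow> real" and g :: "real^'n \<Rightarrow> real^'n" and H :: "real^'n^'n"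
  assumes S: "open S" "\<theta> \<in> S"
    and f: "\<And>x. x \<in> S \<Longrightarrow> (f has_derivative (\<lambda>k. g x \<bullet> k)) (at x)"
    and g: "(g has_derivative (\<lambda>k. H *v k)) (at \<theta>)"
  shows "transpose H = H"
proof -
  obtain \<rho> where \<rho>: "\<rho> > 0" "ball \<theta> \<rho> \<subseteq> S" using S openE by blast
  have sym: "(H *v u) \<bullet> v = (H *v v) \<bullet> u" for u v
  proof (rule ccontr)
    assume ne: "(H *v u) \<bullet> v \<noteq> (H *v v) \<bullet> u"
    define q where "q = \<bar>(H *v u) \<bullet> v - (H *v v) \<bullet> u\<bar>"
    define N where "N = (norm u + norm v)"
    have q: "q > 0" using ne by (simp add: q_def)
    have N: "N \<ge> 0" by (simp add: N_def)
    \<comment> \<open>The two errors will add up to 2 e N^2 t^2, which has to stay below q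
      t^2.\<close>
    define e where "e = q / (4 * (N * N + 1))"
    have e: "e > 0" "4 * e * (N * N) < q"
    proof -
      have NN: "0 < N * N + 1" using N by (simp add: add_nonneg_pos)
      show "e > 0" using q NN by (simp add: e_def)
      have "4 * e * (N * N) = q * (N * N / (N * N + 1))" using NN by (simp add: e_def field_simps)
      also have "\<dots> < q * 1" using q NN by (intro mult_strict_left_mono) auto
      finally show "4 * e * (N * N) < q" by simp
    qed
    from has_derivative_expansion[OF g e(1)] obtain d where d: "d > 0"
      "\<And>y. norm y < d \<Longrightarrow> norm (g (\<theta> + y) - g \<theta> - H *v y) \<le> e * norm y" by blast
    define t where "t = min d \<rho> / (2 * (N + 1))"
    have t: "t > 0" using d \<rho> N by (simp add: t_def)
    have "t * N < t * (2 * (N + 1))" using t N by (intro mult_strict_left_mono) auto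
    also have "\<dots> = min d \<rho>" using N unfolding t_def by (simp add: field_simps)
    finally have "t * N < min d \<rho>" .
    then have tN: "t * N < d" "t * N < \<rho>" by auto
    let ?D = "f (\<theta> + t *\<^sub>R u + t *\<^sub>R v) - f (\<theta> + t *\<^sub>R u) - f (\<theta> + t *\<^sub>R v) + f \<theta>"
    have f': "(f has_derivative (\<lambda>k. g x \<bullet> k)) (at x)" if "x \<in> ball \<theta> \<rho>" for x
      using f \<rho>(2) that by blast
    have lin: "linear (\<lambda>k. H *v k)" by (rule matrix_vector_mul_linear)
    have 1: "\<bar>?D - t\<^sup>2 * ((H *v u) \<bullet> v)\<bar> \<le> 2 * e * t\<^sup>2 * N * norm v"
      unfolding N_def
      by (rule second_difference_bound[OF f' lin d(2) t tN[unfolded N_def] less_imp_le[OF e(1)]])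
    have "\<bar>(f (\<theta> + t *\<^sub>R v + t *\<^sub>R u) - f (\<theta> + t *\<^sub>R v) - f (\<theta> + t *\<^sub>R u) + f \<theta>)
        - t\<^sup>2 * ((H *v v) \<bullet> u)\<bar> \<le> 2 * e * t\<^sup>2 * (norm v + norm u) * norm u"
      by (rule second_difference_bound[OF f' lin d(2) t tN[unfolded N_def add.commute[of "norm u"]]
            less_imp_le[OF e(1)]])
    then have 2: "\<bar>?D - t\<^sup>2 * ((H *v v) \<bullet> u)\<bar> \<le> 2 * e * t\<^sup>2 * N * norm u"
      unfolding N_def by (simp only: add.commute[of "norm v" "norm u"] diff_diff_eq
          add.commute[of "f (\<theta> + t *\<^sub>R v)"] add.commute[of "t *\<^sub>R v" "t *\<^sub>R u"] add.assoc)
    have "t\<^sup>2 * q = \<bar>t\<^sup>2 * ((H *v u) \<bullet> v) - t\<^sup>2 * ((H *v v) \<bullet> u)\<bar>"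
      by (simp add: q_def abs_mult right_diff_distrib[symmetric])
    also have "\<dots> \<le> 2 * e * t\<^sup>2 * N * norm v + 2 * e * t\<^sup>2 * N * norm u"
      using 1 2 by linarith
    also have "\<dots> = t\<^sup>2 * (2 * e * (N * N))" by (simp add: N_def algebra_simps)
    also have "\<dots> < t\<^sup>2 * q"
    proof (rule mult_strict_left_mono)
      have "0 \<le> e * (N * N)" using e(1) N by simp
      then show "2 * e * (N * N) < q" using e(2) by linarith
    qed (use t in simp)
    finally show False by simp
  qed
  have "transpose H *v u = H *v u" for u
  proof (rule vector_eq_rdot[THEN iffD1], rule allI)
    fix z
    have "(transpose H *v u) \<bullet> z = u \<bullet> (H *v z)"
      using dot_lmul_matrix[of u H z] by simp
    then show "(transpose H *v u) \<bullet> z = (H *v u) \<bullet> z"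
      using sym[of u z] by (simp add: inner_commute)
  qed
  then show ?thesis by (simp add: matrix_eq)
qed

subsection \<open>Change of variables over arbitrary finite index types\<close>

text \<open>
  The library has the change of variables theorem only for well-ordered index types. Every finite
  type has a well-ordered copy, and reindexing preserves Lebesgue measure and determinants.
\<close>

typedef 'a ordered = "UNIV :: 'a set" by auto

lemma bij_Rep_ordered: "bij Rep_ordered"
  by (metis Abs_ordered_inverse Rep_ordered_inverse UNIV_I bijI')

instance ordered :: (finite) finite
proof
  show "finite (UNIV :: 'a ordered set)"
    using bij_Rep_ordered bij_betw_finite finite_class.finite_UNIV by blast
qed

instantiation ordered :: (finite) wellorder
begin

definition ordered_index :: "'a ordered \<Rightarrow> nat" where
  "ordered_index = (SOME e. inj e)"

definition less_eq_ordered :: "'a ordered \<Rightarrow> 'a ordered \<Rightarrow> bool" where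
  "x \<le> y \<longleftrightarrow> ordered_index x \<le> ordered_index y"

definition less_ordered :: "'a ordered \<Rightarrow> 'a ordered \<Rightarrow> bool" where
  "x < y \<longleftrightarrow> ordered_index x < ordered_index y"

instance
proof
  have "\<exists>e :: 'a ordered \<Rightarrow> nat. inj e"
    using finite_imp_inj_to_nat_seg[of "UNIV :: 'a ordered set"] by auto
  then have inj: "inj (ordered_index :: 'a ordered \<Rightarrow> nat)"
    unfolding ordered_index_def by (rule someI_ex)
  fix x y z :: "'a ordered"
  show "x < y \<longleftrightarrow> x \<le> y \<and> \<not> y \<le> x" "x \<le> x" "x \<le> y \<or> y \<le> x"
    by (auto simp: less_eq_ordered_def less_ordered_def)
  show "x \<le> z" if "x \<le> y" "y \<le> z"
    using that by (auto simp: less_eq_ordered_def)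
  show "x = y" if "x \<le> y" "y \<le> x"
    using that inj by (auto simp: less_eq_ordered_def inj_def)
  show "P x" if step: "\<And>x :: 'a ordered. (\<And>y. y < x \<Longrightarrow> P y) \<Longrightarrow> P x" for P
    by (induction x rule: measure_induct_rule[of ordered_index]) (use step in \<open>auto simp: less_ordered_def\<close>)
qed

end

definition reindex :: "('a \<Rightarrow> 'b) \<Rightarrow> real^'b \<Rightarrow> real^'a" where
  "reindex e v = (\<chi> i. v $ e i)"

lemma reindex_nth [simp]: "reindex e v $ i = v $ e i"
  by (simp add: reindex_def)

lemma linear_reindex: "linear (reindex e)"
  by (rule linearI) (auto simp: vec_eq_iff)

lemma reindex_inverse:
  assumes "bij e"
  shows "reindex e (reindex (inv e) v) = v" "reindex (inv e) (reindex e w) = w"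
  using assms by (auto simp: vec_eq_iff bij_def surj_f_inv_f)

lemma reindex_borel [measurable]: "reindex e \<in> borel \<rightarrow>\<^sub>M borel"
  by (intro borel_measurable_continuous_onI linear_continuous_on linear_reindex[unfolded linear_conv_bounded_linear])

text \<open>Lebesgue measure is determined by its values on boxes, and permuting coordinates takes a
  box to a box with the same side lengths in another order.\<close>

lemma distr_reindex_lborel:
  fixes e :: "'a::finite \<Rightarrow> 'b::finite"
  assumes e: "bij e"
  shows "distr lborel borel (reindex e) = lborel"
proof (rule lborel_eqI[symmetric])
  fix l u :: "real^'a"
  assume le: "\<And>b. b \<in> Basis \<Longrightarrow> l \<bullet> b \<le> u \<bullet> b"
  let ?l = "reindex (inv e) l" and ?u = "reindex (inv e) u"
  have B: "(\<Prod>b\<in>Basis. (v :: real^'c::finite) \<bullet> b) = (\<Prod>i\<in>UNIV. v $ i)" for v :: "real^'c"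
  proof -
    have "bij_betw (\<lambda>i. axis i 1) UNIV (Basis :: (real^'c) set)"
      by (auto simp: bij_betw_def Basis_vec_def inj_def axis_eq_axis)
    from prod.reindex_bij_betw[OF this, of "\<lambda>b. v \<bullet> b", symmetric]
    have "(\<Prod>b\<in>Basis. v \<bullet> b) = (\<Prod>i\<in>UNIV. v \<bullet> axis i 1)" .
    then show ?thesis by (simp add: inner_axis)
  qed
  have le': "l $ i \<le> u $ i" for i
    using le[of "axis i 1"] by (simp add: inner_axis)
  have pre: "reindex e -` box l u = box ?l ?u"
  proof -
    have "(\<forall>i. l $ i < x $ e i \<and> x $ e i < u $ i) \<longleftrightarrow>
        (\<forall>j. l $ inv e j < x $ j \<and> x $ j < u $ inv e j)" for x
      using e by (metis bij_inv_eq_iff)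
    then show ?thesis by (auto simp: mem_box_cart)
  qed
  have "emeasure (distr lborel borel (reindex e)) (box l u) = emeasure lborel (box ?l ?u)"
    by (subst emeasure_distr) (auto simp: pre)
  also have "\<dots> = ennreal (\<Prod>b\<in>Basis. (?u - ?l) \<bullet> b)"
    by (rule emeasure_lborel_box) (auto simp: Basis_vec_def inner_axis le')
  also have "(\<Prod>b\<in>Basis. (?u - ?l) \<bullet> b) = (\<Prod>j\<in>UNIV. (u - l) $ inv e j)"
    by (subst B) simp
  also have "\<dots> = (\<Prod>i\<in>UNIV. (u - l) $ i)"
    by (rule prod.reindex_bij_betw[of "inv e" UNIV UNIV "\<lambda>i. (u - l) $ i"]) (simp add: e bij_imp_bij_inv)
  also have "\<dots> = (\<Prod>b\<in>Basis. (u - l) \<bullet> b)" by (subst B) simp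
  finally show "emeasure (distr lborel borel (reindex e)) (box l u) = ennreal (\<Prod>b\<in>Basis. (u - l) \<bullet> b)" .
qed simp

text \<open>Conjugation by \<open>e\<close> is a sign-preserving bijection between the permutations
  of the two index types, so the Leibniz sums agree term by term.\<close>

lemma det_reindex:
  fixes A :: "real^'b^'b" and e :: "'a::finite \<Rightarrow> 'b::finite"
  assumes e: "bij e"
  shows "det (\<chi> i j. A $ e i $ e j) = det A"
proof -
  let ?m = "map_permutation (UNIV :: 'a set) e"
  have m: "?m p = (\<lambda>x. e (p (inv e x)))" for p
    using e by (auto simp: map_permutation_def bij_def fun_eq_iff restrict_id_def)
  have bij: "bij_betw ?m {p. p permutes UNIV} {p. p permutes UNIV}"
  proof (rule bij_betw_byWitness[where f' = "\<lambda>q x. inv e (q (e x))"])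
    show "\<forall>p\<in>{p. p permutes UNIV}. (\<lambda>x. inv e (?m p (e x))) = p"
      using e by (simp add: m bij_def fun_eq_iff inv_f_f)
    show "\<forall>q\<in>{p. p permutes UNIV}. ?m (\<lambda>x. inv e (q (e x))) = q"
      using e by (simp add: m bij_def fun_eq_iff surj_f_inv_f)
    have c: "(\<lambda>x. inv e (q (e x))) = inv e \<circ> q \<circ> e" "?m p = e \<circ> p \<circ> inv e" for p q
      by (auto simp: m)
    show "?m ` {p. p permutes UNIV} \<subseteq> {p. p permutes UNIV}"
      using e by (auto simp: c(2) intro!: bij_imp_permutes bij_comp bij_imp_bij_inv dest: permutes_bij)
    show "(\<lambda>q x. inv e (q (e x))) ` {p. p permutes UNIV} \<subseteq> {p. p permutes UNIV}"
      using e by (auto simp: c(1) intro!: bij_imp_permutes bij_comp bij_imp_bij_inv dest: permutes_bij)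
  qed
  have "det A = (\<Sum>p | p permutes (UNIV::'a set). of_int (sign (?m p)) * (\<Prod>i\<in>UNIV. A $ i $ ?m p i))"
    unfolding det_def by (rule sum.reindex_bij_betw[OF bij, symmetric])
  also have "\<dots> = (\<Sum>p | p permutes (UNIV::'a set). of_int (sign p) * (\<Prod>i\<in>UNIV. A $ e i $ e (p i)))"
  proof (rule sum.cong[OF refl])
    fix p :: "'a \<Rightarrow> 'a" assume p: "p \<in> {p. p permutes UNIV}"
    have "(\<Prod>i\<in>UNIV. A $ i $ ?m p i) = (\<Prod>i\<in>UNIV. A $ e i $ ?m p (e i))"
      using e by (rule prod.reindex_bij_betw[symmetric])
    moreover have "sign (?m p) = sign p"
      using p e by (intro sign_map_permutation) (auto simp: bij_def)
    ultimately show "of_int (sign (?m p)) * (\<Prod>i\<in>UNIV. A $ i $ ?m p i) =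
        of_int (sign p) * (\<Prod>i\<in>UNIV. A $ e i $ e (p i))"
      using e by (simp add: m bij_def inv_f_f)
  qed
  also have "\<dots> = det (\<chi> i j. A $ e i $ e j)" by (simp add: det_def)
  finally show ?thesis by simp
qed

lemma nn_integral_change_of_variables_wellorder:
  fixes g :: "real^'m::{finite,wellorder} \<Rightarrow> real^'m::_" and \<phi> :: "real^'m::_ \<Rightarrow> real"
  assumes S: "S \<in> sets borel" and gS: "g ` S \<in> sets borel"
    and der: "\<And>x. x \<in> S \<Longrightarrow> (g has_derivative (\<lambda>h. A x *v h)) (at x)"
    and inj: "inj_on g S"
    and A[measurable]: "A \<in> borel_measurable borel" and g[measurable]: "g \<in> borel_measurable borel"
    and \<phi>: "integrable lborel \<phi>" "\<And>x. \<phi> x \<ge> 0"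
  shows "(\<integral>\<^sup>+y. ennreal (\<phi> y) * indicator (g ` S) y \<partial>lborel)
       = (\<integral>\<^sup>+x. ennreal (\<bar>det (A x)\<bar> * \<phi> (g x)) * indicator S x \<partial>lborel)"
proof -
  \<comment> \<open>The change of variables theorem is invoked for vector-valued functions, hence
    the passage to \<open>real^1\<close>; component 1 is the way back.\<close>
  define F where "F y = (vec (\<phi> y) :: real^1)" for y
  define G where "G x = \<bar>det (A x)\<bar> *\<^sub>R F (g x)" for x
  have [measurable]: "\<phi> \<in> borel_measurable borel" using \<phi>(1) by simp
  have [measurable]: "S \<in> sets borel" "g ` S \<in> sets borel" by fact+
  have [measurable]: "(\<lambda>x. det (A x)) \<in> borel_measurable borel"
    using A by (rule measurable_compose)
      (unfold det_def, intro borel_measurable_continuous_onI continuous_intros)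
  have lin: "bounded_linear (\<lambda>v :: real^1. v $ 1)" by (rule bounded_linear_vec_nth)
  have vec: "bounded_linear (vec :: real \<Rightarrow> real^1)"
    by (intro linear_conv_bounded_linear[THEN iffD1] linearI) (auto simp: vec_eq_iff)
  have "integrable lebesgue \<phi>" using \<phi>(1) by (simp add: integrable_completion)
  then have "integrable lebesgue F" unfolding F_def by (rule integrable_bounded_linear[OF vec])
  then have F: "F absolutely_integrable_on g ` S"
    unfolding set_integrable_def by (intro integrable_mult_indicator) auto
  have cv: "G absolutely_integrable_on S \<and> integral S G = b \<longleftrightarrow>
      F absolutely_integrable_on g ` S \<and> integral (g ` S) F = b" for b
    using has_absolute_integral_change_of_variables[of S g "\<lambda>x h. A x *v h" F b] S inj der
    by (simp add: G_def[abs_def] has_derivative_at_withinI)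
  then have G: "G absolutely_integrable_on S" and eq: "integral S G = integral (g ` S) F"
    using F by blast+
  \<comment> \<open>Translates the gauge integral over a set back into a nonnegative Lebesgue
    integral; both sides of the claim are read off with it.\<close>
  have conv: "(\<integral>\<^sup>+x. ennreal (H x $ 1) * indicator T x \<partial>lborel) = ennreal (integral T H $ 1)"
    if H: "H absolutely_integrable_on T" "\<And>x. H x $ 1 \<ge> 0" and [measurable]: "T \<in> sets borel"
      "(\<lambda>x. H x $ 1) \<in> borel_measurable borel"
    for H :: "real^'m::_ \<Rightarrow> real^1" and T
  proof -
    have i: "set_integrable lebesgue T (\<lambda>x. H x $ 1)"
      using integrable_bounded_linear[OF lin H(1)[unfolded set_integrable_def]]
      by (simp add: set_integrable_def)
    have "(\<integral>\<^sup>+x. ennreal (H x $ 1) * indicator T x \<partial>lborel) = (\<integral>\<^sup>+x. ennreal (indicator T x *\<^sub>R H x $ 1) \<partial>lebesgue)"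
      by (subst nn_integral_completion) (auto intro!: nn_integral_cong simp: indicator_def)
    also have "\<dots> = ennreal (LINT x:T|lebesgue. H x $ 1)"
      unfolding set_lebesgue_integral_def
      by (rule nn_integral_eq_integral) (use i H(2) in \<open>auto simp: set_integrable_def\<close>)
    also have "(LINT x:T|lebesgue. H x $ 1) = integral T (\<lambda>x. H x $ 1)"
      using i by (rule set_lebesgue_integral_eq_integral)
    also have "\<dots> = integral T H $ 1"
      using integral_linear[OF _ lin, of H T] set_lebesgue_integral_eq_integral(1)[OF H(1)]
      by (simp add: o_def)
    finally show ?thesis .
  qed
  have "(\<integral>\<^sup>+y. ennreal (\<phi> y) * indicator (g ` S) y \<partial>lborel) = ennreal (integral (g ` S) F $ 1)"
    using conv[OF F] gS \<phi>(2) by (simp add: F_def)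
  moreover have "(\<integral>\<^sup>+x. ennreal (\<bar>det (A x)\<bar> * \<phi> (g x)) * indicator S x \<partial>lborel) = ennreal (integral S G $ 1)"
    using conv[OF G] S \<phi>(2) by (simp add: F_def G_def)
  ultimately show ?thesis using eq by simp
qed

lemma nn_integral_change_of_variables:
  fixes g :: "real^'n \<Rightarrow> real^'n" and \<phi> :: "real^'n \<Rightarrow> real"
  assumes S: "S \<in> sets borel" and gS: "g ` S \<in> sets borel"
    and der: "\<And>x. x \<in> S \<Longrightarrow> (g has_derivative (\<lambda>h. A x *v h)) (at x)"
    and inj: "inj_on g S"
    and A[measurable]: "A \<in> borel_measurable borel" and g[measurable]: "g \<in> borel_measurable borel"
    and \<phi>: "integrable lborel \<phi>" "\<And>x. \<phi> x \<ge> 0"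
  shows "(\<integral>\<^sup>+y. ennreal (\<phi> y) * indicator (g ` S) y \<partial>lborel)
       = (\<integral>\<^sup>+x. ennreal (\<bar>det (A x)\<bar> * \<phi> (g x)) * indicator S x \<partial>lborel)"
proof -
  let ?e = "Rep_ordered :: 'n ordered \<Rightarrow> 'n"
  let ?P = "reindex ?e" and ?Q = "reindex (inv ?e)"
  note e = bij_Rep_ordered[where 'a = 'n]
  note PQ = reindex_inverse[OF e]
  define B :: "real^'n ordered \<Rightarrow> real^'n ordered^'n ordered"
    where "B y = (\<chi> i j. A (?Q y) $ ?e i $ ?e j)" for y
  \<comment> \<open>The conjugate of \<open>g\<close>. Its Jacobian matrix \<open>B\<close>
    reindexes rows and columns of \<open>A\<close> simultaneously, so \<open>det_reindex\<close>
    applies.\<close>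
  define k where "k y = ?P (g (?Q y))" for y
  have [measurable]: "\<phi> \<in> borel_measurable borel" using \<phi>(1) by simp
  have [measurable]: "S \<in> sets borel" "g ` S \<in> sets borel" by fact+
  have [measurable]: "(\<lambda>x. det (A x)) \<in> borel_measurable borel"
    using A by (rule measurable_compose)
      (unfold det_def, intro borel_measurable_continuous_onI continuous_intros)
  have im: "?P ` T = ?Q -` T" for T
    using PQ by (auto simp: image_iff) metis
  have kPS: "k ` (?P ` S) = ?P ` (g ` S)" by (auto simp: k_def PQ image_iff)
  have mem: "y \<in> k ` (?P ` S) \<longleftrightarrow> ?Q y \<in> g ` S" for y
    unfolding kPS im[of "g ` S"] by simp
  have QP: "distr lborel borel ?Q = lborel"
    by (rule distr_reindex_lborel) (simp add: e bij_imp_bij_inv)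
  have matB: "B y *v h = ?P (A (?Q y) *v ?Q h)" for y h
  proof (simp add: vec_eq_iff B_def matrix_vector_mult_def, rule allI)
    fix i
    show "(\<Sum>j\<in>UNIV. A (?Q y) $ ?e i $ ?e j * h $ j) = (\<Sum>j\<in>UNIV. A (?Q y) $ ?e i $ j * h $ inv ?e j)"
      using sum.reindex_bij_betw[OF e, of "\<lambda>j. A (?Q y) $ ?e i $ j * h $ inv ?e j"] e
      by (simp add: bij_def inv_f_f)
  qed
  have der': "(k has_derivative (\<lambda>h. B y *v h)) (at y)" if "y \<in> ?P ` S" for y
  proof -
    have y: "?Q y \<in> S" using that im by auto
    have 1: "(?Q has_derivative ?Q) (at y)"
      by (intro bounded_linear_imp_has_derivative linear_reindex[unfolded linear_conv_bounded_linear])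
    have 2: "((\<lambda>y. g (?Q y)) has_derivative (\<lambda>h. A (?Q y) *v ?Q h)) (at y)"
      by (rule has_derivative_compose[OF 1 der[OF y]])
    show ?thesis unfolding k_def matB
      by (rule bounded_linear.has_derivative[OF linear_reindex[unfolded linear_conv_bounded_linear] 2])
  qed
  have inj': "inj_on k (?P ` S)"
  proof (rule inj_onI)
    fix a b assume "a \<in> ?P ` S" "b \<in> ?P ` S" "k a = k b"
    moreover from \<open>k a = k b\<close> have "g (?Q a) = g (?Q b)" unfolding k_def by (metis PQ(2))
    ultimately show "a = b" using inj im by (metis PQ(1) inj_onD vimage_eq)
  qed
  have "(\<integral>\<^sup>+y. ennreal (\<phi> y) * indicator (g ` S) y \<partial>lborel)
      = (\<integral>\<^sup>+y. ennreal (\<phi> (?Q y)) * indicator (g ` S) (?Q y) \<partial>lborel)"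
    by (subst QP[symmetric], subst nn_integral_distr) auto
  also have "\<dots> = (\<integral>\<^sup>+y. ennreal (\<phi> (?Q y)) * indicator (k ` (?P ` S)) y \<partial>lborel)"
    by (simp only: indicator_def mem)
  also have "\<dots> = (\<integral>\<^sup>+x. ennreal (\<bar>det (B x)\<bar> * \<phi> (?Q (k x))) * indicator (?P ` S) x \<partial>lborel)"
  proof (rule nn_integral_change_of_variables_wellorder[where \<phi> = "\<lambda>y. \<phi> (?Q y)"])
    show "?P ` S \<in> sets borel" by (simp only: im measurable_sets_borel[OF reindex_borel] S)
    show "k ` ?P ` S \<in> sets borel"
      unfolding kPS by (simp only: im measurable_sets_borel[OF reindex_borel] gS)
    have "(\<lambda>C :: real^'n^'n. \<chi> i j. C $ ?e i $ ?e j) \<in> borel_measurable borel"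
      by (intro borel_measurable_continuous_onI continuous_intros)
    then show "B \<in> borel_measurable borel" unfolding B_def
      by (rule measurable_compose[OF measurable_compose[OF reindex_borel A]])
    show "k \<in> borel_measurable borel" unfolding k_def by measurable
    show "integrable lborel (\<lambda>y. \<phi> (?Q y))"
      using \<phi>(1) by (subst (asm) QP[symmetric], subst (asm) integrable_distr_eq) auto
  qed (use der' inj' \<phi>(2) in auto)
  also have "\<dots> = (\<integral>\<^sup>+x. ennreal (\<bar>det (A (?Q x))\<bar> * \<phi> (g (?Q x))) * indicator S (?Q x) \<partial>lborel)"
    unfolding im B_def det_reindex[OF e] by (simp add: k_def PQ indicator_def)
  also have "\<dots> = (\<integral>\<^sup>+x. ennreal (\<bar>det (A x)\<bar> * \<phi> (g x)) * indicator S x \<partial>lborel)"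
    by (subst QP[symmetric], subst nn_integral_distr) auto
  finally show ?thesis .
qed

lemma det_scaleR_matrix:
  fixes A :: "real^'n^'n"
  shows "det (c *\<^sub>R A) = c ^ CARD('n) * det A"
proof -
  have "c *\<^sub>R A = (\<chi> i. c *s A $ i)" by (simp add: vec_eq_iff)
  then show ?thesis using det_rows_mul[of "\<lambda>_. c" "\<lambda>i. A $ i"] by simp
qed

subsection \<open>Gaussian vectors\<close>

lemma nn_integral_exp_square:
  fixes a :: real
  assumes a: "a > 0"
  shows "(\<integral>\<^sup>+x. ennreal (exp (- (a / 2) * x\<^sup>2)) \<partial>lborel) = ennreal (sqrt (2 * pi / a))"
proof -
  let ?s = "1 / sqrt a"
  have s: "?s > 0" "?s\<^sup>2 = 1 / a" using a by (auto simp: power_divide)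
  interpret prob_space "density lborel (normal_density 0 ?s)"
    by (rule prob_space_normal_density) (rule s)
  have "1 = (\<integral>\<^sup>+x. ennreal (normal_density 0 ?s x) \<partial>lborel)"
    using emeasure_space_1 by (simp add: emeasure_density)
  then have "ennreal (sqrt (2 * pi / a))
      = (\<integral>\<^sup>+x. ennreal (sqrt (2 * pi / a)) * ennreal (normal_density 0 ?s x) \<partial>lborel)"
    by (simp add: nn_integral_cmult)
  also have "\<dots> = (\<integral>\<^sup>+x. ennreal (exp (- (a / 2) * x\<^sup>2)) \<partial>lborel)"
    using a by (intro nn_integral_cong) (simp add: ennreal_mult'[symmetric] normal_density_def s field_simps)
  finally show ?thesis by simp
qed

lemma nn_integral_exp_norm_square:
  fixes a :: real
  assumes a: "a > 0"
  shows "(\<integral>\<^sup>+w. ennreal (exp (- (a / 2) * (norm (w :: real^'n))\<^sup>2)) \<partial>lborel)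
    = ennreal (sqrt (2 * pi / a) ^ CARD('n))"
proof -
  have "exp (- (a / 2) * (norm w)\<^sup>2) = (\<Prod>b\<in>Basis. exp (- (a / 2) * (w \<bullet> b)\<^sup>2))" for w :: "real^'n"
    by (subst power2_norm_eq_inner, subst euclidean_inner)
      (simp add: sum_distrib_left exp_sum power2_eq_square)
  then have "(\<integral>\<^sup>+w. ennreal (exp (- (a / 2) * (norm (w :: real^'n))\<^sup>2)) \<partial>lborel)
      = (\<integral>\<^sup>+w. (\<Prod>b\<in>Basis. ennreal (exp (- (a / 2) * ((w :: real^'n) \<bullet> b)\<^sup>2))) \<partial>lborel)"
    by (simp add: prod_ennreal)
  also have "\<dots> = (\<Prod>b\<in>(Basis :: (real^'n) set). (\<integral>\<^sup>+x. ennreal (exp (- (a / 2) * x\<^sup>2)) \<partial>lborel))"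
    by (rule nn_integral_lborel_prod) auto
  also have "\<dots> = ennreal (sqrt (2 * pi / a) ^ CARD('n))"
    unfolding nn_integral_exp_square[OF a] using a by (simp add: ennreal_power)
  finally show ?thesis .
qed

text \<open>The normal density with covariance identity over d, as a function of the norm of
  \<open>w\<close> alone.\<close>

definition gauss_density :: "real^'n \<Rightarrow> real" where
  "gauss_density w = sqrt (real CARD('n) / (2 * pi)) ^ CARD('n)
     * exp (- (real CARD('n) / 2) * (norm w)\<^sup>2)"

lemma gauss_density_pos: "gauss_density w > 0"
  by (simp add: gauss_density_def)

lemma gauss_density_borel [measurable]: "gauss_density \<in> borel_measurable borel"
  unfolding gauss_density_def by measurable

lemma gauss_vec_eq: "gauss_vec = density lborel (\<lambda>w :: real^'n. ennreal (gauss_density w))"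
proof -
  have "(\<Prod>i\<in>UNIV. ennreal (normal_density 0 (sqrt (1 / real CARD('n))) (w $ i)))
      = ennreal (gauss_density w)" for w :: "real^'n"
  proof -
    have "normal_density 0 (sqrt (1 / real CARD('n))) x
        = sqrt (real CARD('n) / (2 * pi)) * exp (- (real CARD('n) / 2) * x\<^sup>2)" for x
      by (simp add: normal_density_def real_sqrt_divide field_simps)
    moreover have "(norm w)\<^sup>2 = (\<Sum>i\<in>UNIV. (w $ i)\<^sup>2)"
      by (simp only: power2_norm_eq_inner inner_vec_def) (simp add: power2_eq_square)
    ultimately have "(\<Prod>i\<in>UNIV. normal_density 0 (sqrt (1 / real CARD('n))) (w $ i)) = gauss_density w"
      by (simp only: gauss_density_def prod.distrib prod_constant
          sum_distrib_left exp_sum finite_class.finite_UNIV)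
    then show ?thesis by (subst prod_ennreal) auto
  qed
  then show ?thesis by (simp add: gauss_vec_def)
qed

lemma sets_gauss_vec [measurable_cong, simp]: "sets gauss_vec = sets borel"
  and space_gauss_vec [simp]: "space gauss_vec = UNIV"
  by (simp_all add: gauss_vec_eq)

text \<open>Tilting a Gaussian of precision d by s|w|^2/2 leaves a Gaussian integral of precision d
  - s; the value is the ratio of the normalising constants.\<close>

lemma gauss_vec_exp_square:
  fixes s :: real
  assumes s: "s < real CARD('n)"
  shows "(\<integral>\<^sup>+w. ennreal (exp (s / 2 * (norm (w :: real^'n))\<^sup>2)) \<partial>gauss_vec)
    = ennreal (sqrt (real CARD('n) / (real CARD('n) - s)) ^ CARD('n))"
proof -
  let ?d = "real CARD('n)"
  have "(\<integral>\<^sup>+w. ennreal (exp (s / 2 * (norm (w :: real^'n))\<^sup>2)) \<partial>gauss_vec)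
     = (\<integral>\<^sup>+w. ennreal (sqrt (?d / (2 * pi)) ^ CARD('n))
        * ennreal (exp (- ((?d - s) / 2) * (norm (w :: real^'n))\<^sup>2)) \<partial>lborel)"
    unfolding gauss_vec_eq
    by (subst nn_integral_density, simp, simp, intro nn_integral_cong)
      (simp add: gauss_density_def ennreal_mult'[symmetric] mult.assoc exp_add[symmetric] field_simps)
  also have "\<dots> = ennreal (sqrt (?d / (2 * pi)) ^ CARD('n)) * ennreal (sqrt (2 * pi / (?d - s)) ^ CARD('n))"
    using s by (subst nn_integral_cmult, simp, subst nn_integral_exp_norm_square) auto
  also have "\<dots> = ennreal ((sqrt (?d / (2 * pi)) * sqrt (2 * pi / (?d - s))) ^ CARD('n))"
    by (simp add: ennreal_mult'[symmetric] power_mult_distrib)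
  also have "sqrt (?d / (2 * pi)) * sqrt (2 * pi / (?d - s)) = sqrt (?d / (?d - s))"
    by (simp add: real_sqrt_mult[symmetric])
  finally show ?thesis .
qed

lemma prob_space_gauss_vec: "prob_space (gauss_vec :: (real^'n) measure)"
proof
  show "emeasure (gauss_vec :: (real^'n) measure) (space gauss_vec) = 1"
    using gauss_vec_exp_square[where s = 0 and 'n = 'n] by simp
qed

lemma integrable_gauss_density: "integrable lborel (gauss_density :: real^'n \<Rightarrow> real)"
proof (rule integrableI_nonneg)
  interpret prob_space "gauss_vec :: (real^'n) measure" by (rule prob_space_gauss_vec)
  show "(\<integral>\<^sup>+w. ennreal (gauss_density (w :: real^'n)) \<partial>lborel) < \<infinity>"
    using emeasure_space_1 by (simp add: gauss_vec_eq emeasure_density)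
qed (auto intro!: always_eventually less_imp_le[OF gauss_density_pos])

text \<open>Reduces to the quadratic moment by 2|w| \<le> 1 + |w|^2. The remaining factor (1 -
  s/d)^(-d/2) is at most exp s in every dimension, by Bernoulli's inequality (1 - s/d)^d \<ge> 1 - s
  and by (1 - s)(1 + 2s) \<ge> 1.\<close>

lemma gauss_vec_exp_norm:
  fixes s :: real
  assumes s: "0 \<le> s" "s \<le> 1/3"
  shows "(\<integral>\<^sup>+w. ennreal (exp (s * norm (w :: real^'n))) \<partial>gauss_vec) \<le> ennreal (exp (3 * s / 2))"
proof -
  let ?d = "real CARD('n)"
  have d: "?d \<ge> 1" by (simp add: Suc_leI)
  have sd: "s < ?d" using d s by linarith
  have le: "exp (s * norm w) \<le> exp (s / 2) * exp (s / 2 * (norm w)\<^sup>2)" for w :: "real^'n"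
  proof -
    have "2 * norm w \<le> 1 + (norm w)\<^sup>2"
      using zero_le_power2[of "1 - norm w"] by (simp add: power2_eq_square algebra_simps)
    then have "s * (2 * norm w) \<le> s * (1 + (norm w)\<^sup>2)" using s by (intro mult_left_mono)
    then show ?thesis by (simp add: exp_add[symmetric] algebra_simps)
  qed
  have "(\<integral>\<^sup>+w. ennreal (exp (s * norm (w :: real^'n))) \<partial>gauss_vec)
      \<le> (\<integral>\<^sup>+w. ennreal (exp (s / 2)) * ennreal (exp (s / 2 * (norm (w :: real^'n))\<^sup>2)) \<partial>gauss_vec)"
    using le by (intro nn_integral_mono) (simp add: ennreal_mult'[symmetric])
  also have "\<dots> = ennreal (exp (s / 2)) * ennreal (sqrt (?d / (?d - s)) ^ CARD('n))"
    using sd by (subst nn_integral_cmult, simp, subst gauss_vec_exp_square) auto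
  also have "\<dots> = ennreal (exp (s / 2) * sqrt (?d / (?d - s)) ^ CARD('n))"
    by (simp add: ennreal_mult'[symmetric])
  also have "\<dots> \<le> ennreal (exp (3 * s / 2))"
  proof (rule ennreal_leI)
    have sd': "s / ?d \<le> 1" using sd d by (simp add: divide_le_eq_1)
    have "1 - s \<le> (1 - s / ?d) ^ CARD('n)"
      using Bernoulli_inequality[of "- (s / ?d)" "CARD('n)"] sd' d by simp
    moreover have "1 \<le> (1 - s) * exp (2 * s)"
    proof -
      have "1 \<le> (1 - s) * (1 + 2 * s)"
        using s mult_nonneg_nonneg[of s "1 - 2 * s"] by (simp add: algebra_simps)
      also have "\<dots> \<le> (1 - s) * exp (2 * s)" using s by (intro mult_left_mono) auto
      finally show ?thesis .
    qed
    ultimately have "1 \<le> (1 - s / ?d) ^ CARD('n) * exp (2 * s)"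
      by (smt (verit) exp_gt_zero mult_right_mono)
    moreover have pos: "(1 - s / ?d) ^ CARD('n) > 0" using sd d by (intro zero_less_power) (simp add: divide_less_eq_1)
    ultimately have "(1 / (1 - s / ?d)) ^ CARD('n) \<le> exp (2 * s)"
      by (simp add: power_one_over field_simps)
    moreover have "?d / (?d - s) = 1 / (1 - s / ?d)" using sd d by (simp add: field_simps)
    ultimately have "sqrt ((?d / (?d - s)) ^ CARD('n)) \<le> sqrt (exp (2 * s))" by simp
    also have "sqrt (exp (2 * s)) = exp s"
      by (simp add: real_sqrt_unique exp_double)
    finally have "sqrt (?d / (?d - s)) ^ CARD('n) \<le> exp s" by (simp add: real_sqrt_power)
    then have "exp (s / 2) * sqrt (?d / (?d - s)) ^ CARD('n) \<le> exp (s / 2) * exp s" by simp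
    then show "exp (s / 2) * sqrt (?d / (?d - s)) ^ CARD('n) \<le> exp (3 * s / 2)"
      by (simp add: exp_add[symmetric])
  qed
  finally show ?thesis .
qed

text \<open>Jensen's inequality for the exponential in tangent line form: exp u \<ge> 1 + u at u = Y
  - k. Adding 1 on both sides avoids a negative integrand.\<close>

lemma (in prob_space) nn_integral_le_of_exp_bound:
  fixes Y :: "'a \<Rightarrow> real"
  assumes [measurable]: "Y \<in> borel_measurable M" and Y: "\<And>x. x \<in> space M \<Longrightarrow> Y x \<ge> 0"
    and bd: "(\<integral>\<^sup>+x. ennreal (exp (Y x)) \<partial>M) \<le> ennreal (exp k)" and k: "k \<ge> 0"
  shows "(\<integral>\<^sup>+x. ennreal (Y x) \<partial>M) \<le> ennreal k"
proof -
  have le: "Y x + 1 \<le> k + exp (- k) * exp (Y x)" for x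
    using exp_ge_add_one_self[of "Y x - k"] by (simp add: exp_diff exp_minus field_simps)
  have "(\<integral>\<^sup>+x. ennreal (Y x) \<partial>M) + 1 = (\<integral>\<^sup>+x. ennreal (Y x) + 1 \<partial>M)"
    by (simp add: nn_integral_add emeasure_space_1)
  also have "\<dots> \<le> (\<integral>\<^sup>+x. ennreal k + ennreal (exp (- k)) * ennreal (exp (Y x)) \<partial>M)"
  proof (rule nn_integral_mono)
    fix x assume x: "x \<in> space M"
    have "ennreal (Y x) + 1 = ennreal (Y x + 1)" using Y[OF x] by (simp add: ennreal_plus)
    also have "\<dots> \<le> ennreal (k + exp (- k) * exp (Y x))" by (intro ennreal_leI le)
    also have "\<dots> = ennreal k + ennreal (exp (- k)) * ennreal (exp (Y x))"
      using k by (simp add: ennreal_plus ennreal_mult')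
    finally show "ennreal (Y x) + 1 \<le> ennreal k + ennreal (exp (- k)) * ennreal (exp (Y x))" .
  qed
  also have "\<dots> = ennreal k + ennreal (exp (- k)) * (\<integral>\<^sup>+x. ennreal (exp (Y x)) \<partial>M)"
    by (simp add: nn_integral_add nn_integral_cmult emeasure_space_1)
  also have "\<dots> \<le> ennreal k + ennreal (exp (- k)) * ennreal (exp k)"
    by (intro add_left_mono mult_left_mono bd) auto
  also have "\<dots> = ennreal k + 1" by (simp add: ennreal_mult'[symmetric] exp_minus)
  finally have "1 + (\<integral>\<^sup>+x. ennreal (Y x) \<partial>M) \<le> 1 + ennreal k" by (simp only: add.commute)
  then show ?thesis by (simp only: ennreal_add_left_cancel_le) simp
qed

subsection \<open>Lower integrals and measurable minorants\<close>

text \<open>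
  The suprema in Assumption 3 need not be measurable, and for a non-measurable function
  \<^const>\<open>nn_integral\<close> is the lower integral. A maximal measurable minorant has the same lower
  integral and almost everywhere dominates all measurable functions below the given one.
\<close>

lemma measurable_minorant:
  fixes u :: "'a \<Rightarrow> ennreal"
  obtains v where "v \<in> borel_measurable M" "\<And>x. x \<in> space M \<Longrightarrow> v x \<le> u x"
    "(\<integral>\<^sup>+x. v x \<partial>M) = (\<integral>\<^sup>+x. u x \<partial>M)"
proof -
  let ?A = "integral\<^sup>S M ` {g. simple_function M g \<and> g \<le> u}"
  have "(\<lambda>_. 0) \<in> {g. simple_function M g \<and> g \<le> u}" by (simp add: le_fun_def)
  then have "?A \<noteq> {}" by blast
  \<comment> \<open>Countably many simple functions already exhaust the lower integral; their
    pointwise supremum \<open>v\<close> is measurable and still below \<open>u\<close>.\<close>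
  from ennreal_Sup_countable_SUP[OF this] obtain F :: "nat \<Rightarrow> ennreal"
    where F: "range F \<subseteq> ?A" "Sup ?A = (SUP i. F i)" by blast
  then have "\<forall>i. \<exists>g. simple_function M g \<and> g \<le> u \<and> F i = integral\<^sup>S M g" by (auto simp: image_subset_iff)
  then obtain g where g: "\<And>i. simple_function M (g i)" "\<And>i. g i \<le> u" "\<And>i. F i = integral\<^sup>S M (g i)"
    by metis
  have [measurable]: "g i \<in> borel_measurable M" for i
    using g(1) by (rule borel_measurable_simple_function)
  define v where "v x = (SUP i. g i x)" for x
  have [measurable]: "v \<in> borel_measurable M" unfolding v_def by measurable
  have vu: "v x \<le> u x" for x using g(2) by (auto simp: v_def le_fun_def intro: SUP_least)
  have "(\<integral>\<^sup>+x. u x \<partial>M) = (SUP i. F i)" using F(2) by (simp add: nn_integral_def)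
  also have "\<dots> \<le> (\<integral>\<^sup>+x. v x \<partial>M)"
  proof (rule SUP_least)
    fix i
    have "F i = (\<integral>\<^sup>+x. g i x \<partial>M)" using g(1,3) by (simp add: nn_integral_eq_simple_integral)
    also have "\<dots> \<le> (\<integral>\<^sup>+x. v x \<partial>M)" by (intro nn_integral_mono) (auto simp: v_def intro: SUP_upper)
    finally show "F i \<le> (\<integral>\<^sup>+x. v x \<partial>M)" .
  qed
  finally have le: "(\<integral>\<^sup>+x. u x \<partial>M) \<le> (\<integral>\<^sup>+x. v x \<partial>M)" .
  have "(\<integral>\<^sup>+x. v x \<partial>M) \<le> (\<integral>\<^sup>+x. u x \<partial>M)" by (intro nn_integral_mono vu)
  with le have "(\<integral>\<^sup>+x. v x \<partial>M) = (\<integral>\<^sup>+x. u x \<partial>M)" by (rule antisym[rotated])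
  with vu show ?thesis by (intro that[of v]) auto
qed

text \<open>The maximum of \<open>h\<close> and \<open>v\<close> is again a measurable function
  below \<open>u\<close>, so its integral cannot exceed that of \<open>v\<close>. As this integral
  is finite, the nonnegative difference vanishes almost everywhere.\<close>

lemma measurable_minorant_maximal:
  fixes u v h :: "'a \<Rightarrow> ennreal"
  assumes [measurable]: "v \<in> borel_measurable M" "h \<in> borel_measurable M"
    and v: "\<And>x. x \<in> space M \<Longrightarrow> v x \<le> u x" "(\<integral>\<^sup>+x. v x \<partial>M) = (\<integral>\<^sup>+x. u x \<partial>M)"
    and h: "\<And>x. x \<in> space M \<Longrightarrow> h x \<le> u x" and fin: "(\<integral>\<^sup>+x. u x \<partial>M) < \<infinity>"
  shows "AE x in M. h x \<le> v x"
proof -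
  let ?m = "\<lambda>x. max (h x) (v x)"
  have fin': "(\<integral>\<^sup>+x. v x \<partial>M) \<noteq> \<infinity>" using v(2) fin by auto
  have "(\<integral>\<^sup>+x. ?m x - v x \<partial>M) = (\<integral>\<^sup>+x. ?m x \<partial>M) - (\<integral>\<^sup>+x. v x \<partial>M)"
    by (rule nn_integral_diff) (use fin' in auto)
  also have "(\<integral>\<^sup>+x. ?m x \<partial>M) \<le> (\<integral>\<^sup>+x. v x \<partial>M)"
    unfolding v(2) by (intro nn_integral_mono) (use v(1) h in auto)
  then have "(\<integral>\<^sup>+x. ?m x \<partial>M) - (\<integral>\<^sup>+x. v x \<partial>M) = 0"
    using fin' by (intro diff_eq_0_ennreal) (auto simp: less_top top_unique)
  finally have "AE x in M. ?m x - v x = 0" by (subst (asm) nn_integral_0_iff_AE) auto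
  moreover have "AE x in M. v x \<noteq> \<infinity>" using fin' by (intro nn_integral_PInf_AE) auto
  ultimately show ?thesis
  proof eventually_elim
    case (elim x)
    then have "?m x \<le> v x" by (simp add: diff_eq_0_iff_ennreal)
    then show ?case by simp
  qed
qed

text \<open>By Markov's inequality the sets where \<open>h\<close> is at least 1/(n+1) have finite
  measure, and positivity makes them cover the space. Applied to the density at
  \<open>\<theta>0\<close>, this gives the sigma-finiteness that Fubini's theorem requires of the
  base measure.\<close>

lemma sigma_finite_positive_density:
  fixes h :: "'a \<Rightarrow> real"
  assumes [measurable]: "h \<in> borel_measurable M" and pos: "\<And>x. x \<in> space M \<Longrightarrow> h x > 0"
    and fin: "(\<integral>\<^sup>+x. ennreal (h x) \<partial>M) < \<infinity>"
  shows "sigma_finite_measure M"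
proof
  define A where "A n = {x \<in> space M. 1 \<le> ennreal (real (Suc n)) * ennreal (h x)}" for n
  have [measurable]: "A n \<in> sets M" for n unfolding A_def by measurable
  have "emeasure M (A n) \<noteq> \<infinity>" for n
  proof -
    have "emeasure M (A n) \<le> ennreal (real (Suc n)) * (\<integral>\<^sup>+x. ennreal (h x) * indicator (space M) x \<partial>M)"
      unfolding A_def by (rule nn_integral_Markov_inequality) auto
    also have "(\<integral>\<^sup>+x. ennreal (h x) * indicator (space M) x \<partial>M) = (\<integral>\<^sup>+x. ennreal (h x) \<partial>M)"
      by (intro nn_integral_cong) simp
    also have "ennreal (real (Suc n)) * \<dots> < \<infinity>" using fin by (simp add: ennreal_mult_less_top del: of_nat_Suc)
    finally show ?thesis by simp
  qed
  moreover have "\<Union>(range A) = space M"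
  proof (rule antisym)
    show "space M \<subseteq> \<Union>(range A)"
    proof
      fix x assume x: "x \<in> space M"
      obtain n where "inverse (real (Suc n)) < h x" using reals_Archimedean pos[OF x] by blast
      then have "1 \<le> real (Suc n) * h x" by (simp add: inverse_eq_divide divide_less_eq mult.commute)
      then have "x \<in> A n" using x pos[OF x] by (simp add: A_def ennreal_mult'[symmetric] del: of_nat_Suc)
      then show "x \<in> \<Union>(range A)" by blast
    qed
  qed (auto simp: A_def)
  ultimately show "\<exists>A. countable A \<and> A \<subseteq> sets M \<and> \<Union>A = space M \<and> (\<forall>a\<in>A. emeasure M a \<noteq> \<infinity>)"
    by (intro exI[of _ "range A"]) auto
qed

text \<open>\<open>u\<close> may be non-measurable, and then a finite lower integral does not in
  general make it finite almost everywhere. One point of finiteness is still available, and this is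
  what \<open>curvature_separation\<close> consumes.\<close>

lemma (in prob_space) exists_finite_of_nn_integral:
  fixes u :: "'a \<Rightarrow> ennreal"
  assumes "(\<integral>\<^sup>+x. u x \<partial>M) < \<infinity>"
  shows "\<exists>x\<in>space M. u x < \<infinity>"
proof (rule ccontr)
  assume "\<not> (\<exists>x\<in>space M. u x < \<infinity>)"
  then have "u x = \<infinity>" if "x \<in> space M" for x using that by (metis infinity_ennreal_def top.not_eq_extremum)
  then have "(\<integral>\<^sup>+x. u x \<partial>M) = (\<integral>\<^sup>+x. \<infinity> \<partial>M)" by (intro nn_integral_cong) auto
  also have "\<dots> = \<infinity>" by (simp add: emeasure_space_1)
  finally show False using assms by simp
qed

subsection \<open>Exchangeable laws, total variation and p-values\<close>

lemma space_tuple_space: "space (tuple_space MX M) = {..M} \<rightarrow>\<^sub>E space MX"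
  by (simp add: tuple_space_def space_PiM)

lemma tuple_space_component:
  "i \<le> M \<Longrightarrow> (\<lambda>z. z i) \<in> tuple_space MX M \<rightarrow>\<^sub>M MX"
  unfolding tuple_space_def by (rule measurable_component_singleton) simp

lemma permute_tuple_measurable:
  assumes "\<pi> permutes {..M}"
  shows "(\<lambda>z. \<lambda>i\<in>{..M}. z (\<pi> i)) \<in> tuple_space MX M \<rightarrow>\<^sub>M tuple_space MX M"
  unfolding tuple_space_def
  by (rule measurable_restrict, rule measurable_component_singleton)
    (metis permutes_in_image[OF assms])

lemma const_tuple_measurable [measurable]:
  "(\<lambda>x. \<lambda>i\<in>{..M}. x) \<in> MX \<rightarrow>\<^sub>M tuple_space MX M"
  unfolding tuple_space_def by (rule measurable_restrict) simp

lemma exchangeable_emeasure: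
  assumes "exchangeable_law MX M B" "\<pi> permutes {..M}" "A \<in> sets (tuple_space MX M)"
  shows "emeasure B ((\<lambda>z. \<lambda>i\<in>{..M}. z (\<pi> i)) -` A \<inter> space (tuple_space MX M)) = emeasure B A"
proof -
  have s: "sets B = sets (tuple_space MX M)" using assms(1) by (simp add: exchangeable_law_def)
  have "emeasure B A = emeasure (distr B (tuple_space MX M) (\<lambda>z. \<lambda>i\<in>{..M}. z (\<pi> i))) A"
    using assms by (simp add: exchangeable_law_def)
  also have "\<dots> = emeasure B ((\<lambda>z. \<lambda>i\<in>{..M}. z (\<pi> i)) -` A \<inter> space B)"
    using assms permute_tuple_measurable[OF assms(2)] s
    by (subst emeasure_distr) (auto simp: measurable_cong_sets[OF s refl])
  finally show ?thesis using sets_eq_imp_space_eq[OF s] by simp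
qed

lemma exchangeable_lawI:
  assumes "prob_space B" and s: "sets B = sets (tuple_space MX M)"
    and "\<And>\<pi> A. \<pi> permutes {..M} \<Longrightarrow> A \<in> sets (tuple_space MX M) \<Longrightarrow>
      emeasure B ((\<lambda>z. \<lambda>i\<in>{..M}. z (\<pi> i)) -` A \<inter> space (tuple_space MX M)) = emeasure B A"
  shows "exchangeable_law MX M B"
  unfolding exchangeable_law_def
proof (intro conjI allI impI)
  fix \<pi> assume p: "\<pi> permutes {..M}"
  show "distr B (tuple_space MX M) (\<lambda>z. \<lambda>i\<in>{..M}. z (\<pi> i)) = B"
  proof (rule measure_eqI)
    fix A assume "A \<in> sets (distr B (tuple_space MX M) (\<lambda>z. \<lambda>i\<in>{..M}. z (\<pi> i)))"
    then have "A \<in> sets (tuple_space MX M)" by simp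
    then show "emeasure (distr B (tuple_space MX M) (\<lambda>z. \<lambda>i\<in>{..M}. z (\<pi> i))) A = emeasure B A"
      using assms(3)[OF p] permute_tuple_measurable[OF p] sets_eq_imp_space_eq[OF s]
      by (subst emeasure_distr) (auto simp: measurable_cong_sets[OF s refl])
  qed (simp add: s)
qed fact+

lemma exchangeable_return:
  assumes x: "x \<in> space MX"
  shows "exchangeable_law MX M (return (tuple_space MX M) (\<lambda>i\<in>{..M}. x))"
proof (rule exchangeable_lawI)
  have c: "(\<lambda>i\<in>{..M}. x) \<in> space (tuple_space MX M)"
    using x by (auto simp: space_tuple_space)
  then show "prob_space (return (tuple_space MX M) (\<lambda>i\<in>{..M}. x))" by (rule prob_space_return)
  fix \<pi> A assume p: "\<pi> permutes {..M}" and A: "A \<in> sets (tuple_space MX M)"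
  have e: "(\<lambda>i\<in>{..M}. (\<lambda>i\<in>{..M}. x) (\<pi> i)) = (\<lambda>i\<in>{..M}. x)"
    by (rule restrict_ext) (use permutes_in_image[OF p] in force)
  show "emeasure (return (tuple_space MX M) (\<lambda>i\<in>{..M}. x))
      ((\<lambda>z. \<lambda>i\<in>{..M}. z (\<pi> i)) -` A \<inter> space (tuple_space MX M))
    = emeasure (return (tuple_space MX M) (\<lambda>i\<in>{..M}. x)) A"
    unfolding emeasure_return[OF A] emeasure_return[OF measurable_sets[OF permute_tuple_measurable[OF p] A]]
    using c by (simp only: indicator_def Int_iff vimage_eq e simp_thms)
qed simp

lemma exchangeable_bind:
  assumes Q: "prob_space Q" and K: "K \<in> Q \<rightarrow>\<^sub>M prob_algebra (tuple_space MX M)"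
    and ex: "\<And>q. q \<in> space Q \<Longrightarrow> exchangeable_law MX M (K q)"
  shows "exchangeable_law MX M (Q \<bind> K)"
proof (rule exchangeable_lawI)
  have QP: "Q \<in> space (prob_algebra Q)" using Q by (simp add: space_prob_algebra)
  show "prob_space (Q \<bind> K)" by (rule prob_space_bind'[OF QP K])
  show "sets (Q \<bind> K) = sets (tuple_space MX M)" by (rule sets_bind'[OF QP K])
  fix \<pi> A assume p: "\<pi> permutes {..M}" and A: "A \<in> sets (tuple_space MX M)"
  show "emeasure (Q \<bind> K) ((\<lambda>z. \<lambda>i\<in>{..M}. z (\<pi> i)) -` A \<inter> space (tuple_space MX M))
      = emeasure (Q \<bind> K) A"
    unfolding emeasure_bind_prob_algebra[OF QP K A]
      emeasure_bind_prob_algebra[OF QP K measurable_sets[OF permute_tuple_measurable[OF p] A]]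
    by (intro nn_integral_cong exchangeable_emeasure ex p A)
qed

lemma dTV_nonneg:
  assumes "prob_space \<mu>" "prob_space \<nu>"
  shows "dTV \<mu> \<nu> \<ge> 0"
  unfolding dTV_def
proof (rule cSUP_upper2[where x = "{}"])
  have "\<bar>measure \<mu> A - measure \<nu> A\<bar> \<le> 1" for A
    using prob_space.prob_le_1[OF assms(1), of A] prob_space.prob_le_1[OF assms(2), of A]
      measure_nonneg[of \<mu> A] measure_nonneg[of \<nu> A] by linarith
  then show "bdd_above ((\<lambda>A. \<bar>measure \<mu> A - measure \<nu> A\<bar>) ` sets \<mu>)"
    by (intro bdd_aboveI2)
qed auto

text \<open>Passing to the complement reverses the inequality, so a one-sided bound on all events
  controls the absolute difference.\<close>

lemma dTV_le:
  assumes P: "prob_space \<mu>" "prob_space \<nu>" and s: "sets \<nu> = sets \<mu>"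
    and le: "\<And>A. A \<in> sets \<mu> \<Longrightarrow> measure \<mu> A \<le> measure \<nu> A + D"
  shows "dTV \<mu> \<nu> \<le> D"
  unfolding dTV_def
proof (rule cSUP_least)
  fix A assume A: "A \<in> sets \<mu>"
  then have "space \<mu> - A \<in> sets \<mu>" by blast
  from le[OF this] have "1 - measure \<mu> A \<le> 1 - measure \<nu> A + D"
    using prob_space.prob_compl[OF P(1) A] prob_space.prob_compl[OF P(2), of A] A s
      sets_eq_imp_space_eq[OF s] by simp
  with le[OF A] show "\<bar>measure \<mu> A - measure \<nu> A\<bar> \<le> D" by linarith
qed auto

lemma dexch_le:
  assumes "prob_space \<mu>" "exchangeable_law MX M B"
  shows "dexch MX M \<mu> \<le> dTV \<mu> B"
  unfolding dexch_def
  by (rule cINF_lower[OF bdd_belowI2[where m = 0]])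
    (use assms in \<open>auto simp: exchangeable_law_def intro!: dTV_nonneg\<close>)

text \<open>The index set is contained in the upper level set of its own member with smallest
  \<open>t\<close>, and membership bounds the size of that level set by \<open>c\<close>.\<close>

lemma card_small_rank:
  fixes t :: "nat \<Rightarrow> real" and c :: real
  assumes "c \<ge> 0"
  shows "real (card {j \<in> {..M}. real (card {m \<in> {..M}. t j \<le> t m}) \<le> c}) \<le> c"
proof (cases "{j \<in> {..M}. real (card {m \<in> {..M}. t j \<le> t m}) \<le> c} = {}")
  case True
  then show ?thesis using assms by (metis card.empty of_nat_0)
next
  case False
  let ?J = "{j \<in> {..M}. real (card {m \<in> {..M}. t j \<le> t m}) \<le> c}"
  have fin: "finite ?J" by simp
  obtain j where j: "j \<in> ?J" "\<And>i. i \<in> ?J \<Longrightarrow> t j \<le> t i"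
    using arg_min_if_finite(1)[OF fin False] arg_min_least[OF fin False] by (rule that)
  then have "?J \<subseteq> {m \<in> {..M}. t j \<le> t m}" by blast
  then have "card ?J \<le> card {m \<in> {..M}. t j \<le> t m}" by (intro card_mono) auto
  then show ?thesis using j(1) by simp
qed

text \<open>Exchangeability gives each of the M + 1 entries the same probability of having rank at
  most \<alpha>(M + 1), while at most that many entries can have such a rank at once.\<close>

lemma exchangeable_pval:
  assumes ex: "exchangeable_law MX M B" and T [measurable]: "T \<in> borel_measurable MX" and a: "\<alpha> \<ge> 0"
  shows "{z \<in> space (tuple_space MX M). pval T M z \<le> \<alpha>} \<in> sets (tuple_space MX M)"
    and "measure B {z \<in> space (tuple_space MX M). pval T M z \<le> \<alpha>} \<le> \<alpha>"
proof -
  interpret B: prob_space B using ex by (simp add: exchangeable_law_def)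
  have s: "sets B = sets (tuple_space MX M)" using ex by (simp add: exchangeable_law_def)
  note sp = sets_eq_imp_space_eq[OF s]
  define N where "N z j = (\<Sum>m\<le>M. if T (z j) \<le> T (z m) then 1 else 0 :: real)" for z j
  define c where "c = \<alpha> * real (M + 1)"
  have c: "c \<ge> 0" using a by (simp add: c_def)
  have N: "N z j = real (card {m \<in> {..M}. T (z j) \<le> T (z m)})" for z j
    unfolding N_def by (subst sum.inter_filter[symmetric]) auto
  define E where "E j = {z \<in> space (tuple_space MX M). N z j \<le> c}" for j
  have E: "E j \<in> sets (tuple_space MX M)" if "j \<le> M" for j
  proof -
    have Tm [measurable]: "(\<lambda>z. T (z m)) \<in> borel_measurable (tuple_space MX M)" if "m \<le> M" for m
      by (rule measurable_compose[OF tuple_space_component[OF that] T])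
    have "(\<lambda>z. N z j) \<in> borel_measurable (tuple_space MX M)" unfolding N_def
    proof (rule borel_measurable_sum)
      fix m assume "m \<in> {..M}"
      then have "{z \<in> space (tuple_space MX M). T (z j) \<le> T (z m)} \<in> sets (tuple_space MX M)"
        using that by (intro borel_measurable_le Tm) auto
      then show "(\<lambda>z. if T (z j) \<le> T (z m) then 1 else 0 :: real) \<in> borel_measurable (tuple_space MX M)"
        by (intro measurable_If) auto
    qed
    then show ?thesis unfolding E_def by (intro borel_measurable_le) auto
  qed
  have pv: "{z \<in> space (tuple_space MX M). pval T M z \<le> \<alpha>} = E 0"
  proof -
    \<comment> \<open>Entry 0 counts itself in \<open>N\<close>, which supplies the 1 in the
      numerator of \<open>pval\<close>.\<close>
    have "{m \<in> {..M}. T (z 0) \<le> T (z m)} = insert 0 {m \<in> {1..M}. T (z 0) \<le> T (z m)}" for z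
      by (auto simp: not_less_eq_eq Suc_le_eq)
    moreover have "finite {m \<in> {1..M}. T (z 0) \<le> T (z m)}" "0 \<notin> {m \<in> {1..M}. T (z 0) \<le> T (z m)}" for z
      by auto
    ultimately have N0: "N z 0 = 1 + real (card {m \<in> {1..M}. T (z 0) \<le> T (z m)})" for z
      unfolding N by simp
    have "pval T M z \<le> \<alpha> \<longleftrightarrow> N z 0 \<le> c" for z
      unfolding pval_def c_def N0 by (rule pos_divide_le_eq) simp
    then show ?thesis unfolding E_def by (simp only:)
  qed
  show "{z \<in> space (tuple_space MX M). pval T M z \<le> \<alpha>} \<in> sets (tuple_space MX M)"
    unfolding pv by (rule E) simp
  have eq: "measure B (E j) = measure B (E 0)" if j: "j \<le> M" for j
  proof -
    let ?p = "Transposition.transpose 0 j"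
    have p: "?p permutes {..M}" using j by (intro permutes_swap_id) auto
    have pl: "?p i \<le> M" if "i \<le> M" for i using permutes_in_image[OF p, of i] that by simp
    have "N (\<lambda>i\<in>{..M}. z (?p i)) 0 = N z j" for z
    proof -
      have "N (\<lambda>i\<in>{..M}. z (?p i)) 0 = (\<Sum>m\<le>M. if T (z j) \<le> T (z (?p m)) then 1 else 0)"
        unfolding N_def by (rule sum.cong) auto
      also have "\<dots> = N z j" unfolding N_def
        by (rule sum.permute[OF p, of "\<lambda>m. if T (z j) \<le> T (z m) then 1 else 0", unfolded o_def, symmetric])
      finally show ?thesis .
    qed
    then have "(\<lambda>z. \<lambda>i\<in>{..M}. z (?p i)) -` E 0 \<inter> space (tuple_space MX M) = E j"
      using measurable_space[OF permute_tuple_measurable[OF p]] by (auto simp: E_def)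
    with exchangeable_emeasure[OF ex p, of "E 0"] show ?thesis by (simp add: E measure_def)
  qed
  have intE: "integrable B (indicator (E j) :: _ \<Rightarrow> real)" if "j \<le> M" for j
    using E[OF that] by (intro integrable_real_indicator) (simp_all add: s less_top[symmetric])
  have "real (M + 1) * measure B (E 0) = (\<Sum>j\<le>M. measure B (E j))"
  proof -
    have "(\<Sum>j\<le>M. measure B (E j)) = (\<Sum>j\<le>M. measure B (E 0))" by (intro sum.cong eq) auto
    then show ?thesis by simp
  qed
  also have "\<dots> = (\<integral>z. (\<Sum>j\<le>M. indicator (E j) z) \<partial>B)"
  proof (subst Bochner_Integration.integral_sum)
    have "E j \<inter> space B = E j" for j unfolding E_def sp by blast
    then show "(\<Sum>j\<le>M. measure B (E j)) = (\<Sum>j\<le>M. \<integral>z. indicator (E j) z \<partial>B)"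
      by (simp only: Bochner_Integration.integral_indicator)
  qed (simp add: intE)
  also have "\<dots> \<le> (\<integral>z. c \<partial>B)"
  proof (rule integral_mono)
    show "integrable B (\<lambda>z. \<Sum>j\<le>M. indicator (E j) z :: real)"
      using intE by (intro Bochner_Integration.integrable_sum) auto
    fix z assume z: "z \<in> space B"
    have "(\<Sum>j\<le>M. indicator (E j) z :: real) = (\<Sum>j\<le>M. if N z j \<le> c then 1 else 0)"
      using z by (intro sum.cong) (auto simp: E_def indicator_def sp)
    also have "\<dots> = (\<Sum>j\<in>{j \<in> {..M}. N z j \<le> c}. 1)"
      by (rule sum.inter_filter[symmetric]) simp
    also have "\<dots> = real (card {j \<in> {..M}. N z j \<le> c})" by simp
    also have "\<dots> \<le> c" unfolding N by (rule card_small_rank[OF c])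
    finally show "(\<Sum>j\<le>M. indicator (E j) z :: real) \<le> c" .
  qed auto
  also have "\<dots> = \<alpha> * real (M + 1)" by (simp add: c_def B.prob_space)
  finally have "measure B (E 0) \<le> \<alpha>" by (simp add: mult.commute[of \<alpha>])
  then show "measure B {z \<in> space (tuple_space MX M). pval T M z \<le> \<alpha>} \<le> \<alpha>" unfolding pv .
qed

subsection \<open>Exponential tilting\<close>

text \<open>In the application \<open>k\<close> is the mass of an event under the copying kernel and
  \<open>u\<close> a ratio of normalised densities. The core is 1 - u \<le> \<alpha> + ln Z,
  followed by the tangent line of the logarithm at \<open>K\<close>; the 1 is moved to the left to
  avoid subtraction.\<close>

lemma tilting_pointwise:
  fixes k u \<alpha> Z K :: real
  assumes k: "0 \<le> k" "k \<le> 1" and Z: "Z \<ge> 1" and K: "K \<ge> 1" and \<alpha>: "\<alpha> \<ge> 0"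
    and u: "u \<ge> exp (- \<alpha>) / Z"
  shows "k + 1 \<le> k * u + \<alpha> + ln K + Z / K"
proof -
  have "ln (Z / K) \<le> Z / K - 1" using Z K by (intro ln_le_minus_one) auto
  then have lnZ: "ln Z \<le> ln K + Z / K - 1" using Z K by (simp add: ln_div)
  have "0 \<le> ln Z" using Z by simp
  moreover have "1 - u \<le> \<alpha> + ln Z"
  proof -
    have "exp (- \<alpha>) / Z = exp (- \<alpha> - ln Z)" using Z by (simp add: exp_diff)
    then have "1 - (\<alpha> + ln Z) \<le> u"
      using u exp_ge_add_one_self[of "- \<alpha> - ln Z"] by linarith
    then show ?thesis by linarith
  qed
  ultimately have "k * (1 - u) \<le> \<alpha> + ln Z"
  proof (cases "1 - u \<ge> 0")
    case True
    then have "k * (1 - u) \<le> 1 * (1 - u)" using k by (intro mult_right_mono)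
    then show ?thesis using \<open>1 - u \<le> \<alpha> + ln Z\<close> by simp
  next
    case False
    then have "k * (1 - u) \<le> 0" using k by (simp add: mult_nonneg_nonpos)
    then show ?thesis using \<alpha> \<open>0 \<le> ln Z\<close> by linarith
  qed
  then show ?thesis using lnZ by (simp add: algebra_simps)
qed

lemma tilting_normalizer:
  fixes q qd :: "'a \<Rightarrow> ennreal" and g Y :: "'a \<Rightarrow> real" and c :: real
  assumes [measurable]: "q \<in> borel_measurable M" "Y \<in> borel_measurable M"
    and qd: "\<And>x. x \<in> space M \<Longrightarrow> qd x = q x * ennreal (c * exp (- g x))" and c: "c > 0"
    and g: "AE x in M. - g x \<le> Y x"
  shows "(\<integral>\<^sup>+x. qd x \<partial>M) \<le> ennreal c * (\<integral>\<^sup>+x. q x * ennreal (exp (Y x)) \<partial>M)"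
proof -
  have "(\<integral>\<^sup>+x. qd x \<partial>M) \<le> (\<integral>\<^sup>+x. ennreal c * (q x * ennreal (exp (Y x))) \<partial>M)"
  proof (rule nn_integral_mono_AE)
    show "AE x in M. qd x \<le> ennreal c * (q x * ennreal (exp (Y x)))"
      using g AE_space
    proof eventually_elim
      case (elim x)
      have "ennreal (c * exp (- g x)) \<le> ennreal (c * exp (Y x))" using c elim by (intro ennreal_leI) simp
      then have "q x * ennreal (c * exp (- g x)) \<le> q x * ennreal (c * exp (Y x))" by (intro mult_left_mono) auto
      then show ?case using c elim by (simp add: qd ennreal_mult mult.assoc mult.left_commute)
    qed
  qed
  then show ?thesis by (simp add: nn_integral_cmult)
qed

text \<open>With m, n, h the integrals of \<open>q\<close>, \<open>qd\<close> and \<open>q\<close>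
  times exp Y, the ratio of the normalised densities is m c exp(-g) / n. By n \<le> c h it is at
  least exp(-\<alpha>) m / h, so \<open>tilting_pointwise\<close> applies with Z = h / m, weighted
  by \<open>q\<close>. The constant \<open>c\<close> cancels.\<close>

lemma tilting_inequality:
  fixes q k qd :: "'a \<Rightarrow> ennreal" and g \<alpha> Y :: "'a \<Rightarrow> real" and c K :: real
  assumes [measurable]: "q \<in> borel_measurable M" "k \<in> borel_measurable M" "g \<in> borel_measurable M"
      "\<alpha> \<in> borel_measurable M" "Y \<in> borel_measurable M"
    and k: "\<And>x. x \<in> space M \<Longrightarrow> k x \<le> 1"
    and qd: "\<And>x. x \<in> space M \<Longrightarrow> qd x = q x * ennreal (c * exp (- g x))" and c: "c > 0"
    and \<alpha>: "\<And>x. x \<in> space M \<Longrightarrow> \<alpha> x \<ge> 0" and Y: "\<And>x. x \<in> space M \<Longrightarrow> Y x \<ge> 0"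
    and g: "AE x in M. g x \<le> \<alpha> x \<and> - g x \<le> Y x" and K: "K \<ge> 1"
    and fin: "(\<integral>\<^sup>+x. q x * ennreal (exp (Y x)) \<partial>M) < \<infinity>"
  shows "(\<integral>\<^sup>+x. q x * k x \<partial>M) + (\<integral>\<^sup>+x. q x \<partial>M)
    \<le> (\<integral>\<^sup>+x. q x \<partial>M) * (\<integral>\<^sup>+x. qd x / (\<integral>\<^sup>+y. qd y \<partial>M) * k x \<partial>M)
      + (\<integral>\<^sup>+x. q x * ennreal (\<alpha> x) \<partial>M) + ennreal (ln K) * (\<integral>\<^sup>+x. q x \<partial>M)
      + (\<integral>\<^sup>+x. q x * ennreal (exp (Y x)) \<partial>M) / ennreal K"
    (is "?qk + ?m \<le> ?m * ?pk + ?qa + _ + ?h / _")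
proof (cases "?m = 0")
  case True
  then have "AE x in M. q x = 0" by (subst (asm) nn_integral_0_iff_AE) auto
  then have "?qk = 0" by (subst nn_integral_0_iff_AE) auto
  then show ?thesis using True by simp
next
  case False
  let ?n = "\<integral>\<^sup>+y. qd y \<partial>M"
  have qd_cong: "?n = (\<integral>\<^sup>+x. q x * ennreal (c * exp (- g x)) \<partial>M)"
    by (intro nn_integral_cong qd)
  have mh: "?m \<le> ?h"
  proof (rule nn_integral_mono)
    fix x assume "x \<in> space M"
    then have "1 \<le> ennreal (exp (Y x))" using Y by simp
    from mult_left_mono[OF this, of "q x"] show "q x \<le> q x * ennreal (exp (Y x))" by simp
  qed
  have nh: "?n \<le> ennreal c * ?h"
    by (rule tilting_normalizer[OF _ _ qd c]) (use g in auto)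
  have n0: "?n \<noteq> 0"
  proof
    assume "?n = 0"
    then have "AE x in M. q x * ennreal (c * exp (- g x)) = 0"
      unfolding qd_cong by (subst (asm) nn_integral_0_iff_AE) auto
    then have "AE x in M. q x = 0" by eventually_elim (use c in \<open>auto simp: ennreal_eq_0_iff mult_le_0_iff\<close>)
    then have "?m = 0" by (subst nn_integral_0_iff_AE) auto
    with False show False by simp
  qed
  define h m n where "h = enn2real ?h" "m = enn2real ?m" "n = enn2real ?n"
  have hr: "?h = ennreal h" using fin by (simp add: h_m_n_def)
  have mr: "?m = ennreal m" using fin mh by (simp add: h_m_n_def less_le_trans le_less_trans)
  have "?n < \<infinity>" using nh unfolding hr by (simp add: ennreal_mult'[symmetric] c less_imp_le le_less_trans)
  then have nr: "?n = ennreal n" by (simp add: h_m_n_def)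
  have m: "m > 0" using False mr by (metis ennreal_eq_0_iff not_le)
  have n: "n > 0" using n0 nr by (metis ennreal_eq_0_iff not_le)
  have h: "m \<le> h" "n \<le> c * h" "0 < h"
  proof -
    have h0: "h \<ge> 0" by (simp add: h_m_n_def)
    show "m \<le> h" using mh h0 unfolding hr mr by simp
    then show "0 < h" using m by linarith
    show "n \<le> c * h" using nh h0 c unfolding hr nr by (simp add: ennreal_mult'[symmetric])
  qed
  have "AE x in M. q x \<noteq> \<infinity>" by (intro nn_integral_PInf_AE) (auto simp: mr)
  then have ae: "AE x in M. q x * k x + q x \<le> ennreal m * (qd x / ennreal n * k x)
     + q x * ennreal (\<alpha> x) + ennreal (ln K) * q x + ennreal (h / (m * K)) * q x"
    using g AE_space
  proof eventually_elim
    case (elim x)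
    define Q where "Q = enn2real (q x)"
    have Q: "q x = ennreal Q" "Q \<ge> 0" using elim by (auto simp: Q_def less_top)
    define \<kappa> where "\<kappa> = enn2real (k x)"
    have "k x < \<infinity>" using k[OF elim(3)] by (simp add: le_less_trans)
    then have \<kappa>: "k x = ennreal \<kappa>" "\<kappa> \<ge> 0" by (auto simp: \<kappa>_def)
    have \<kappa>1: "\<kappa> \<le> 1" using k[OF elim(3)] \<kappa> by (simp add: ennreal_le_1)
    let ?u = "m * c * exp (- g x) / n"
    have "exp (- \<alpha> x) / (h / m) \<le> exp (- g x) / (h / m)"
      using elim m h by (intro divide_right_mono) auto
    also have "\<dots> = m * c * exp (- g x) / (c * h)" using c m by (simp add: field_simps)
    also have "\<dots> \<le> ?u" using h n m c by (intro divide_left_mono) auto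
    finally have u: "exp (- \<alpha> x) / (h / m) \<le> ?u" .
    have "\<kappa> + 1 \<le> \<kappa> * ?u + \<alpha> x + ln K + h / m / K"
      using \<kappa> \<kappa>1 m h K \<alpha>[OF elim(3)] u by (intro tilting_pointwise) auto
    from mult_left_mono[OF this Q(2)]
    have le: "Q * \<kappa> + Q \<le> m * (Q * (c * exp (- g x)) / n * \<kappa>) + Q * \<alpha> x + ln K * Q + h / (m * K) * Q"
      by (simp add: algebra_simps)
    have qdx: "qd x = ennreal (Q * (c * exp (- g x)))"
      using qd[OF elim(3)] Q c by (simp add: ennreal_mult)
    have "q x * k x + q x = ennreal (Q * \<kappa> + Q)" using Q \<kappa> by (simp add: ennreal_mult ennreal_plus)
    also have "\<dots> \<le> ennreal (m * (Q * (c * exp (- g x)) / n * \<kappa>) + Q * \<alpha> x + ln K * Q + h / (m * K) * Q)"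
      by (intro ennreal_leI le)
    also have "\<dots> = ennreal m * (qd x / ennreal n * k x)
       + q x * ennreal (\<alpha> x) + ennreal (ln K) * q x + ennreal (h / (m * K)) * q x"
    proof -
      have 1: "ennreal m * (qd x / ennreal n * k x) = ennreal (m * (Q * (c * exp (- g x)) / n * \<kappa>))"
        unfolding qdx \<kappa>(1) using Q \<kappa> m n c by (simp add: divide_ennreal ennreal_mult'[symmetric])
      have 2: "q x * ennreal (\<alpha> x) = ennreal (Q * \<alpha> x)"
        unfolding Q(1) using Q by (simp add: ennreal_mult'[symmetric])
      have 3: "ennreal (ln K) * q x = ennreal (ln K * Q)"
        unfolding Q(1) using K by (simp add: ennreal_mult'[symmetric])
      have 4: "ennreal (h / (m * K)) * q x = ennreal (h / (m * K) * Q)"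
        unfolding Q(1) using h m K by (simp add: ennreal_mult'[symmetric])
      have nn: "0 \<le> m * (Q * (c * exp (- g x)) / n * \<kappa>)" "0 \<le> Q * \<alpha> x" "0 \<le> ln K * Q"
        "0 \<le> h / (m * K) * Q"
        using Q \<kappa> m n c h K \<alpha>[OF elim(3)] by auto
      show ?thesis unfolding 1 2 3 4 using nn by (simp add: ennreal_plus)
    qed
    finally show ?case .
  qed
  have [measurable]: "qd \<in> borel_measurable M"
    using qd by (subst measurable_cong[where g = "\<lambda>x. q x * ennreal (c * exp (- g x))"]) auto
  have "?qk + ?m = (\<integral>\<^sup>+x. q x * k x + q x \<partial>M)" by (simp add: nn_integral_add)
  also have "\<dots> \<le> (\<integral>\<^sup>+x. ennreal m * (qd x / ennreal n * k x)
     + q x * ennreal (\<alpha> x) + ennreal (ln K) * q x + ennreal (h / (m * K)) * q x \<partial>M)"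
    by (rule nn_integral_mono_AE[OF ae])
  also have "\<dots> = ennreal m * (\<integral>\<^sup>+x. qd x / ennreal n * k x \<partial>M) + ?qa + ennreal (ln K) * ?m
      + ennreal (h / (m * K)) * ?m"
    by (simp add: nn_integral_add nn_integral_cmult)
  also have "ennreal (h / (m * K)) * ?m = ?h / ennreal K"
    unfolding hr mr using m K h by (simp add: ennreal_mult'[symmetric] divide_ennreal)
  finally show ?thesis unfolding nr mr .
qed

subsection \<open>Second-order Taylor comparison\<close>

text \<open>Lagrange form of the remainder along the segment. \<open>curvature_separation\<close>
  applies it to the difference of the losses at two data points, so that both Hessians are taken at
  the same intermediate point.\<close>

lemma taylor_second_order:
  fixes N :: "real^'n \<Rightarrow> real" and g :: "real^'n \<Rightarrow> real^'n" and H :: "real^'n \<Rightarrow> real^'n^'n"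
  assumes S: "convex S" "a \<in> S" "b \<in> S"
    and N: "\<And>x. x \<in> S \<Longrightarrow> (N has_derivative (\<lambda>k. g x \<bullet> k)) (at x)"
    and g: "\<And>x. x \<in> S \<Longrightarrow> (g has_derivative (\<lambda>k. H x *v k)) (at x)"
  shows "\<exists>\<xi>\<in>closed_segment a b.
    N b = N a + g a \<bullet> (b - a) + (b - a) \<bullet> (H \<xi> *v (b - a)) / 2"
proof -
  define v where "v = b - a"
  define p where "p t = a + t *\<^sub>R v" for t :: real
  have p: "p t \<in> closed_segment a b" if "0 \<le> t" "t \<le> 1" for t
    using that unfolding closed_segment_def p_def v_def
    by (auto intro!: exI[of _ t] simp: algebra_simps)
  have pS: "p t \<in> S" if "0 \<le> t" "t \<le> 1" for t
    using p[OF that] closed_segment_subset[OF S(2,3,1)] by blast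
  have dp: "(p has_derivative (\<lambda>k. k *\<^sub>R v)) (at t)" for t
    unfolding p_def by (auto intro!: derivative_eq_intros)
  define D where "D m t = (if m = (0::nat) then N (p t) else if m = 1 then g (p t) \<bullet> v
    else v \<bullet> (H (p t) *v v))" for m t
  have "DERIV (D m) t :> D (Suc m) t" if "m < 2" "0 \<le> t" "t \<le> 1" for m t
  proof -
    have "((\<lambda>t. N (p t)) has_derivative (\<lambda>k. g (p t) \<bullet> (k *\<^sub>R v))) (at t)"
      by (rule has_derivative_compose[where f = p and g = N, OF dp N[OF pS[OF that(2,3)]]])
    then have 0: "DERIV (\<lambda>t. N (p t)) t :> g (p t) \<bullet> v"
      unfolding has_field_derivative_def by (rule has_derivative_eq_rhs) (auto simp: mult.commute)
    have "((\<lambda>t. g (p t)) has_derivative (\<lambda>k. H (p t) *v (k *\<^sub>R v))) (at t)"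
      by (rule has_derivative_compose[where f = p and g = g, OF dp g[OF pS[OF that(2,3)]]])
    then have "((\<lambda>t. g (p t) \<bullet> v) has_derivative (\<lambda>k. (H (p t) *v (k *\<^sub>R v)) \<bullet> v)) (at t)"
      by (rule has_derivative_inner_left)
    then have 1: "DERIV (\<lambda>t. g (p t) \<bullet> v) t :> v \<bullet> (H (p t) *v v)"
      unfolding has_field_derivative_def
      by (rule has_derivative_eq_rhs) (auto simp: matrix_vector_mult_scaleR inner_commute mult.commute)
    from that consider "m = 0" | "m = 1" by linarith
    then show ?thesis using 0 1 by cases (simp_all add: D_def[abs_def])
  qed
  then obtain t where t: "0 < t" "t < 1"
    and eq: "D 0 1 = (\<Sum>m<2. D m 0 / fact m * 1 ^ m) + D 2 t / fact 2 * 1 ^ 2"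
    using Maclaurin[of 1 2 D "D 0"] by auto
  have "N b = N a + g a \<bullet> v + v \<bullet> (H (p t) *v v) / 2"
    using eq by (simp add: D_def p_def v_def numeral_2_eq_2)
  then show ?thesis using p[of t] t unfolding v_def by (intro bexI[of _ "p t"]) auto
qed

text \<open>
  Comparing the remainders at two data points through the same intermediate point, on which the
  reference matrix cancels, avoids any regularity of that matrix as a function of the parameter.
\<close>

lemma curvature_separation:
  fixes N :: "'x \<Rightarrow> real^'n \<Rightarrow> real" and g :: "'x \<Rightarrow> real^'n \<Rightarrow> real^'n"
    and H :: "'x \<Rightarrow> real^'n \<Rightarrow> real^'n^'n" and J :: "real^'n \<Rightarrow> real^'n^'n"
    and \<Theta> :: "(real^'n) set" and \<theta>0 \<theta> :: "real^'n" and r :: real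
  defines "lo \<equiv> \<lambda>x. \<Squnion>\<xi>\<in>cball \<theta>0 r \<inter> \<Theta>. ennreal (r\<^sup>2 * max 0 (lmax (J \<xi> - H x \<xi>)))"
    and "up \<equiv> \<lambda>x. \<Squnion>\<xi>\<in>cball \<theta>0 r \<inter> \<Theta>. ennreal (exp (r\<^sup>2 * max 0 (lmax (H x \<xi> - J \<xi>))))"
    and "\<psi> \<equiv> \<lambda>x. N x \<theta> - N x \<theta>0 + (\<theta>0 - \<theta>) \<bullet> g x \<theta>"
  assumes \<Theta>: "open \<Theta>" "convex \<Theta>" "\<theta>0 \<in> \<Theta>" "\<theta> \<in> \<Theta>" "norm (\<theta> - \<theta>0) \<le> r"
    and N: "\<And>x t. x \<in> X \<Longrightarrow> t \<in> \<Theta> \<Longrightarrow> (N x has_derivative (\<lambda>k. g x t \<bullet> k)) (at t)"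
    and g: "\<And>x t. x \<in> X \<Longrightarrow> t \<in> \<Theta> \<Longrightarrow> (g x has_derivative (\<lambda>k. H x t *v k)) (at t)"
    and J: "\<And>t. t \<in> cball \<theta>0 r \<inter> \<Theta> \<Longrightarrow> transpose (J t) = J t"
    and fin: "\<exists>x\<in>X. lo x < \<infinity>" "\<exists>x\<in>X. up x < \<infinity>"
  shows "\<exists>c. \<forall>x\<in>X. ennreal (2 * (\<psi> x - c)) \<le> lo x \<and> ennreal (exp (2 * (c - \<psi> x))) \<le> up x"
proof -
  define v where "v = \<theta>0 - \<theta>"
  have symH: "transpose (H x t) = H x t" if "x \<in> X" "t \<in> \<Theta>" for x t
    by (rule second_derivative_symmetric[OF \<Theta>(1) that(2) N[OF that(1)] g[OF that]])
  have quad: "v \<bullet> (A *v v) \<le> r\<^sup>2 * max 0 (lmax A)" if "transpose A = A" for A :: "real^'n^'n"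
  proof -
    have "norm v \<le> r" using \<Theta>(5) by (simp add: v_def norm_minus_commute)
    then have "v \<bullet> v \<le> r\<^sup>2" by (simp add: power2_norm_eq_inner[symmetric] power_mono)
    then have "max 0 (lmax A) * (v \<bullet> v) \<le> max 0 (lmax A) * r\<^sup>2" by (intro mult_left_mono) auto
    moreover have "lmax A * (v \<bullet> v) \<le> max 0 (lmax A) * (v \<bullet> v)" by (intro mult_right_mono) auto
    ultimately show ?thesis using rayleigh_le_lmax[OF that, of v] by (simp add: mult.commute)
  qed
  have seg: "\<xi> \<in> cball \<theta>0 r \<inter> \<Theta>" if "\<xi> \<in> closed_segment \<theta> \<theta>0" for \<xi>
  proof -
    have "0 \<le> r" using \<Theta>(5) norm_ge_zero order_trans by blast
    then have "\<theta> \<in> cball \<theta>0 r \<inter> \<Theta>" "\<theta>0 \<in> cball \<theta>0 r \<inter> \<Theta>"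
      using \<Theta>(3,4,5) by (simp_all add: dist_norm norm_minus_commute)
    from closed_segment_subset[OF this convex_Int[OF convex_cball \<Theta>(2)]] show ?thesis using that by auto
  qed
  have lo_ge: "ennreal (r\<^sup>2 * max 0 (lmax (J \<xi> - H x \<xi>))) \<le> lo x" if "\<xi> \<in> cball \<theta>0 r \<inter> \<Theta>" for \<xi> x
    unfolding lo_def using that by (rule SUP_upper)
  have up_ge: "ennreal (exp (r\<^sup>2 * max 0 (lmax (H x \<xi> - J \<xi>)))) \<le> up x" if "\<xi> \<in> cball \<theta>0 r \<inter> \<Theta>" for \<xi> x
    unfolding up_def using that by (rule SUP_upper)
  \<comment> \<open>\<open>\<psi>\<close> is minus the second-order remainder at
    \<open>\<theta>0\<close> expanded from \<open>\<theta>\<close>. At the common point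
    \<open>\<xi>\<close>, inserting \<open>J\<close> splits the quadratic form of the difference
    into a part bounded by \<open>lo\<close> at \<open>x\<close> and a part bounded by
    \<open>up\<close> at \<open>y\<close>.\<close>
  have key: "2 * (\<psi> x - \<psi> y) \<le> a + b" if x: "x \<in> X" "lo x = ennreal a" "a \<ge> 0"
    and y: "y \<in> X" "up y = ennreal (exp b)" for x y a b
  proof -
    have dN: "((\<lambda>t. N x t - N y t) has_derivative (\<lambda>k. (g x t - g y t) \<bullet> k)) (at t)" if "t \<in> \<Theta>" for t
      using has_derivative_diff[OF N[OF x(1) that] N[OF y(1) that]]
      by (rule has_derivative_eq_rhs) (simp add: inner_diff_left)
    have dg: "((\<lambda>t. g x t - g y t) has_derivative (\<lambda>k. (H x t - H y t) *v k)) (at t)" if "t \<in> \<Theta>" for t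
      using has_derivative_diff[OF g[OF x(1) that] g[OF y(1) that]]
      by (rule has_derivative_eq_rhs) (simp add: matrix_vector_mult_diff_rdistrib)
    obtain \<xi> where \<xi>: "\<xi> \<in> closed_segment \<theta> \<theta>0"
      and eq: "N x \<theta>0 - N y \<theta>0 = N x \<theta> - N y \<theta> + (g x \<theta> - g y \<theta>) \<bullet> v + v \<bullet> ((H x \<xi> - H y \<xi>) *v v) / 2"
      using taylor_second_order[OF \<Theta>(2,4,3) dN dg] unfolding v_def by blast
    have in\<Theta>: "\<xi> \<in> cball \<theta>0 r \<inter> \<Theta>" by (rule seg[OF \<xi>])
    have tr: "transpose (A - B) = transpose A - transpose B" for A B :: "real^'n^'n"
      by (simp add: transpose_def vec_eq_iff)
    have arith: "2 * (a - a0 + p - (b - b0 + q)) = - Q" if "a0 - b0 = a - b + (p - q) + Q / 2"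
      for a a0 b b0 p q Q :: real using that by (simp add: field_simps)
    have gv: "(g x \<theta> - g y \<theta>) \<bullet> v = v \<bullet> g x \<theta> - v \<bullet> g y \<theta>"
      by (simp add: inner_diff_right inner_commute)
    have "2 * (\<psi> x - \<psi> y) = - (v \<bullet> ((H x \<xi> - H y \<xi>) *v v))"
      unfolding \<psi>_def v_def[symmetric] by (rule arith[OF eq[unfolded gv]])
    also have "\<dots> = v \<bullet> ((J \<xi> - H x \<xi>) *v v) + v \<bullet> ((H y \<xi> - J \<xi>) *v v)"
      by (simp add: matrix_vector_mult_diff_rdistrib inner_diff_right)
    also have "\<dots> \<le> r\<^sup>2 * max 0 (lmax (J \<xi> - H x \<xi>)) + r\<^sup>2 * max 0 (lmax (H y \<xi> - J \<xi>))"
      using in\<Theta> x(1) y(1) by (intro add_mono quad) (auto simp: tr J symH)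
    also have "\<dots> \<le> a + b"
      using lo_ge[OF in\<Theta>, of x] up_ge[OF in\<Theta>, of y] x y by (intro add_mono) auto
    finally show ?thesis .
  qed
  have \<theta>0: "\<theta>0 \<in> cball \<theta>0 r \<inter> \<Theta>" by (rule seg) simp
  have up_real: "\<exists>b. up y = ennreal (exp b)" if "up y < \<infinity>" for y
  proof -
    have "up y \<noteq> 0" using up_ge[OF \<theta>0, of y] by (metis ennreal_eq_0_iff exp_gt_zero le_zero_eq not_le)
    then have "enn2real (up y) > 0" using that by (simp add: enn2real_positive_iff less_top zero_less_iff_neq_zero)
    then show ?thesis using that by (intro exI[of _ "ln (enn2real (up y))"]) (simp add: less_top)
  qed
  \<comment> \<open>By \<open>key\<close> every \<psi> x - a/2 lies below every \<psi> y + b/2, so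
    the infimum of the latter separates the two families. The hypotheses \<open>fin\<close> make
    \<open>C\<close> nonempty and bounded below.\<close>
  define C where "C = {\<psi> y + b / 2 | y b. y \<in> X \<and> up y = ennreal (exp b)}"
  have Cne: "C \<noteq> {}"
  proof -
    obtain y where "y \<in> X" "up y < \<infinity>" using fin(2) by blast
    then show ?thesis using up_real[of y] unfolding C_def by blast
  qed
  have lower: "\<psi> x - a / 2 \<le> z" if "x \<in> X" "lo x = ennreal a" "a \<ge> 0" "z \<in> C" for x a z
    using that key[OF that(1,2,3)] unfolding C_def by fastforce
  obtain x0 a0 where x0: "x0 \<in> X" "lo x0 = ennreal a0" "a0 \<ge> 0"
    using fin(1) by (metis enn2real_nonneg ennreal_enn2real infinity_ennreal_def)
  have bdd: "bdd_below C" using lower[OF x0] by (auto simp: bdd_below_def)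
  define c where "c = Inf C"
  have "ennreal (2 * (\<psi> x - c)) \<le> lo x" if x: "x \<in> X" for x
  proof (cases "lo x")
    case (real a)
    have "\<psi> x - a / 2 \<le> c" unfolding c_def using Cne lower[OF x real(2,1)] by (rule cInf_greatest)
    then show ?thesis using real by (simp add: ennreal_leI)
  qed simp
  moreover have "ennreal (exp (2 * (c - \<psi> x))) \<le> up x" if x: "x \<in> X" for x
  proof (cases "up x < \<infinity>")
    case True
    then obtain b where b: "up x = ennreal (exp b)" using up_real by blast
    then have "c \<le> \<psi> x + b / 2" unfolding c_def using x by (intro cInf_lower bdd) (auto simp: C_def)
    then show ?thesis unfolding b by (intro ennreal_leI) simp
  qed (simp add: less_top[symmetric])
  ultimately show ?thesis by blast
qed

subsection \<open>The joint law of data and estimate\<close>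

text \<open>Everything that concerns one fixed true parameter. The curvature control is kept outside
  and enters \<open>key_inequality\<close> and \<open>tv_bound\<close> as the hypothesis
  \<open>sep\<close>.\<close>

locale acss =
  fixes MX :: "'x measure"
    and f :: "'x \<Rightarrow> real^'d \<Rightarrow> real"
    and \<sigma> :: real
    and \<Theta> :: "(real^'d) set"
    and gL :: "'x \<Rightarrow> real^'d \<Rightarrow> real^'d"
    and hL :: "'x \<Rightarrow> real^'d \<Rightarrow> real^'d^'d"
    and \<theta>hat :: "'x \<Rightarrow> real^'d \<Rightarrow> real^'d"
    and M :: nat
    and Ptil :: "'x \<times> (real^'d) \<Rightarrow> (nat \<Rightarrow> 'x) measure"
    and \<theta>0 :: "real^'d"
  assumes sigma_pos: "\<sigma> > 0"
    and Theta_open: "open \<Theta>"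
    and f_meas: "(\<lambda>(x, \<theta>). f x \<theta>) \<in> borel_measurable (MX \<Otimes>\<^sub>M borel)"
    and f_pos: "\<And>x \<theta>. x \<in> space MX \<Longrightarrow> \<theta> \<in> \<Theta> \<Longrightarrow> f x \<theta> > 0"
    and P0_prob: "prob_space (density MX (\<lambda>x. ennreal (f x \<theta>0)))"
    and L_hess: "\<And>x \<theta>. x \<in> space MX \<Longrightarrow> \<theta> \<in> \<Theta> \<Longrightarrow> (gL x has_derivative (\<lambda>h. hL x \<theta> *v h)) (at \<theta>)"
    and gL_meas: "(\<lambda>(x, \<theta>). gL x \<theta>) \<in> borel_measurable (MX \<Otimes>\<^sub>M borel)"
    and hL_meas: "(\<lambda>(x, \<theta>). hL x \<theta>) \<in> borel_measurable (MX \<Otimes>\<^sub>M borel)"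
    and est_range: "\<And>x w. x \<in> space MX \<Longrightarrow> \<theta>hat x w \<in> \<Theta>"
    and est_meas: "(\<lambda>(x, w). \<theta>hat x w) \<in> borel_measurable (MX \<Otimes>\<^sub>M borel)"
    and Ptil_kernel: "Ptil \<in> MX \<Otimes>\<^sub>M restrict_space borel \<Theta> \<rightarrow>\<^sub>M prob_algebra (PiM {..<M} (\<lambda>_. MX))"
    and theta0: "\<theta>0 \<in> \<Theta>"
begin

abbreviation P0 :: "'x measure" where "P0 \<equiv> density MX (\<lambda>x. ennreal (f x \<theta>0))"
abbreviation TS :: "(nat \<Rightarrow> 'x) measure" where "TS \<equiv> tuple_space MX M"
abbreviation W :: "(real^'d) measure" where "W \<equiv> gauss_vec"
abbreviation q :: "real^'d \<Rightarrow> real^'d \<Rightarrow> 'x \<Rightarrow> ennreal" where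
  "q \<equiv> cond_dens_un MX f gL hL \<sigma> \<theta>hat"

text \<open>At a stationary point the noise is determined by the data and the estimate.\<close>

definition noise :: "'x \<Rightarrow> real^'d \<Rightarrow> real^'d" where
  "noise x \<theta> = (- (1 / \<sigma>)) *\<^sub>R gL x \<theta>"

text \<open>Stationarity leaves \<open>noise x \<theta>\<close> as the only candidate for the
  witness in \<open>Xset\<close>. Without the existential quantifier, membership is jointly
  measurable in \<open>x\<close> and \<open>\<theta>\<close>.\<close>

definition attained :: "'x \<Rightarrow> real^'d \<Rightarrow> bool" where
  "attained x \<theta> \<longleftrightarrow> \<theta>hat x (noise x \<theta>) = \<theta> \<and> posdef (hL x \<theta>)"

definition ssosp :: "'x \<Rightarrow> real^'d \<Rightarrow> bool" where
  "ssosp x w \<longleftrightarrow> is_SSOSP gL hL \<sigma> x w (\<theta>hat x w)"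

lemma stationary_iff: "gL x \<theta> + \<sigma> *\<^sub>R w = 0 \<longleftrightarrow> w = noise x \<theta>"
proof -
  have "w = noise x \<theta> \<longleftrightarrow> \<sigma> *\<^sub>R w = \<sigma> *\<^sub>R noise x \<theta>" using sigma_pos by simp
  also have "\<sigma> *\<^sub>R noise x \<theta> = - gL x \<theta>" using sigma_pos by (simp add: noise_def)
  finally show ?thesis by (metis add.commute add_eq_0_iff)
qed

text \<open>Consequently \<open>noise x\<close> and \<open>\<theta>hat x\<close> are mutually
  inverse between the noise values with a strict stationary estimate and the attained
  parameters.\<close>

lemma ssosp_iff: "ssosp x w \<longleftrightarrow> w = noise x (\<theta>hat x w) \<and> attained x (\<theta>hat x w)"
  by (auto simp: ssosp_def is_SSOSP_def stationary_iff attained_def)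

lemma Xset_iff: "x \<in> Xset MX gL hL \<sigma> \<theta>hat \<theta> \<longleftrightarrow> x \<in> space MX \<and> attained x \<theta>"
  by (auto simp: Xset_def is_SSOSP_def stationary_iff attained_def)

section \<open>Joint measurability in data, parameter and noise\<close>

lemma f_meas' [measurable (raw)]:
  "a \<in> N \<rightarrow>\<^sub>M MX \<Longrightarrow> b \<in> N \<rightarrow>\<^sub>M borel \<Longrightarrow> (\<lambda>y. f (a y) (b y)) \<in> borel_measurable N"
  using measurable_compose[OF measurable_Pair f_meas, of a N b] by simp

lemma gL_meas' [measurable (raw)]:
  "a \<in> N \<rightarrow>\<^sub>M MX \<Longrightarrow> b \<in> N \<rightarrow>\<^sub>M borel \<Longrightarrow> (\<lambda>y. gL (a y) (b y)) \<in> borel_measurable N"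
  using measurable_compose[OF measurable_Pair gL_meas, of a N b] by simp

lemma hL_meas' [measurable (raw)]:
  "a \<in> N \<rightarrow>\<^sub>M MX \<Longrightarrow> b \<in> N \<rightarrow>\<^sub>M borel \<Longrightarrow> (\<lambda>y. hL (a y) (b y)) \<in> borel_measurable N"
  using measurable_compose[OF measurable_Pair hL_meas, of a N b] by simp

lemma est_meas' [measurable (raw)]:
  "a \<in> N \<rightarrow>\<^sub>M MX \<Longrightarrow> b \<in> N \<rightarrow>\<^sub>M borel \<Longrightarrow> (\<lambda>y. \<theta>hat (a y) (b y)) \<in> borel_measurable N"
  using measurable_compose[OF measurable_Pair est_meas, of a N b] by simp

lemma noise_meas [measurable (raw)]:
  "a \<in> N \<rightarrow>\<^sub>M MX \<Longrightarrow> b \<in> N \<rightarrow>\<^sub>M borel \<Longrightarrow> (\<lambda>y. noise (a y) (b y)) \<in> borel_measurable N"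
  unfolding noise_def by (intro borel_measurable_scaleR gL_meas' borel_measurable_const)

lemma attained_meas [measurable (raw)]:
  assumes [measurable]: "a \<in> N \<rightarrow>\<^sub>M MX" "b \<in> N \<rightarrow>\<^sub>M borel"
  shows "Measurable.pred N (\<lambda>y. attained (a y) (b y))"
proof -
  have "Measurable.pred N (\<lambda>y. posdef (hL (a y) (b y)))"
    by (rule measurable_compose[OF hL_meas'[OF assms] posdef_borel])
  then show ?thesis unfolding attained_def by measurable
qed

lemma ssosp_meas [measurable (raw)]:
  assumes [measurable]: "a \<in> N \<rightarrow>\<^sub>M MX" "b \<in> N \<rightarrow>\<^sub>M borel"
  shows "Measurable.pred N (\<lambda>y. ssosp (a y) (b y))"
  unfolding ssosp_iff by measurable

lemma q_eq:
  assumes "x \<in> space MX"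
  shows "q \<theta>v \<theta> x = (if attained x \<theta> then ennreal (f x \<theta>v
    * exp (- (norm (gL x \<theta>))\<^sup>2 / (2 * \<sigma>\<^sup>2 / real CARD('d))) * det (hL x \<theta>)) else 0)"
  using assms by (simp add: cond_dens_un_def indicator_def Xset_iff)

lemma q_meas [measurable (raw)]:
  assumes [measurable]: "a \<in> N \<rightarrow>\<^sub>M MX" "b \<in> N \<rightarrow>\<^sub>M borel" "c \<in> N \<rightarrow>\<^sub>M borel"
  shows "(\<lambda>y. q (c y) (b y) (a y)) \<in> borel_measurable N"
proof -
  have [measurable]: "(\<lambda>y. det (hL (a y) (b y))) \<in> borel_measurable N"
    by (rule measurable_compose[OF hL_meas'[OF assms(1,2)] det_borel])
  have "(\<lambda>y. q (c y) (b y) (a y)) \<in> borel_measurable N \<longleftrightarrow>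
    (\<lambda>y. if attained (a y) (b y) then ennreal (f (a y) (c y)
    * exp (- (norm (gL (a y) (b y)))\<^sup>2 / (2 * \<sigma>\<^sup>2 / real CARD('d))) * det (hL (a y) (b y))) else 0)
    \<in> borel_measurable N"
    by (intro measurable_cong q_eq measurable_space[OF assms(1)])
  also have "\<dots>" by measurable
  finally show ?thesis .
qed

sublocale MX: sigma_finite_measure MX
proof (rule sigma_finite_positive_density[where h = "\<lambda>x. f x \<theta>0"])
  interpret prob_space P0 by (rule P0_prob)
  have "emeasure P0 (space P0) = 1" by (rule emeasure_space_1)
  then show "(\<integral>\<^sup>+x. ennreal (f x \<theta>0) \<partial>MX) < \<infinity>"
    by (simp add: emeasure_density cong: nn_integral_cong)
qed (use f_pos theta0 in auto)

sublocale P0: prob_space P0 by (rule P0_prob)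
sublocale W: prob_space W by (rule prob_space_gauss_vec)
sublocale MXL: pair_sigma_finite MX "lborel :: (real^'d) measure" ..
sublocale PW: pair_prob_space P0 W ..

text \<open>The estimator is only measurable, so the substitution runs through its inverse
  \<open>noise x\<close>, which is differentiable with Jacobian matrix -hL/\<sigma>. Positive
  definiteness makes the absolute determinant equal to det hL / \<sigma>^d.\<close>

lemma change_of_variables_point:
  assumes x: "x \<in> space MX" and F [measurable]: "F \<in> borel_measurable borel"
  shows "(\<integral>\<^sup>+w. (if ssosp x w then F (\<theta>hat x w) else 0) \<partial>W)
    = (\<integral>\<^sup>+\<theta>. (if attained x \<theta> then ennreal (gauss_density (noise x \<theta>) * (det (hL x \<theta>) / \<sigma> ^ CARD('d))) else 0)
        * F \<theta> \<partial>lborel)"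
proof -
  have xm [measurable]: "(\<lambda>_. x) \<in> N \<rightarrow>\<^sub>M MX" for N :: "(real^'d) measure" using x by simp
  have dm [measurable]: "(\<lambda>\<theta>. det (hL x \<theta>)) \<in> borel_measurable borel"
    by (rule measurable_compose[OF hL_meas' det_borel]) measurable
  define d2 where "d2 \<theta> = (if attained x \<theta>
     then ennreal (gauss_density (noise x \<theta>) * (det (hL x \<theta>) / \<sigma> ^ CARD('d))) else 0)" for \<theta>
  have [measurable]: "d2 \<in> borel_measurable borel" unfolding d2_def by measurable
  let ?d1 = "\<lambda>w. if ssosp x w then 1 else 0 :: ennreal"
  have eq: "distr (density W ?d1) borel (\<theta>hat x) = density lborel d2"
  proof (rule measure_eqI)
    fix A assume "A \<in> sets (distr (density W ?d1) borel (\<theta>hat x))"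
    then have A [measurable]: "A \<in> sets borel" by simp
    define S where "S = {\<theta>. attained x \<theta> \<and> \<theta> \<in> A}"
    \<comment> \<open>Describing the image through the estimator shows that it is Borel.\<close>
    have im: "noise x ` S = {w. ssosp x w \<and> \<theta>hat x w \<in> A}"
      unfolding S_def ssosp_iff by (auto simp: attained_def image_iff)
    have S: "S \<in> sets borel" unfolding S_def by measurable
    have gS: "noise x ` S \<in> sets borel" unfolding im by measurable
    have inj: "inj_on (noise x) S" unfolding S_def attained_def inj_on_def by (metis (mono_tags, lifting) mem_Collect_eq)
    have der: "(noise x has_derivative (\<lambda>h. ((- (1 / \<sigma>)) *\<^sub>R hL x \<theta>) *v h)) (at \<theta>)" if "\<theta> \<in> S" for \<theta>
    proof -
      have "\<theta> \<in> \<Theta>" using that est_range[OF x] unfolding S_def attained_def by (metis (mono_tags, lifting) mem_Collect_eq)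
      from has_derivative_scaleR_right[OF L_hess[OF x this], of "- (1 / \<sigma>)"] show ?thesis
        unfolding noise_def by (rule has_derivative_eq_rhs) (simp add: scaleR_matrix_vector_assoc)
    qed
    have pre [measurable]: "\<theta>hat x -` A \<in> sets borel"
      by (rule measurable_sets_borel[OF _ A]) measurable
    have "emeasure (distr (density W ?d1) borel (\<theta>hat x)) A
        = (\<integral>\<^sup>+w. ?d1 w * indicator (\<theta>hat x -` A) w \<partial>W)"
      by (subst emeasure_distr, simp, simp, subst emeasure_density) auto
    also have "\<dots> = (\<integral>\<^sup>+w. ennreal (gauss_density w) * indicator (noise x ` S) w \<partial>lborel)"
      unfolding gauss_vec_eq
      by (subst nn_integral_density, measurable, intro nn_integral_cong) (auto simp: im indicator_def)
    also have "\<dots> = (\<integral>\<^sup>+\<theta>. ennreal (\<bar>det ((- (1 / \<sigma>)) *\<^sub>R hL x \<theta>)\<bar> * gauss_density (noise x \<theta>)) * indicator S \<theta> \<partial>lborel)"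
      by (rule nn_integral_change_of_variables[OF S gS der inj _ _ integrable_gauss_density])
        (auto simp: gauss_density_pos less_imp_le)
    also have "\<dots> = (\<integral>\<^sup>+\<theta>. d2 \<theta> * indicator A \<theta> \<partial>lborel)"
    proof (intro nn_integral_cong)
      fix \<theta>
      have "\<bar>det ((- (1 / \<sigma>)) *\<^sub>R hL x \<theta>)\<bar> = det (hL x \<theta>) / \<sigma> ^ CARD('d)" if "attained x \<theta>"
        using posdef_det_pos[of "hL x \<theta>"] that sigma_pos
        unfolding det_scaleR_matrix by (simp add: attained_def abs_mult power_abs power_one_over)
      then show "ennreal (\<bar>det ((- (1 / \<sigma>)) *\<^sub>R hL x \<theta>)\<bar> * gauss_density (noise x \<theta>)) * indicator S \<theta>
          = d2 \<theta> * indicator A \<theta>"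
        by (auto simp: S_def d2_def indicator_def mult.commute)
    qed
    also have "\<dots> = emeasure (density lborel d2) A" by (simp add: emeasure_density)
    finally show "emeasure (distr (density W ?d1) borel (\<theta>hat x)) A = emeasure (density lborel d2) A" .
  qed simp
  have "(\<integral>\<^sup>+w. (if ssosp x w then F (\<theta>hat x w) else 0) \<partial>W) = (\<integral>\<^sup>+w. ?d1 w * F (\<theta>hat x w) \<partial>W)"
    by (intro nn_integral_cong) simp
  also have "\<dots> = (\<integral>\<^sup>+\<theta>. F \<theta> \<partial>distr (density W ?d1) borel (\<theta>hat x))"
    by (subst nn_integral_distr, simp, simp, subst nn_integral_density) auto
  also have "\<dots> = (\<integral>\<^sup>+\<theta>. d2 \<theta> * F \<theta> \<partial>lborel)"
    unfolding eq by (subst nn_integral_density) auto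
  finally show ?thesis unfolding d2_def .
qed

text \<open>The Gaussian normalising constant times the factor \<sigma>^(-d) of the Jacobian: what
  separates \<open>q \<theta>0\<close> from the joint density of data and estimate.\<close>

definition norm_const :: real where
  "norm_const = sqrt (real CARD('d) / (2 * pi)) ^ CARD('d) / \<sigma> ^ CARD('d)"

lemma norm_const_pos: "norm_const > 0"
  unfolding norm_const_def using sigma_pos by simp

text \<open>With the data density included, the weight of \<open>change_of_variables_point\<close>
  becomes \<open>norm_const * q \<theta>0 \<theta> x\<close>. Fubini places \<theta> outside, so
  that laws of the data can be compared for each fixed \<theta>.\<close>

lemma change_of_variables:
  assumes F [measurable]: "(\<lambda>(x, \<theta>). F x \<theta>) \<in> borel_measurable (MX \<Otimes>\<^sub>M borel)"
  shows "(\<integral>\<^sup>+x. \<integral>\<^sup>+w. (if ssosp x w then F x (\<theta>hat x w) else 0) \<partial>W \<partial>P0)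
    = (\<integral>\<^sup>+\<theta>. \<integral>\<^sup>+x. ennreal norm_const * q \<theta>0 \<theta> x * F x \<theta> \<partial>MX \<partial>lborel)"
proof -
  have F' [measurable (raw)]: "(\<lambda>y. F (a y) (b y)) \<in> borel_measurable N"
    if "a \<in> N \<rightarrow>\<^sub>M MX" "b \<in> N \<rightarrow>\<^sub>M borel" for a b and N :: "'c measure"
    using measurable_compose[OF measurable_Pair[OF that] F] by simp
  have Fx: "(\<lambda>y. F x y) \<in> borel_measurable borel" if "x \<in> space MX" for x
    using measurable_compose[OF measurable_Pair1'[OF that] F] by simp
  have Im: "(\<lambda>x. \<integral>\<^sup>+w. (if ssosp x w then F x (\<theta>hat x w) else 0) \<partial>W) \<in> borel_measurable MX"
  proof (rule W.borel_measurable_nn_integral)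
    have "(\<lambda>y. F (fst y) (\<theta>hat (fst y) (snd y))) \<in> borel_measurable (MX \<Otimes>\<^sub>M W)"
      using measurable_compose[OF measurable_Pair F, of fst "MX \<Otimes>\<^sub>M W" "\<lambda>y. \<theta>hat (fst y) (snd y)"] by simp
    then show "(\<lambda>(x, w). if ssosp x w then F x (\<theta>hat x w) else 0) \<in> borel_measurable (MX \<Otimes>\<^sub>M W)"
      unfolding split_beta by measurable
  qed
  have Fp: "(\<lambda>y. F (fst y) (snd y)) \<in> borel_measurable (MX \<Otimes>\<^sub>M lborel)"
    using measurable_compose[OF measurable_Pair F, of fst "MX \<Otimes>\<^sub>M lborel" snd] by simp
  have "(\<integral>\<^sup>+x. \<integral>\<^sup>+w. (if ssosp x w then F x (\<theta>hat x w) else 0) \<partial>W \<partial>P0)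
      = (\<integral>\<^sup>+x. ennreal (f x \<theta>0) * (\<integral>\<^sup>+w. (if ssosp x w then F x (\<theta>hat x w) else 0) \<partial>W) \<partial>MX)"
    using Im by (subst nn_integral_density) auto
  also have "\<dots> = (\<integral>\<^sup>+x. \<integral>\<^sup>+\<theta>. ennreal norm_const * q \<theta>0 \<theta> x * F x \<theta> \<partial>lborel \<partial>MX)"
  proof (rule nn_integral_cong)
    fix x assume x: "x \<in> space MX"
    have xm [measurable]: "(\<lambda>_. x) \<in> N \<rightarrow>\<^sub>M MX" for N :: "(real^'d) measure" using x by simp
    have dm [measurable]: "(\<lambda>\<theta>. det (hL x \<theta>)) \<in> borel_measurable borel"
      by (rule measurable_compose[OF hL_meas' det_borel]) measurable
    have [measurable]: "(\<lambda>y. F x y) \<in> borel_measurable borel" by (rule Fx[OF x])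
    have "ennreal (f x \<theta>0) * (\<integral>\<^sup>+w. (if ssosp x w then F x (\<theta>hat x w) else 0) \<partial>W)
       = (\<integral>\<^sup>+\<theta>. ennreal (f x \<theta>0) * ((if attained x \<theta>
          then ennreal (gauss_density (noise x \<theta>) * (det (hL x \<theta>) / \<sigma> ^ CARD('d))) else 0)
        * F x \<theta>) \<partial>lborel)"
      unfolding change_of_variables_point[OF x Fx[OF x]] by (subst nn_integral_cmult) auto
    also have "\<dots> = (\<integral>\<^sup>+\<theta>. ennreal norm_const * q \<theta>0 \<theta> x * F x \<theta> \<partial>lborel)"
    proof (intro nn_integral_cong)
      fix \<theta>
      show "ennreal (f x \<theta>0) * ((if attained x \<theta>
          then ennreal (gauss_density (noise x \<theta>) * (det (hL x \<theta>) / \<sigma> ^ CARD('d))) else 0) * F x \<theta>)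
         = ennreal norm_const * q \<theta>0 \<theta> x * F x \<theta>"
      proof (cases "attained x \<theta>")
        case True
        have "- (real CARD('d) / 2) * (norm (noise x \<theta>))\<^sup>2 = - (norm (gL x \<theta>))\<^sup>2 / (2 * \<sigma>\<^sup>2 / real CARD('d))"
          using sigma_pos by (simp add: noise_def power_divide field_simps)
        then have "f x \<theta>0 * (gauss_density (noise x \<theta>) * (det (hL x \<theta>) / \<sigma> ^ CARD('d)))
            = norm_const * (f x \<theta>0 * exp (- (norm (gL x \<theta>))\<^sup>2 / (2 * \<sigma>\<^sup>2 / real CARD('d))) * det (hL x \<theta>))"
          unfolding gauss_density_def norm_const_def by (simp only:) (simp add: field_simps)
        then have "ennreal (f x \<theta>0) * ennreal (gauss_density (noise x \<theta>) * (det (hL x \<theta>) / \<sigma> ^ CARD('d)))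
           = ennreal norm_const * ennreal (f x \<theta>0 * exp (- (norm (gL x \<theta>))\<^sup>2 / (2 * \<sigma>\<^sup>2 / real CARD('d))) * det (hL x \<theta>))"
          using f_pos[OF x theta0] norm_const_pos by (simp only: ennreal_mult'[symmetric] less_imp_le)
        then show ?thesis using True x by (simp add: q_eq mult.assoc[symmetric])
      next
        case False
        then show ?thesis using x by (simp add: q_eq)
      qed
    qed
    finally show "ennreal (f x \<theta>0) * (\<integral>\<^sup>+w. (if ssosp x w then F x (\<theta>hat x w) else 0) \<partial>W)
      = (\<integral>\<^sup>+\<theta>. ennreal norm_const * q \<theta>0 \<theta> x * F x \<theta> \<partial>lborel)" .
  qed
  also have "\<dots> = (\<integral>\<^sup>+\<theta>. \<integral>\<^sup>+x. ennreal norm_const * q \<theta>0 \<theta> x * F x \<theta> \<partial>MX \<partial>lborel)"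
    by (rule MXL.Fubini'[symmetric]) (use Fp in \<open>measurable\<close>)
  finally show ?thesis .
qed

text \<open>\<open>Ptil\<close> is a kernel over \<Theta> only. The constant tuple is a default
  elsewhere, so that measurability holds on the whole parameter space; estimates lie in \<Theta> and
  never reach it.\<close>

definition tup :: "'x \<Rightarrow> real^'d \<Rightarrow> (nat \<Rightarrow> 'x) measure" where
  "tup x \<theta> = (if \<theta> \<in> \<Theta> then distr (Ptil (x, \<theta>)) TS (join_tuple M x)
     else return TS (\<lambda>i\<in>{..M}. x))"

lemma join_tuple_meas:
  "(\<lambda>(x, xs). join_tuple M x xs) \<in> MX \<Otimes>\<^sub>M PiM {..<M} (\<lambda>_. MX) \<rightarrow>\<^sub>M TS"
  unfolding tuple_space_def join_tuple_def split_beta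
proof (rule measurable_restrict)
  fix i assume i: "i \<in> {..M}"
  show "(\<lambda>z. if i = 0 then fst z else snd z (i - 1)) \<in> MX \<Otimes>\<^sub>M PiM {..<M} (\<lambda>_. MX) \<rightarrow>\<^sub>M MX"
  proof (cases "i = 0")
    case False
    then have "(\<lambda>z. z (i - 1)) \<in> PiM {..<M} (\<lambda>_. MX) \<rightarrow>\<^sub>M MX"
      using i by (intro measurable_component_singleton) auto
    from measurable_compose[OF measurable_snd this] show ?thesis using False by simp
  qed simp
qed

lemma tup_kernel: "(\<lambda>z. tup (fst z) (snd z)) \<in> MX \<Otimes>\<^sub>M borel \<rightarrow>\<^sub>M prob_algebra TS"
  unfolding tup_def
proof (subst measurable_If_restrict_space_iff, safe)
  have "snd -` \<Theta> \<inter> space (MX \<Otimes>\<^sub>M borel) \<in> sets (MX \<Otimes>\<^sub>M (borel :: (real^'d) measure))"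
    using Theta_open by (intro measurable_sets[OF measurable_snd]) auto
  then show "{z \<in> space (MX \<Otimes>\<^sub>M borel). snd z \<in> \<Theta>} \<in> sets (MX \<Otimes>\<^sub>M (borel :: (real^'d) measure))"
    by (simp add: vimage_def Int_def conj_commute)
  let ?R = "restrict_space (MX \<Otimes>\<^sub>M borel) {z. snd z \<in> \<Theta>}"
  have f: "fst \<in> ?R \<rightarrow>\<^sub>M MX" by (intro measurable_restrict_space1 measurable_fst)
  have s: "snd \<in> ?R \<rightarrow>\<^sub>M restrict_space borel \<Theta>"
    by (intro measurable_restrict_space2 measurable_restrict_space1 measurable_snd)
      (auto simp: space_restrict_space)
  have P: "(\<lambda>z. Ptil (fst z, snd z)) \<in> ?R \<rightarrow>\<^sub>M prob_algebra (PiM {..<M} (\<lambda>_. MX))"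
    by (rule measurable_compose[OF measurable_Pair[OF f s] Ptil_kernel])
  have j: "(\<lambda>(z, xs). join_tuple M (fst z) xs) \<in> ?R \<Otimes>\<^sub>M PiM {..<M} (\<lambda>_. MX) \<rightarrow>\<^sub>M TS"
    using measurable_compose[OF measurable_Pair[OF measurable_compose[OF measurable_fst f] measurable_snd] join_tuple_meas]
    by (simp add: split_beta)
  show "(\<lambda>z. distr (Ptil (fst z, snd z)) TS (join_tuple M (fst z))) \<in> ?R \<rightarrow>\<^sub>M prob_algebra TS"
    by (rule measurable_distr_prob_space2[OF P j])
  have "fst \<in> restrict_space (MX \<Otimes>\<^sub>M borel) {z. snd z \<notin> \<Theta>} \<rightarrow>\<^sub>M MX"
    by (intro measurable_restrict_space1 measurable_fst)
  from measurable_compose[OF measurable_compose[OF this const_tuple_measurable] measurable_return_prob_space]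
  show "(\<lambda>z. return TS (\<lambda>i\<in>{..M}. fst z)) \<in> restrict_space (MX \<Otimes>\<^sub>M borel) {z. snd z \<notin> \<Theta>} \<rightarrow>\<^sub>M prob_algebra TS" .
qed

lemma tup_meas:
  "a \<in> N \<rightarrow>\<^sub>M MX \<Longrightarrow> b \<in> N \<rightarrow>\<^sub>M borel \<Longrightarrow> (\<lambda>y. tup (a y) (b y)) \<in> N \<rightarrow>\<^sub>M prob_algebra TS"
  using measurable_compose[OF measurable_Pair tup_kernel, of a N b] by simp

lemma emeasure_tup_meas [measurable (raw)]:
  assumes "A \<in> sets TS" "a \<in> N \<rightarrow>\<^sub>M MX" "b \<in> N \<rightarrow>\<^sub>M borel"
  shows "(\<lambda>y. emeasure (tup (a y) (b y)) A) \<in> borel_measurable N"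
  by (rule measurable_compose[OF measurable_prob_algebraD[OF tup_meas[OF assms(2,3)]]
      measurable_emeasure_subprob_algebra[OF assms(1)]])

lemma tup_prob:
  assumes "x \<in> space MX"
  shows "prob_space (tup x \<theta>)" "sets (tup x \<theta>) = sets TS"
  using measurable_space[OF tup_kernel, of "(x, \<theta>)"] assms
  by (auto simp: space_pair_measure space_prob_algebra)

lemma emeasure_tup_le_1: "x \<in> space MX \<Longrightarrow> emeasure (tup x \<theta>) A \<le> 1"
  using tup_prob(1) prob_space.emeasure_le_1 by blast

definition acss_kernel :: "'x \<Rightarrow> real^'d \<Rightarrow> (nat \<Rightarrow> 'x) measure" where
  "acss_kernel x w = (if ssosp x w then tup x (\<theta>hat x w) else return TS (\<lambda>i\<in>{..M}. x))"

lemma const_kernel: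
  "a \<in> N \<rightarrow>\<^sub>M MX \<Longrightarrow> (\<lambda>y. return TS (\<lambda>i\<in>{..M}. a y)) \<in> N \<rightarrow>\<^sub>M prob_algebra TS"
  by (rule measurable_compose[OF measurable_compose[OF _ const_tuple_measurable] measurable_return_prob_space])

lemma acss_kernel_meas:
  assumes [measurable]: "a \<in> N \<rightarrow>\<^sub>M MX" "b \<in> N \<rightarrow>\<^sub>M borel"
  shows "(\<lambda>y. acss_kernel (a y) (b y)) \<in> N \<rightarrow>\<^sub>M prob_algebra TS"
  unfolding acss_kernel_def
proof (rule measurable_If)
  show "(\<lambda>y. tup (a y) (\<theta>hat (a y) (b y))) \<in> N \<rightarrow>\<^sub>M prob_algebra TS"
    by (intro tup_meas assms est_meas')
  show "(\<lambda>y. return TS (\<lambda>i\<in>{..M}. a y)) \<in> N \<rightarrow>\<^sub>M prob_algebra TS"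
    by (intro const_kernel assms)
  show "{y \<in> space N. ssosp (a y) (b y)} \<in> sets N" by measurable
qed

section \<open>The aCSS law as an iterated integral over data and noise\<close>

abbreviation law :: "(nat \<Rightarrow> 'x) measure" where
  "law \<equiv> aCSS_law MX M \<sigma> gL hL \<theta>hat Ptil P0"

lemma law_eq: "law = P0 \<bind> (\<lambda>x. W \<bind> acss_kernel x)"
  unfolding aCSS_law_def
proof (rule bind_cong[OF refl])
  fix x assume "x \<in> space P0"
  then have x: "x \<in> space MX" by simp
  have "acss_kernel x = (\<lambda>w. if is_SSOSP gL hL \<sigma> x w (\<theta>hat x w)
        then distr (Ptil (x, \<theta>hat x w)) TS (join_tuple M x) else return TS (\<lambda>i\<in>{..M}. x))"
    using est_range[OF x] by (auto simp: acss_kernel_def ssosp_def tup_def fun_eq_iff)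
  then show "W \<bind> (\<lambda>w. if is_SSOSP gL hL \<sigma> x w (\<theta>hat x w)
        then distr (Ptil (x, \<theta>hat x w)) TS (join_tuple M x) else return TS (\<lambda>i\<in>{..M}. x)) = W \<bind> acss_kernel x"
    by simp
qed

lemma P0_in: "P0 \<in> space (prob_algebra P0)" and W_in: "W \<in> space (prob_algebra W)"
  by (simp_all add: space_prob_algebra P0.prob_space_axioms W.prob_space_axioms)

lemma inner_kernel: "(\<lambda>x. W \<bind> acss_kernel x) \<in> P0 \<rightarrow>\<^sub>M prob_algebra TS"
proof (rule measurable_bind_prob_space2[where N = W])
  show "(\<lambda>_. W) \<in> P0 \<rightarrow>\<^sub>M prob_algebra W" using W_in by simp
  show "(\<lambda>(x, w). acss_kernel x w) \<in> P0 \<Otimes>\<^sub>M W \<rightarrow>\<^sub>M prob_algebra TS"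
    using acss_kernel_meas[of fst "P0 \<Otimes>\<^sub>M W" snd] by (simp add: split_beta)
qed

lemma prob_space_law: "prob_space law" and sets_law: "sets law = sets TS"
  unfolding law_eq by (rule prob_space_bind'[OF P0_in inner_kernel], rule sets_bind'[OF P0_in inner_kernel])

lemma emeasure_law:
  assumes A: "A \<in> sets TS"
  shows "emeasure law A = (\<integral>\<^sup>+x. \<integral>\<^sup>+w. (if ssosp x w then emeasure (tup x (\<theta>hat x w)) A
    else indicator A (\<lambda>i\<in>{..M}. x)) \<partial>W \<partial>P0)"
  unfolding law_eq emeasure_bind_prob_algebra[OF P0_in inner_kernel A]
proof (intro nn_integral_cong)
  fix x assume x: "x \<in> space P0"
  have "acss_kernel x \<in> W \<rightarrow>\<^sub>M prob_algebra TS"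
    using acss_kernel_meas[of "\<lambda>_. x" W "\<lambda>w. w"] x by simp
  from emeasure_bind_prob_algebra[OF W_in this A]
  show "emeasure (W \<bind> acss_kernel x) A = (\<integral>\<^sup>+w. (if ssosp x w then emeasure (tup x (\<theta>hat x w)) A
    else indicator A (\<lambda>i\<in>{..M}. x)) \<partial>W)"
    by (simp add: acss_kernel_def A if_distrib[of "\<lambda>K. emeasure K A"] cong: if_cong)
qed

section \<open>Conditional laws and the exchangeable reference law\<close>

definition normalizer :: "real^'d \<Rightarrow> ennreal" where
  "normalizer \<theta> = (\<integral>\<^sup>+y. q \<theta> \<theta> y \<partial>MX)"

text \<open>The parameters at which condition (E), in the form assumed by the theorem, yields
  exchangeability.\<close>

definition regular :: "real^'d \<Rightarrow> bool" where
  "regular \<theta> \<longleftrightarrow> \<theta> \<in> \<Theta> \<and> 0 < emeasure MX (Xset MX gL hL \<sigma> \<theta>hat \<theta>) \<and> normalizer \<theta> < \<infinity>"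

definition ref_law :: "real^'d \<Rightarrow> (nat \<Rightarrow> 'x) measure" where
  "ref_law \<theta> = (cond_law MX f gL hL \<sigma> \<theta>hat \<theta> \<theta> \<bind>
     (\<lambda>x. distr (Ptil (x, \<theta>)) TS (join_tuple M x)))"

lemma q_section [measurable]: "q \<theta>v \<theta> \<in> borel_measurable MX"
  using q_meas[of "\<lambda>x. x" MX "\<lambda>_. \<theta>" "\<lambda>_. \<theta>v"] by simp

lemma normalizer_meas [measurable]: "normalizer \<in> borel_measurable borel"
proof -
  have "(\<lambda>\<theta>. \<integral>\<^sup>+y. q \<theta> \<theta> y \<partial>MX) \<in> borel_measurable borel"
    by (rule MX.borel_measurable_nn_integral) (simp add: split_beta q_meas)
  then show ?thesis by (simp add: normalizer_def[abs_def])
qed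

lemma emeasure_Xset: "emeasure MX (Xset MX gL hL \<sigma> \<theta>hat \<theta>) = (\<integral>\<^sup>+x. (if attained x \<theta> then 1 else 0) \<partial>MX)"
proof -
  have e: "Xset MX gL hL \<sigma> \<theta>hat \<theta> = {x \<in> space MX. attained x \<theta>}" using Xset_iff by blast
  have "{x \<in> space MX. attained x \<theta>} \<in> sets MX" by measurable
  then have "emeasure MX {x \<in> space MX. attained x \<theta>} = (\<integral>\<^sup>+x. indicator {x \<in> space MX. attained x \<theta>} x \<partial>MX)" by simp
  also have "\<dots> = (\<integral>\<^sup>+x. (if attained x \<theta> then 1 else 0) \<partial>MX)"
    by (intro nn_integral_cong) (simp add: indicator_def)
  finally show ?thesis unfolding e .
qed

lemma regular_meas [measurable]: "Measurable.pred borel regular"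
proof -
  have "(\<lambda>\<theta>. \<integral>\<^sup>+x. (if attained x \<theta> then 1 else 0) \<partial>MX) \<in> borel_measurable borel"
    by (rule MX.borel_measurable_nn_integral) (simp add: split_beta)
  moreover have "\<Theta> \<in> sets borel" using Theta_open by simp
  ultimately show ?thesis unfolding regular_def emeasure_Xset by measurable
qed

lemma emeasure_ref_law:
  assumes \<theta>: "\<theta> \<in> \<Theta>" and A: "A \<in> sets TS"
  shows "emeasure (ref_law \<theta>) A = (\<integral>\<^sup>+x. q \<theta> \<theta> x / normalizer \<theta> * emeasure (tup x \<theta>) A \<partial>MX)"
proof -
  have k: "(\<lambda>x. distr (Ptil (x, \<theta>)) TS (join_tuple M x)) = (\<lambda>x. tup x \<theta>)"
    using \<theta> by (simp add: tup_def)
  have m: "(\<lambda>x. tup x \<theta>) \<in> MX \<rightarrow>\<^sub>M subprob_algebra TS"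
    using tup_meas[of "\<lambda>x. x" MX "\<lambda>_. \<theta>"] by (intro measurable_prob_algebraD) simp
  have "emeasure (ref_law \<theta>) A = (\<integral>\<^sup>+x. emeasure (tup x \<theta>) A \<partial>cond_law MX f gL hL \<sigma> \<theta>hat \<theta> \<theta>)"
    unfolding ref_law_def k
  proof (rule emeasure_bind[OF _ _ A])
    show "space (cond_law MX f gL hL \<sigma> \<theta>hat \<theta> \<theta>) \<noteq> {}" using P0.not_empty by (simp add: cond_law_def)
    show "(\<lambda>x. tup x \<theta>) \<in> cond_law MX f gL hL \<sigma> \<theta>hat \<theta> \<theta> \<rightarrow>\<^sub>M subprob_algebra TS"
      using m by (simp add: cond_law_def)
  qed
  also have "\<dots> = (\<integral>\<^sup>+x. q \<theta> \<theta> x / normalizer \<theta> * emeasure (tup x \<theta>) A \<partial>MX)"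
    unfolding cond_law_def normalizer_def[symmetric]
    using A by (subst nn_integral_density) (auto intro!: emeasure_tup_meas)
  finally show ?thesis .
qed

definition good :: "real \<Rightarrow> 'x \<Rightarrow> real^'d \<Rightarrow> bool" where
  "good \<rho> x w \<longleftrightarrow> ssosp x w \<and> norm (\<theta>hat x w - \<theta>0) \<le> \<rho>"

lemma good_meas [measurable (raw)]:
  assumes [measurable]: "a \<in> N \<rightarrow>\<^sub>M MX" "b \<in> N \<rightarrow>\<^sub>M borel"
  shows "Measurable.pred N (\<lambda>y. good \<rho> (a y) (b y))"
  unfolding good_def by measurable

text \<open>The integral formula for \<open>ref_law\<close> stated over the base measure and with
  the total kernel \<open>tup\<close>, so that measurability in \<theta> is available. Through it
  \<open>ref_kernel\<close> is shown to be a kernel.\<close>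

definition ref_mass :: "(nat \<Rightarrow> 'x) set \<Rightarrow> real^'d \<Rightarrow> ennreal" where
  "ref_mass A \<theta> = (\<integral>\<^sup>+x. q \<theta> \<theta> x / normalizer \<theta> * emeasure (tup x \<theta>) A \<partial>MX)"

lemma ref_mass_meas [measurable]: "A \<in> sets TS \<Longrightarrow> ref_mass A \<in> borel_measurable borel"
proof -
  assume [measurable]: "A \<in> sets TS"
  have "(\<lambda>\<theta>. \<integral>\<^sup>+x. q \<theta> \<theta> x / normalizer \<theta> * emeasure (tup x \<theta>) A \<partial>MX) \<in> borel_measurable borel"
    by (rule MX.borel_measurable_nn_integral) (unfold split_beta, measurable)
  then show ?thesis by (simp add: ref_mass_def[abs_def])
qed

text \<open>
  Outside the good event the data are copied, which is exchangeable and costs only the probability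
  of that event.
\<close>

definition ref_kernel :: "real \<Rightarrow> 'x \<times> (real^'d) \<Rightarrow> (nat \<Rightarrow> 'x) measure" where
  "ref_kernel \<rho> z = (if good \<rho> (fst z) (snd z) \<and> regular (\<theta>hat (fst z) (snd z))
     then ref_law (\<theta>hat (fst z) (snd z)) else return TS (\<lambda>i\<in>{..M}. fst z))"

definition reference :: "real \<Rightarrow> (nat \<Rightarrow> 'x) measure" where
  "reference \<rho> = (P0 \<Otimes>\<^sub>M W) \<bind> ref_kernel \<rho>"

context
  assumes ref_exch: "\<And>\<theta>. regular \<theta> \<Longrightarrow> exchangeable_law MX M (ref_law \<theta>)"
begin

lemma ref_kernel_exch:
  assumes "z \<in> space (P0 \<Otimes>\<^sub>M W)"
  shows "exchangeable_law MX M (ref_kernel \<rho> z)"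
  using assms by (auto simp: ref_kernel_def space_pair_measure intro!: ref_exch exchangeable_return)

lemma ref_kernel_emeasure:
  assumes "z \<in> space (P0 \<Otimes>\<^sub>M W)" "A \<in> sets TS"
  shows "emeasure (ref_kernel \<rho> z) A = (if good \<rho> (fst z) (snd z) \<and> regular (\<theta>hat (fst z) (snd z))
     then ref_mass A (\<theta>hat (fst z) (snd z)) else indicator A (\<lambda>i\<in>{..M}. fst z))"
  using assms by (auto simp: ref_kernel_def emeasure_ref_law regular_def ref_mass_def)

lemma ref_kernel_meas: "ref_kernel \<rho> \<in> P0 \<Otimes>\<^sub>M W \<rightarrow>\<^sub>M prob_algebra TS"
proof (rule measurable_prob_algebraI)
  show p: "prob_space (ref_kernel \<rho> z)" if "z \<in> space (P0 \<Otimes>\<^sub>M W)" for z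
    using ref_kernel_exch[OF that] by (simp add: exchangeable_law_def)
  show "ref_kernel \<rho> \<in> P0 \<Otimes>\<^sub>M W \<rightarrow>\<^sub>M subprob_algebra TS"
  proof (rule measurable_subprob_algebra)
    show "subprob_space (ref_kernel \<rho> z)" if "z \<in> space (P0 \<Otimes>\<^sub>M W)" for z
      by (rule prob_space_imp_subprob_space[OF p[OF that]])
    show "sets (ref_kernel \<rho> z) = sets TS" if "z \<in> space (P0 \<Otimes>\<^sub>M W)" for z
      using ref_kernel_exch[OF that] by (simp add: exchangeable_law_def)
    fix A assume A [measurable]: "A \<in> sets TS"
    have [measurable]: "(\<lambda>z. indicator A (\<lambda>i\<in>{..M}. fst z) :: ennreal) \<in> borel_measurable (P0 \<Otimes>\<^sub>M W)"
      by (rule measurable_compose[OF measurable_compose[OF _ const_tuple_measurable] borel_measurable_indicator[OF A]]) simp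
    have [measurable]: "fst \<in> P0 \<Otimes>\<^sub>M W \<rightarrow>\<^sub>M MX" "snd \<in> P0 \<Otimes>\<^sub>M W \<rightarrow>\<^sub>M borel" by simp_all
    have "(\<lambda>z. if good \<rho> (fst z) (snd z) \<and> regular (\<theta>hat (fst z) (snd z))
       then ref_mass A (\<theta>hat (fst z) (snd z)) else indicator A (\<lambda>i\<in>{..M}. fst z)) \<in> borel_measurable (P0 \<Otimes>\<^sub>M W)"
      by measurable
    then show "(\<lambda>z. emeasure (ref_kernel \<rho> z) A) \<in> borel_measurable (P0 \<Otimes>\<^sub>M W)"
      by (subst measurable_cong[OF ref_kernel_emeasure[OF _ A]])
  qed
qed

lemma PW_in: "P0 \<Otimes>\<^sub>M W \<in> space (prob_algebra (P0 \<Otimes>\<^sub>M W))"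
  by (simp add: space_prob_algebra PW.prob_space_axioms)

lemma reference_exch: "exchangeable_law MX M (reference \<rho>)"
  unfolding reference_def
  by (rule exchangeable_bind[OF PW.prob_space_axioms ref_kernel_meas ref_kernel_exch])

lemma emeasure_reference:
  assumes A: "A \<in> sets TS"
  shows "emeasure (reference \<rho>) A = (\<integral>\<^sup>+x. \<integral>\<^sup>+w. (if good \<rho> x w \<and> regular (\<theta>hat x w)
     then ref_mass A (\<theta>hat x w) else indicator A (\<lambda>i\<in>{..M}. x)) \<partial>W \<partial>P0)"
proof -
  have "emeasure (reference \<rho>) A = (\<integral>\<^sup>+z. emeasure (ref_kernel \<rho> z) A \<partial>(P0 \<Otimes>\<^sub>M W))"
    unfolding reference_def by (rule emeasure_bind_prob_algebra[OF PW_in ref_kernel_meas A])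
  also have "\<dots> = (\<integral>\<^sup>+x. \<integral>\<^sup>+w. emeasure (ref_kernel \<rho> (x, w)) A \<partial>W \<partial>P0)"
    by (rule W.nn_integral_fst[symmetric],
        rule measurable_compose[OF measurable_prob_algebraD[OF ref_kernel_meas]
          measurable_emeasure_subprob_algebra[OF A]])
  also have "\<dots> = (\<integral>\<^sup>+x. \<integral>\<^sup>+w. (if good \<rho> x w \<and> regular (\<theta>hat x w)
     then ref_mass A (\<theta>hat x w) else indicator A (\<lambda>i\<in>{..M}. x)) \<partial>W \<partial>P0)"
    using A by (intro nn_integral_cong) (simp add: ref_kernel_emeasure space_pair_measure)
  finally show ?thesis .
qed

end

text \<open>For almost every \<theta> this is \<open>tilting_inequality\<close>, with the joint
  density at \<open>\<theta>0\<close> as \<open>q\<close> and the unnormalised conditional density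
  \<open>q \<theta> \<theta>\<close> as \<open>qd\<close>. The change of variables is used before
  and after to express both sides as averages over data and noise.\<close>

lemma key_inequality:
  fixes \<alpha> Y :: "'x \<Rightarrow> real^'d \<Rightarrow> real" and \<rho> K :: real
  assumes A [measurable]: "A \<in> sets TS" and K: "K \<ge> 1"
    and \<alpha>_meas: "(\<lambda>z. \<alpha> (fst z) (snd z)) \<in> borel_measurable (MX \<Otimes>\<^sub>M borel)"
    and Y_meas: "(\<lambda>z. Y (fst z) (snd z)) \<in> borel_measurable (MX \<Otimes>\<^sub>M borel)"
    and \<alpha>: "\<And>x \<theta>. x \<in> space MX \<Longrightarrow> \<alpha> x \<theta> \<ge> 0" and Y: "\<And>x \<theta>. x \<in> space MX \<Longrightarrow> Y x \<theta> \<ge> 0"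
    and sep: "\<And>\<theta>. \<theta> \<in> \<Theta> \<Longrightarrow> norm (\<theta> - \<theta>0) \<le> \<rho> \<Longrightarrow>
      \<exists>c. AE x in MX. ln (f x \<theta>0) - ln (f x \<theta>) - c \<le> \<alpha> x \<theta> \<and> - (ln (f x \<theta>0) - ln (f x \<theta>) - c) \<le> Y x \<theta>"
    and fin: "(\<integral>\<^sup>+x. \<integral>\<^sup>+w. (if good \<rho> x w then ennreal (exp (Y x (\<theta>hat x w))) else 0) \<partial>W \<partial>P0) < \<infinity>"
  shows "(\<integral>\<^sup>+x. \<integral>\<^sup>+w. (if good \<rho> x w then emeasure (tup x (\<theta>hat x w)) A + 1 else 0) \<partial>W \<partial>P0)
    \<le> (\<integral>\<^sup>+x. \<integral>\<^sup>+w. (if good \<rho> x w then (if regular (\<theta>hat x w) then ref_mass A (\<theta>hat x w) else 0)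
        + ennreal (\<alpha> x (\<theta>hat x w)) + ennreal (ln K) + ennreal (exp (Y x (\<theta>hat x w))) / ennreal K else 0) \<partial>W \<partial>P0)"
proof -
  let ?b = "\<lambda>\<theta>. norm (\<theta> - \<theta>0) \<le> \<rho>"
  have [measurable (raw)]: "(\<lambda>y. \<alpha> (a y) (b y)) \<in> borel_measurable N" "(\<lambda>y. Y (a y) (b y)) \<in> borel_measurable N"
    if "a \<in> N \<rightarrow>\<^sub>M MX" "b \<in> N \<rightarrow>\<^sub>M borel" for a b and N :: "'c measure"
    using measurable_compose[OF measurable_Pair[OF that] \<alpha>_meas] measurable_compose[OF measurable_Pair[OF that] Y_meas]
    by simp_all
  define F1 where "F1 x \<theta> = (if ?b \<theta> then emeasure (tup x \<theta>) A + 1 else 0)" for x \<theta>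
  define F2 where "F2 x \<theta> = (if ?b \<theta> then (if regular \<theta> then ref_mass A \<theta> else 0)
        + ennreal (\<alpha> x \<theta>) + ennreal (ln K) + ennreal (exp (Y x \<theta>)) / ennreal K else 0)" for x \<theta>
  define F3 where "F3 x \<theta> = (if ?b \<theta> then ennreal (exp (Y x \<theta>)) else 0)" for x \<theta>
  have g1: "(if good \<rho> x w then emeasure (tup x (\<theta>hat x w)) A + 1 else 0)
      = (if ssosp x w then F1 x (\<theta>hat x w) else 0)" for x w
    by (simp add: F1_def good_def)
  have g2: "(if good \<rho> x w then (if regular (\<theta>hat x w) then ref_mass A (\<theta>hat x w) else 0)
        + ennreal (\<alpha> x (\<theta>hat x w)) + ennreal (ln K) + ennreal (exp (Y x (\<theta>hat x w))) / ennreal K else 0)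
      = (if ssosp x w then F2 x (\<theta>hat x w) else 0)" for x w
    by (simp add: F2_def good_def)
  have g3: "(if good \<rho> x w then ennreal (exp (Y x (\<theta>hat x w))) else 0)
      = (if ssosp x w then F3 x (\<theta>hat x w) else 0)" for x w
    by (simp add: F3_def good_def)
  have F1m: "(\<lambda>(x, \<theta>). F1 x \<theta>) \<in> borel_measurable (MX \<Otimes>\<^sub>M borel)"
    unfolding F1_def split_beta by measurable
  have F2m: "(\<lambda>(x, \<theta>). F2 x \<theta>) \<in> borel_measurable (MX \<Otimes>\<^sub>M borel)"
    unfolding F2_def split_beta by measurable
  have F3m: "(\<lambda>(x, \<theta>). F3 x \<theta>) \<in> borel_measurable (MX \<Otimes>\<^sub>M borel)"
    unfolding F3_def split_beta by measurable
  let ?q = "\<lambda>\<theta> x. ennreal norm_const * q \<theta>0 \<theta> x"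
  have "(\<lambda>\<theta>. \<integral>\<^sup>+x. ?q \<theta> x * F3 x \<theta> \<partial>MX) \<in> borel_measurable lborel"
  proof (rule MX.borel_measurable_nn_integral)
    have "(\<lambda>z. F3 (snd z) (fst z)) \<in> borel_measurable (lborel \<Otimes>\<^sub>M MX)"
      using measurable_compose[OF measurable_Pair F3m, of snd "lborel \<Otimes>\<^sub>M MX" fst] by simp
    then show "(\<lambda>(\<theta>, x). ?q \<theta> x * F3 x \<theta>) \<in> borel_measurable (lborel \<Otimes>\<^sub>M MX)"
      unfolding split_beta by measurable
  qed
  moreover have "(\<integral>\<^sup>+\<theta>. \<integral>\<^sup>+x. ?q \<theta> x * F3 x \<theta> \<partial>MX \<partial>lborel) \<noteq> \<infinity>"
    using fin unfolding change_of_variables[OF F3m, symmetric] g3 by simp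
  \<comment> \<open>The finite averaged exponential moment becomes finite at almost every \<theta>;
    there it will also bound the normaliser.\<close>
  ultimately have aefin: "AE \<theta> in lborel. (\<integral>\<^sup>+x. ?q \<theta> x * F3 x \<theta> \<partial>MX) \<noteq> \<infinity>"
    by (intro nn_integral_PInf_AE) auto
  have "(\<integral>\<^sup>+\<theta>. \<integral>\<^sup>+x. ?q \<theta> x * F1 x \<theta> \<partial>MX \<partial>lborel) \<le> (\<integral>\<^sup>+\<theta>. \<integral>\<^sup>+x. ?q \<theta> x * F2 x \<theta> \<partial>MX \<partial>lborel)"
  proof (rule nn_integral_mono_AE)
    show "AE \<theta> in lborel. (\<integral>\<^sup>+x. ?q \<theta> x * F1 x \<theta> \<partial>MX) \<le> (\<integral>\<^sup>+x. ?q \<theta> x * F2 x \<theta> \<partial>MX)"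
      using aefin
    proof eventually_elim
      case (elim \<theta>)
      \<comment> \<open>Outside the ball, or where the joint density has no mass, the left side
        vanishes. Everywhere else \<theta> turns out to be regular.\<close>
      show ?case
      proof (cases "?b \<theta> \<and> (\<integral>\<^sup>+x. ?q \<theta> x \<partial>MX) \<noteq> 0")
        case False
        have "(\<integral>\<^sup>+x. ?q \<theta> x * F1 x \<theta> \<partial>MX) = 0"
        proof (cases "?b \<theta>")
          case True
          then have "AE x in MX. ?q \<theta> x = 0" using False by (subst (asm) nn_integral_0_iff_AE) auto
          then have "AE x in MX. ?q \<theta> x * F1 x \<theta> = 0" by eventually_elim (simp only: mult_zero_left)
          then have "(\<integral>\<^sup>+x. ?q \<theta> x * F1 x \<theta> \<partial>MX) = (\<integral>\<^sup>+x. 0 \<partial>MX)" by (rule nn_integral_cong_AE)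
          then show ?thesis by simp
        qed (simp add: F1_def)
        then show ?thesis by simp
      next
        case True
        then have b: "?b \<theta>" and m0: "(\<integral>\<^sup>+x. ?q \<theta> x \<partial>MX) \<noteq> 0" by auto
        have natt: "\<not> (AE x in MX. \<not> attained x \<theta>)"
        proof
          assume "AE x in MX. \<not> attained x \<theta>"
          then have "AE x in MX. ?q \<theta> x = 0" using AE_space by eventually_elim (simp add: q_eq)
          then have "(\<integral>\<^sup>+x. ?q \<theta> x \<partial>MX) = 0" by (subst nn_integral_0_iff_AE) auto
          then show False using m0 by simp
        qed
        have \<theta>: "\<theta> \<in> \<Theta>"
        proof (rule ccontr)
          assume "\<theta> \<notin> \<Theta>"
          then have "\<not> attained x \<theta>" if "x \<in> space MX" for x
            using est_range[OF that] unfolding attained_def by metis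
          then show False using natt by (auto intro: AE_I2)
        qed
        obtain c where sepc: "AE x in MX. ln (f x \<theta>0) - ln (f x \<theta>) - c \<le> \<alpha> x \<theta>
            \<and> - (ln (f x \<theta>0) - ln (f x \<theta>) - c) \<le> Y x \<theta>"
          using sep[OF \<theta> b] by blast
        \<comment> \<open>\<open>?c\<close> collects the additive constant of \<open>sep\<close> and
          divides out \<open>norm_const\<close>; normalising the conditional density removes
          both.\<close>
        let ?g = "\<lambda>x. ln (f x \<theta>0) - ln (f x \<theta>) - c" and ?c = "exp (- c) / norm_const"
        have c: "?c > 0" using norm_const_pos by simp
        have prod3: "ennreal a * ennreal b * ennreal c = ennreal (a * b * c)"
          if "0 \<le> a" "0 \<le> b" "0 \<le> c" for a b c
          using that by (simp add: ennreal_mult')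
        have qd: "q \<theta> \<theta> x = ?q \<theta> x * ennreal (?c * exp (- ?g x))" if x: "x \<in> space MX" for x
        proof (cases "attained x \<theta>")
          case True
          let ?e = "exp (- (norm (gL x \<theta>))\<^sup>2 / (2 * \<sigma>\<^sup>2 / real CARD('d))) * det (hL x \<theta>)"
          have "0 < det (hL x \<theta>)" using True posdef_det_pos by (auto simp: attained_def)
          then have e: "0 \<le> ?e" by simp
          have fp: "0 < f x \<theta>0" "0 < f x \<theta>" using f_pos x \<theta> theta0 by auto
          have "?c * exp (- ?g x) = f x \<theta> / (f x \<theta>0 * norm_const)"
            using fp norm_const_pos by (simp add: exp_diff exp_minus exp_add field_simps)
          then have "norm_const * (f x \<theta>0 * ?e) * (?c * exp (- ?g x)) = f x \<theta> * ?e"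
            using fp norm_const_pos by (simp only:) (simp add: field_simps)
          then have "ennreal (f x \<theta> * ?e) = ennreal norm_const * ennreal (f x \<theta>0 * ?e) * ennreal (?c * exp (- ?g x))"
            using prod3[of norm_const "f x \<theta>0 * ?e" "?c * exp (- ?g x)"] fp norm_const_pos e c
            by (simp only: mult_nonneg_nonneg less_imp_le exp_gt_zero)
          then show ?thesis using True x by (simp add: q_eq mult.assoc)
        next
          case False
          then show ?thesis using x by (simp add: q_eq)
        qed
        have [measurable]: "(\<lambda>_. \<theta>) \<in> MX \<rightarrow>\<^sub>M borel" "(\<lambda>x. x) \<in> MX \<rightarrow>\<^sub>M MX" by simp_all
        have mA [measurable]: "(\<lambda>x. emeasure (tup x \<theta>) A) \<in> borel_measurable MX" by measurable
        have m\<alpha> [measurable]: "(\<lambda>x. \<alpha> x \<theta>) \<in> borel_measurable MX" by measurable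
        have mY [measurable]: "(\<lambda>x. Y x \<theta>) \<in> borel_measurable MX" by measurable
        have hfin: "(\<integral>\<^sup>+x. ?q \<theta> x * ennreal (exp (Y x \<theta>)) \<partial>MX) < \<infinity>"
          using elim b by (simp add: F3_def less_top)
        have "normalizer \<theta> < \<infinity>"
        proof -
          have "normalizer \<theta> \<le> ennreal ?c * (\<integral>\<^sup>+x. ?q \<theta> x * ennreal (exp (Y x \<theta>)) \<partial>MX)"
            unfolding normalizer_def
            by (rule tilting_normalizer[where g = ?g, OF _ mY qd c]) (use sepc in auto)
          also have "\<dots> < \<infinity>" using hfin by (simp add: ennreal_mult_less_top)
          finally show ?thesis .
        qed
        moreover have "0 < emeasure MX (Xset MX gL hL \<sigma> \<theta>hat \<theta>)"
        proof (rule ccontr)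
          assume "\<not> 0 < emeasure MX (Xset MX gL hL \<sigma> \<theta>hat \<theta>)"
          then have "AE x in MX. (if attained x \<theta> then 1 else 0 :: ennreal) = 0"
            unfolding emeasure_Xset by (subst nn_integral_0_iff_AE[symmetric]) auto
          then have "AE x in MX. \<not> attained x \<theta>" by eventually_elim (simp split: if_splits)
          then show False using natt by simp
        qed
        ultimately have reg: "regular \<theta>" using \<theta> by (simp add: regular_def)
        have "(\<integral>\<^sup>+x. ?q \<theta> x * F1 x \<theta> \<partial>MX)
            = (\<integral>\<^sup>+x. ?q \<theta> x * emeasure (tup x \<theta>) A \<partial>MX) + (\<integral>\<^sup>+x. ?q \<theta> x \<partial>MX)"
          using b by (simp add: F1_def distrib_left nn_integral_add)
        also have "\<dots> \<le> (\<integral>\<^sup>+x. ?q \<theta> x \<partial>MX) * (\<integral>\<^sup>+x. q \<theta> \<theta> x / (\<integral>\<^sup>+y. q \<theta> \<theta> y \<partial>MX) * emeasure (tup x \<theta>) A \<partial>MX)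
            + (\<integral>\<^sup>+x. ?q \<theta> x * ennreal (\<alpha> x \<theta>) \<partial>MX) + ennreal (ln K) * (\<integral>\<^sup>+x. ?q \<theta> x \<partial>MX)
            + (\<integral>\<^sup>+x. ?q \<theta> x * ennreal (exp (Y x \<theta>)) \<partial>MX) / ennreal K"
        proof (rule tilting_inequality[where g = ?g and c = ?c])
          show "?g \<in> borel_measurable MX" by measurable
        qed (use qd c sepc K hfin \<alpha> Y emeasure_tup_le_1 in auto)
        also have "\<dots> = (\<integral>\<^sup>+x. ?q \<theta> x * F2 x \<theta> \<partial>MX)"
        proof -
          have "?q \<theta> x * F2 x \<theta> = ?q \<theta> x * ref_mass A \<theta> + ?q \<theta> x * ennreal (\<alpha> x \<theta>)
              + ennreal (ln K) * ?q \<theta> x + ?q \<theta> x * ennreal (exp (Y x \<theta>)) / ennreal K" for x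
            using b reg unfolding F2_def
            by (simp only: if_True distrib_left ennreal_times_divide mult.commute[of "ennreal (ln K)"])
          then show ?thesis
            unfolding ref_mass_def[symmetric] normalizer_def[symmetric]
            by (simp add: nn_integral_add nn_integral_multc nn_integral_cmult nn_integral_divide)
        qed
        finally show ?thesis .
      qed
    qed
  qed
  then show ?thesis
    unfolding change_of_variables[OF F1m, symmetric] change_of_variables[OF F2m, symmetric] g1 g2 .
qed

text \<open>The bounds given to \<open>key_inequality\<close> are sums of a noise part and a data
  part. These are independent under the product law, so the exponential moment factors.\<close>

lemma tv_bound:
  fixes av bv :: "'x \<Rightarrow> real" and \<rho> \<epsilon> :: real
  assumes ref_exch: "\<And>\<theta>. regular \<theta> \<Longrightarrow> exchangeable_law MX M (ref_law \<theta>)"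
    and \<rho>: "\<rho> \<ge> 0" "\<sigma> * \<rho> \<le> 1/3" and \<epsilon>: "\<epsilon> \<ge> 0"
    and av [measurable]: "av \<in> borel_measurable MX" and bv [measurable]: "bv \<in> borel_measurable MX"
    and nonneg: "\<And>x. x \<in> space MX \<Longrightarrow> av x \<ge> 0" "\<And>x. x \<in> space MX \<Longrightarrow> bv x \<ge> 0"
    and Iav: "(\<integral>\<^sup>+x. ennreal (av x) \<partial>P0) \<le> ennreal \<epsilon>"
    and Ibv: "(\<integral>\<^sup>+x. ennreal (exp (bv x)) \<partial>P0) \<le> ennreal (exp \<epsilon>)"
    and sep: "\<And>\<theta>. \<theta> \<in> \<Theta> \<Longrightarrow> norm (\<theta> - \<theta>0) \<le> \<rho> \<Longrightarrow> \<exists>c. AE x in MX.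
      2 * (ln (f x \<theta>0) - ln (f x \<theta>) + (\<theta>0 - \<theta>) \<bullet> gL x \<theta> - c) \<le> av x \<and>
      2 * (c - (ln (f x \<theta>0) - ln (f x \<theta>) + (\<theta>0 - \<theta>) \<bullet> gL x \<theta>)) \<le> bv x"
    and A [measurable]: "A \<in> sets TS"
  shows "measure law A \<le> measure (reference \<rho>) A + (3 * \<sigma> * \<rho> + \<epsilon>
    + (1 - measure (P0 \<Otimes>\<^sub>M W) {z \<in> space (P0 \<Otimes>\<^sub>M W). good \<rho> (fst z) (snd z)}))"
proof -
  let ?PW = "P0 \<Otimes>\<^sub>M W"
  define s where "s = \<sigma> * \<rho>"
  have s: "0 \<le> s" "s \<le> 1/3" using \<rho> sigma_pos by (auto simp: s_def)
  \<comment> \<open>The noise term bounds the inner product of \<open>\<theta>0 - \<theta>\<close>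
    with the gradient by Cauchy-Schwarz, since \<rho>|gL| = s|noise|. The curvature term carries the
    1/2 of the Taylor remainder.\<close>
  define \<alpha> Y where "\<alpha> x \<theta> = s * norm (noise x \<theta>) + av x / 2" and "Y x \<theta> = s * norm (noise x \<theta>) + bv x / 2" for x \<theta>
  \<comment> \<open>\<open>L\<close> will bound both the mean of \<open>\<alpha>w\<close> and the
    logarithm of the exponential moment of \<open>Yw\<close>, which makes exp L the natural tangent
    point.\<close>
  define L where "L = 3 * s / 2 + \<epsilon> / 2"
  define K where "K = exp L"
  have L: "L \<ge> 0" using s \<epsilon> by (simp add: L_def)
  have K: "K \<ge> 1" "ln K = L" using L by (simp_all add: K_def)
  have P01: "emeasure P0 (space MX) = 1" using P0.emeasure_space_1 by simp
  have W1: "emeasure W UNIV = 1" using W.emeasure_space_1 by simp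
  have fstm [measurable]: "fst \<in> ?PW \<rightarrow>\<^sub>M MX" and sndm [measurable]: "snd \<in> ?PW \<rightarrow>\<^sub>M borel" by simp_all
  have indm [measurable]: "(\<lambda>z. indicator A (\<lambda>i\<in>{..M}. fst z) :: ennreal) \<in> borel_measurable ?PW"
    by (rule measurable_compose[OF measurable_compose[OF fstm const_tuple_measurable] borel_measurable_indicator[OF A]])
  have iter: "(\<integral>\<^sup>+x. \<integral>\<^sup>+w. h x w \<partial>W \<partial>P0) = (\<integral>\<^sup>+z. h (fst z) (snd z) \<partial>?PW)"
    if "(\<lambda>z. h (fst z) (snd z)) \<in> borel_measurable ?PW" for h
    using W.nn_integral_fst[OF that] by simp
  have sp: "fst z \<in> space MX" if "z \<in> space ?PW" for z using that by (auto simp: space_pair_measure)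
  \<comment> \<open>On the good event \<open>noise\<close> at the estimate is the noise actually
    drawn, so the bounds become \<open>\<alpha>w\<close> and \<open>Yw\<close>, which no longer
    involve the estimator.\<close>
  have good_noise: "noise x (\<theta>hat x w) = w" if "good \<rho> x w" for x w
    using that by (simp add: good_def ssosp_iff)
  define \<alpha>w where "\<alpha>w z = s * norm (snd z) + av (fst z) / 2" for z :: "'x \<times> (real^'d)"
  define Yw where "Yw z = s * norm (snd z) + bv (fst z) / 2" for z :: "'x \<times> (real^'d)"
  have [measurable]: "\<alpha>w \<in> borel_measurable ?PW" "Yw \<in> borel_measurable ?PW"
    unfolding \<alpha>w_def[abs_def] Yw_def[abs_def] by measurable
  have nn: "0 \<le> \<alpha>w z" "0 \<le> Yw z" if "z \<in> space ?PW" for z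
    using nonneg[OF sp[OF that]] s(1) by (simp_all add: \<alpha>w_def Yw_def)
  let ?G = "\<lambda>z. good \<rho> (fst z) (snd z)"

  \<comment> \<open>Moments of the two bounds under the product law\<close>
  have E\<alpha>: "(\<integral>\<^sup>+z. ennreal (\<alpha>w z) \<partial>?PW) \<le> ennreal L"
  proof -
    have "(\<integral>\<^sup>+z. ennreal (\<alpha>w z) \<partial>?PW) = (\<integral>\<^sup>+z. ennreal (s * norm (snd z)) + ennreal (av (fst z) / 2) \<partial>?PW)"
      using nonneg(1)[OF sp] s(1) by (intro nn_integral_cong) (simp add: \<alpha>w_def ennreal_plus)
    also have "\<dots> = (\<integral>\<^sup>+z. ennreal (s * norm (snd z)) \<partial>?PW) + (\<integral>\<^sup>+z. ennreal (av (fst z) / 2) \<partial>?PW)"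
      by (rule nn_integral_add) measurable
    also have "(\<integral>\<^sup>+z. ennreal (s * norm (snd z)) \<partial>?PW) = (\<integral>\<^sup>+x. \<integral>\<^sup>+w. ennreal (s * norm w) \<partial>W \<partial>P0)"
      by (rule iter[symmetric]) measurable
    also have "\<dots> = (\<integral>\<^sup>+w. ennreal (s * norm w) \<partial>W)" by (simp add: P01)
    also have "\<dots> \<le> ennreal (3 * s / 2)"
    proof (rule W.nn_integral_le_of_exp_bound)
      show "(\<integral>\<^sup>+w. ennreal (exp (s * norm w)) \<partial>W) \<le> ennreal (exp (3 * s / 2))"
        by (rule gauss_vec_exp_norm[OF s])
    qed (use s in auto)
    also have "(\<integral>\<^sup>+z. ennreal (av (fst z) / 2) \<partial>?PW) = (\<integral>\<^sup>+x. \<integral>\<^sup>+w. ennreal (av x / 2) \<partial>W \<partial>P0)"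
      by (rule iter[symmetric]) measurable
    also have "\<dots> = (\<integral>\<^sup>+x. ennreal (av x) / 2 \<partial>P0)"
      using nonneg(1) by (intro nn_integral_cong) (simp add: W1 divide_ennreal flip: ennreal_numeral)
    also have "\<dots> = (\<integral>\<^sup>+x. ennreal (av x) \<partial>P0) / 2" by (rule nn_integral_divide) measurable
    also have "\<dots> \<le> ennreal \<epsilon> / 2" by (rule divide_right_mono_ennreal[OF Iav])
    also have "ennreal \<epsilon> / 2 = ennreal (\<epsilon> / 2)" using \<epsilon> by (simp add: divide_ennreal flip: ennreal_numeral)
    finally show ?thesis using s \<epsilon> by (simp add: L_def ennreal_plus add_mono)
  qed

  have EY: "(\<integral>\<^sup>+z. ennreal (exp (Yw z)) \<partial>?PW) \<le> ennreal K"
  proof -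
    have half: "(\<integral>\<^sup>+x. ennreal (exp (bv x / 2)) \<partial>P0) \<le> ennreal (exp (\<epsilon> / 2))"
    proof -
      \<comment> \<open>Jensen for the square root in the form of an AM-GM inequality, weighted so
        that equality holds at b = \<epsilon>.\<close>
      have "exp (b / 2) \<le> exp (\<epsilon> / 2) / 2 + exp (- \<epsilon> / 2) / 2 * exp b" for b :: real
      proof -
        have e: "exp b = (exp (b / 2))\<^sup>2" "exp (- \<epsilon> / 2) = 1 / exp (\<epsilon> / 2)"
          by (simp_all add: power2_eq_square exp_add[symmetric] exp_minus inverse_eq_divide)
        have "2 * exp (b / 2) * exp (\<epsilon> / 2) \<le> (exp (\<epsilon> / 2))\<^sup>2 + (exp (b / 2))\<^sup>2"
          using zero_le_power2[of "exp (b / 2) - exp (\<epsilon> / 2)"] by (simp add: power2_diff)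
        then show ?thesis unfolding e by (simp add: field_simps power2_eq_square)
      qed
      then have "(\<integral>\<^sup>+x. ennreal (exp (bv x / 2)) \<partial>P0)
          \<le> (\<integral>\<^sup>+x. ennreal (exp (\<epsilon> / 2) / 2) + ennreal (exp (- \<epsilon> / 2) / 2) * ennreal (exp (bv x)) \<partial>P0)"
        by (intro nn_integral_mono) (simp add: ennreal_mult'[symmetric] ennreal_plus[symmetric] del: ennreal_plus)
      also have "\<dots> = ennreal (exp (\<epsilon> / 2) / 2) + ennreal (exp (- \<epsilon> / 2) / 2) * (\<integral>\<^sup>+x. ennreal (exp (bv x)) \<partial>P0)"
        by (simp add: nn_integral_add nn_integral_cmult P01)
      also have "\<dots> \<le> ennreal (exp (\<epsilon> / 2) / 2) + ennreal (exp (- \<epsilon> / 2) / 2) * ennreal (exp \<epsilon>)"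
        by (intro add_left_mono mult_left_mono Ibv) auto
      also have "\<dots> = ennreal (exp (\<epsilon> / 2) / 2 + exp (- \<epsilon> / 2) / 2 * exp \<epsilon>)"
        by (simp add: ennreal_mult'[symmetric] ennreal_plus[symmetric] del: ennreal_plus)
      also have "exp (\<epsilon> / 2) / 2 + exp (- \<epsilon> / 2) / 2 * exp \<epsilon> = exp (\<epsilon> / 2)"
        by (simp add: exp_add[symmetric])
      finally show ?thesis .
    qed
    have "(\<integral>\<^sup>+z. ennreal (exp (Yw z)) \<partial>?PW) = (\<integral>\<^sup>+x. \<integral>\<^sup>+w. ennreal (exp (bv x / 2)) * ennreal (exp (s * norm w)) \<partial>W \<partial>P0)"
      by (subst iter, measurable, intro nn_integral_cong) (simp add: Yw_def exp_add ennreal_mult mult.commute)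
    also have "\<dots> = (\<integral>\<^sup>+x. ennreal (exp (bv x / 2)) \<partial>P0) * (\<integral>\<^sup>+w. ennreal (exp (s * norm w)) \<partial>W)"
      by (simp add: nn_integral_cmult nn_integral_multc)
    also have "\<dots> \<le> ennreal (exp (\<epsilon> / 2)) * ennreal (exp (3 * s / 2))"
      by (intro mult_mono half gauss_vec_exp_norm s) auto
    also have "\<dots> = ennreal K" by (simp add: K_def L_def ennreal_mult'[symmetric] exp_add[symmetric] add.commute)
    finally show ?thesis .
  qed

  \<comment> \<open>Mass of the good event and its share of the exponential moment\<close>
  define EG where "EG = (\<integral>\<^sup>+z. (if ?G z then ennreal (exp (Yw z)) else 0) \<partial>?PW)"
  define p where "p = measure ?PW {z \<in> space ?PW. ?G z}"
  have Gset [measurable]: "{z \<in> space ?PW. ?G z} \<in> sets ?PW" by measurable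
  have p: "(\<integral>\<^sup>+z. (if ?G z then 1 else 0) \<partial>?PW) = ennreal p"
  proof -
    have "(\<integral>\<^sup>+z. (if ?G z then 1 else 0) \<partial>?PW) = (\<integral>\<^sup>+z. indicator {z \<in> space ?PW. ?G z} z \<partial>?PW)"
      by (intro nn_integral_cong) (simp add: indicator_def)
    also have "\<dots> = emeasure ?PW {z \<in> space ?PW. ?G z}" using Gset by (rule nn_integral_indicator)
    finally show ?thesis by (simp add: p_def PW.emeasure_eq_measure)
  qed
  have p01: "0 \<le> p" "p \<le> 1" by (simp_all add: p_def)
  have np: "(\<integral>\<^sup>+z. (if ?G z then 0 else 1) \<partial>?PW) = ennreal (1 - p)"
  proof -
    have "(\<integral>\<^sup>+z. (if ?G z then 0 else 1) \<partial>?PW) = (\<integral>\<^sup>+z. indicator (space ?PW - {z \<in> space ?PW. ?G z}) z \<partial>?PW)"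
      by (intro nn_integral_cong) (simp add: indicator_def)
    also have "\<dots> = emeasure ?PW (space ?PW - {z \<in> space ?PW. ?G z})"
      by (rule nn_integral_indicator) (rule sets.Diff[OF sets.top Gset])
    also have "\<dots> = ennreal (measure ?PW (space ?PW - {z \<in> space ?PW. ?G z}))"
      by (rule PW.emeasure_eq_measure)
    finally show ?thesis using PW.prob_compl[OF Gset] by (simp add: p_def)
  qed
  \<comment> \<open>Off the good event exp Yw is at least 1, so the full moment exceeds the good
    part \<open>EG\<close> by at least 1 - p.\<close>
  have EGK: "EG + ennreal (1 - p) \<le> ennreal K"
  proof -
    have "EG + ennreal (1 - p) = (\<integral>\<^sup>+z. (if ?G z then ennreal (exp (Yw z)) else 0) + (if ?G z then 0 else 1) \<partial>?PW)"
      unfolding EG_def np[symmetric] by (rule nn_integral_add[symmetric]) measurable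
    also have "\<dots> \<le> (\<integral>\<^sup>+z. ennreal (exp (Yw z)) \<partial>?PW)"
      using nn(2) by (intro nn_integral_mono) auto
    finally show ?thesis using EY by (rule order_trans)
  qed

  have key: "(\<integral>\<^sup>+x. \<integral>\<^sup>+w. (if good \<rho> x w then emeasure (tup x (\<theta>hat x w)) A + 1 else 0) \<partial>W \<partial>P0)
    \<le> (\<integral>\<^sup>+x. \<integral>\<^sup>+w. (if good \<rho> x w then (if regular (\<theta>hat x w) then ref_mass A (\<theta>hat x w) else 0)
        + ennreal (\<alpha> x (\<theta>hat x w)) + ennreal (ln K) + ennreal (exp (Y x (\<theta>hat x w))) / ennreal K else 0) \<partial>W \<partial>P0)"
  proof (rule key_inequality[OF A K(1)])
    show "(\<lambda>z. \<alpha> (fst z) (snd z)) \<in> borel_measurable (MX \<Otimes>\<^sub>M borel)"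
      "(\<lambda>z. Y (fst z) (snd z)) \<in> borel_measurable (MX \<Otimes>\<^sub>M borel)"
      unfolding \<alpha>_def Y_def by measurable
    show "\<alpha> x \<theta> \<ge> 0" "Y x \<theta> \<ge> 0" if "x \<in> space MX" for x \<theta>
      using nonneg[OF that] s(1) by (simp_all add: \<alpha>_def Y_def)
    have eq: "(if good \<rho> x w then ennreal (exp (Y x (\<theta>hat x w))) else 0)
        = (if good \<rho> x w then ennreal (exp (Yw (x, w))) else 0)" for x w
      using good_noise by (simp add: Y_def Yw_def)
    have "(\<lambda>z. if ?G z then ennreal (exp (Yw z)) else 0) \<in> borel_measurable ?PW" by measurable
    then have "(\<integral>\<^sup>+x. \<integral>\<^sup>+w. (if good \<rho> x w then ennreal (exp (Y x (\<theta>hat x w))) else 0) \<partial>W \<partial>P0) = EG"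
      unfolding eq using iter[of "\<lambda>x w. if good \<rho> x w then ennreal (exp (Yw (x, w))) else 0"]
      by (simp add: EG_def cong: if_cong)
    also have "EG \<le> ennreal K" using EGK by (rule order_trans[rotated]) simp
    finally show "(\<integral>\<^sup>+x. \<integral>\<^sup>+w. (if good \<rho> x w then ennreal (exp (Y x (\<theta>hat x w))) else 0) \<partial>W \<partial>P0) < \<infinity>"
      by (simp add: le_less_trans)
    fix \<theta> assume \<theta>: "\<theta> \<in> \<Theta>" "norm (\<theta> - \<theta>0) \<le> \<rho>"
    obtain c where c: "AE x in MX.
      2 * (ln (f x \<theta>0) - ln (f x \<theta>) + (\<theta>0 - \<theta>) \<bullet> gL x \<theta> - c) \<le> av x \<and>
      2 * (c - (ln (f x \<theta>0) - ln (f x \<theta>) + (\<theta>0 - \<theta>) \<bullet> gL x \<theta>)) \<le> bv x"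
      using sep[OF \<theta>] by blast
    have inner: "\<bar>(\<theta>0 - \<theta>) \<bullet> gL x \<theta>\<bar> \<le> s * norm (noise x \<theta>)" for x
    proof -
      have "\<bar>(\<theta>0 - \<theta>) \<bullet> gL x \<theta>\<bar> \<le> norm (\<theta>0 - \<theta>) * norm (gL x \<theta>)" by (rule Cauchy_Schwarz_ineq2)
      also have "\<dots> \<le> \<rho> * norm (gL x \<theta>)" using \<theta>(2) by (intro mult_right_mono) (auto simp: norm_minus_commute)
      also have "\<dots> = s * norm (noise x \<theta>)" using sigma_pos by (simp add: s_def noise_def)
      finally show ?thesis .
    qed
    from c have "AE x in MX. ln (f x \<theta>0) - ln (f x \<theta>) - c \<le> \<alpha> x \<theta> \<and> - (ln (f x \<theta>0) - ln (f x \<theta>) - c) \<le> Y x \<theta>"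
    proof eventually_elim
      case (elim x)
      then show ?case using inner[of x] unfolding \<alpha>_def Y_def by (auto simp: abs_le_iff)
    qed
    then show "\<exists>c. AE x in MX. ln (f x \<theta>0) - ln (f x \<theta>) - c \<le> \<alpha> x \<theta> \<and> - (ln (f x \<theta>0) - ln (f x \<theta>) - c) \<le> Y x \<theta>"
      by blast
  qed

  \<comment> \<open>Accounting for an event over data and noise\<close>
  have tupm [measurable]: "(\<lambda>z. emeasure (tup (fst z) (\<theta>hat (fst z) (snd z))) A) \<in> borel_measurable ?PW" by measurable
  define T1 where "T1 z = (if ?G z then emeasure (tup (fst z) (\<theta>hat (fst z) (snd z))) A + 1 else 0)" for z
  define T2 where "T2 z = (if ?G z then (if regular (\<theta>hat (fst z) (snd z)) then ref_mass A (\<theta>hat (fst z) (snd z)) else 0)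
        + ennreal (\<alpha>w z) + ennreal L + ennreal (exp (Yw z)) / ennreal K else 0)" for z
  \<comment> \<open>A stationary estimate far from \<open>\<theta>0\<close> is charged the full 1;
    without a stationary estimate the procedure copies the data.\<close>
  define T3 where "T3 z = (if ?G z then 0 else if ssosp (fst z) (snd z) then 1 else indicator A (\<lambda>i\<in>{..M}. fst z) :: ennreal)" for z
  have [measurable]: "T1 \<in> borel_measurable ?PW" "T2 \<in> borel_measurable ?PW" "T3 \<in> borel_measurable ?PW"
    unfolding T1_def[abs_def] T2_def[abs_def] T3_def[abs_def] by measurable
  have T12: "(\<integral>\<^sup>+z. T1 z \<partial>?PW) \<le> (\<integral>\<^sup>+z. T2 z \<partial>?PW)"
  proof -
    have 1: "(\<integral>\<^sup>+x. \<integral>\<^sup>+w. (if good \<rho> x w then emeasure (tup x (\<theta>hat x w)) A + 1 else 0) \<partial>W \<partial>P0) = (\<integral>\<^sup>+z. T1 z \<partial>?PW)"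
      using iter[of "\<lambda>x w. T1 (x, w)"] by (simp add: T1_def[abs_def] cong: if_cong)
    have e: "(if good \<rho> x w then (if regular (\<theta>hat x w) then ref_mass A (\<theta>hat x w) else 0)
        + ennreal (\<alpha> x (\<theta>hat x w)) + ennreal (ln K) + ennreal (exp (Y x (\<theta>hat x w))) / ennreal K else 0) = T2 (x, w)" for x w
      using good_noise by (simp add: T2_def \<alpha>_def \<alpha>w_def Y_def Yw_def K(2))
    have 2: "(\<integral>\<^sup>+x. \<integral>\<^sup>+w. T2 (x, w) \<partial>W \<partial>P0) = (\<integral>\<^sup>+z. T2 z \<partial>?PW)"
      using iter[of "\<lambda>x w. T2 (x, w)"] by simp
    show ?thesis using key unfolding 1 e 2 .
  qed
  define R where "R z = (if ?G z \<and> regular (\<theta>hat (fst z) (snd z)) then ref_mass A (\<theta>hat (fst z) (snd z))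
     else indicator A (\<lambda>i\<in>{..M}. fst z))" for z
  have [measurable]: "R \<in> borel_measurable ?PW" unfolding R_def[abs_def] by measurable
  have ref: "emeasure (reference \<rho>) A = (\<integral>\<^sup>+z. R z \<partial>?PW)"
    using iter[of "\<lambda>x w. R (x, w)"]
    by (subst emeasure_reference[OF _ A], blast intro: ref_exch) (simp add: R_def[abs_def] cong: if_cong)
  define S where "S z = (if ssosp (fst z) (snd z) then emeasure (tup (fst z) (\<theta>hat (fst z) (snd z))) A
     else indicator A (\<lambda>i\<in>{..M}. fst z))" for z
  have [measurable]: "S \<in> borel_measurable ?PW" unfolding S_def[abs_def] by measurable
  have law: "emeasure law A = (\<integral>\<^sup>+z. S z \<partial>?PW)"
    unfolding emeasure_law[OF A] using iter[of "\<lambda>x w. S (x, w)"] by (simp add: S_def[abs_def] cong: if_cong)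
  have "emeasure law A + ennreal p = (\<integral>\<^sup>+z. S z + (if ?G z then 1 else 0) \<partial>?PW)"
    unfolding law p[symmetric] by (rule nn_integral_add[symmetric]) measurable
  also have "\<dots> \<le> (\<integral>\<^sup>+z. T1 z + T3 z \<partial>?PW)"
    using emeasure_tup_le_1[OF sp] by (intro nn_integral_mono) (auto simp: S_def T1_def T3_def good_def)
  also have "\<dots> = (\<integral>\<^sup>+z. T1 z \<partial>?PW) + (\<integral>\<^sup>+z. T3 z \<partial>?PW)" by (rule nn_integral_add) measurable
  also have "\<dots> \<le> (\<integral>\<^sup>+z. T2 z \<partial>?PW) + (\<integral>\<^sup>+z. T3 z \<partial>?PW)" by (intro add_right_mono T12)
  also have "\<dots> = (\<integral>\<^sup>+z. T2 z + T3 z \<partial>?PW)" by (rule nn_integral_add[symmetric]) measurable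
  also have "\<dots> \<le> (\<integral>\<^sup>+z. R z + ennreal (\<alpha>w z) + ennreal L * (if ?G z then 1 else 0)
      + (if ?G z then ennreal (exp (Yw z)) else 0) / ennreal K + (if ?G z then 0 else 1) \<partial>?PW)"
  proof (rule nn_integral_mono)
    fix z assume "z \<in> space ?PW"
    show "T2 z + T3 z \<le> R z + ennreal (\<alpha>w z) + ennreal L * (if ?G z then 1 else 0)
      + (if ?G z then ennreal (exp (Yw z)) else 0) / ennreal K + (if ?G z then 0 else 1)"
    proof (cases "?G z")
      case True
      then show ?thesis by (auto simp: T2_def T3_def R_def intro!: add_right_mono)
    next
      case False
      have "(indicator A (\<lambda>i\<in>{..M}. fst z) :: ennreal) \<le> 1" by (simp add: indicator_def)
      then have "T2 z + T3 z \<le> 1" using False by (simp add: T2_def T3_def)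
      also have "1 \<le> (R z + ennreal (\<alpha>w z)) + 1" by simp
      finally show ?thesis using False by simp
    qed
  qed
  also have "\<dots> = emeasure (reference \<rho>) A + (\<integral>\<^sup>+z. ennreal (\<alpha>w z) \<partial>?PW) + ennreal L * ennreal p + EG / ennreal K + ennreal (1 - p)"
    unfolding ref EG_def p[symmetric] np[symmetric]
    by (simp add: nn_integral_add nn_integral_cmult nn_integral_divide)
  also have "\<dots> \<le> emeasure (reference \<rho>) A + ennreal L + ennreal L * ennreal p + EG / ennreal K + ennreal (1 - p)"
    by (intro add_right_mono add_left_mono E\<alpha>)
  finally have main: "emeasure law A + ennreal p
      \<le> emeasure (reference \<rho>) A + ennreal L + ennreal L * ennreal p + EG / ennreal K + ennreal (1 - p)" .

  define e where "e = enn2real EG"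
  have "EG \<le> ennreal K" using EGK by (rule order_trans[rotated]) simp
  then have EG: "EG = ennreal e" "0 \<le> e" by (auto simp: e_def le_less_trans)
  have eK: "e + (1 - p) \<le> K" using EGK EG p01 K unfolding EG by (simp add: ennreal_plus[symmetric] del: ennreal_plus)
  have fm: "finite_measure law" "finite_measure (reference \<rho>)"
    using prob_space_law reference_exch[OF ref_exch] by (simp_all add: exchangeable_law_def prob_space.finite_measure)
  have "ennreal (measure law A + p) \<le> ennreal (measure (reference \<rho>) A + L + L * p + e / K + (1 - p))"
    using main p01 L K(1) EG
    unfolding finite_measure.emeasure_eq_measure[OF fm(1)] finite_measure.emeasure_eq_measure[OF fm(2)]
    by (simp add: ennreal_plus ennreal_mult' divide_ennreal)
  then have "measure law A + p \<le> measure (reference \<rho>) A + L + L * p + e / K + (1 - p)"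
    using p01 L K(1) EG by (subst (asm) ennreal_le_iff) auto
  \<comment> \<open>The part of the moment lying off the good event saves (1 - p)/K. The defect left
    over is (1 - p)(1 - 1/K), and 1 - 1/K \<le> ln K = L turns it into (1 - p) L, which completes p
    L to L.\<close>
  moreover have "e / K \<le> 1 - (1 - p) / K"
  proof -
    have "e / K \<le> (K - (1 - p)) / K" using eK K(1) by (intro divide_right_mono) auto
    then show ?thesis using K(1) by (simp add: diff_divide_distrib)
  qed
  moreover have "(1 - p) * (1 - 1 / K) \<le> (1 - p) * L"
  proof (rule mult_left_mono)
    have "ln (1 / K) \<le> 1 / K - 1" using K(1) by (intro ln_le_minus_one) simp
    then show "1 - 1 / K \<le> L" using K by (simp add: ln_div)
  qed (use p01 in simp)
  ultimately have "measure law A \<le> measure (reference \<rho>) A + (2 * L + (1 - p))"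
    by (simp add: algebra_simps)
  then show ?thesis by (simp add: L_def s_def p_def algebra_simps)
qed

end

subsection \<open>The theorem\<close>

theorem theorem1:
  fixes MX :: "'x measure"
    and f :: "'x \<Rightarrow> real^'d \<Rightarrow> real"
    and R :: "real^'d \<Rightarrow> real"
    and \<sigma> :: real
    and \<Theta> :: "(real^'d) set"
    and gL :: "'x \<Rightarrow> real^'d \<Rightarrow> real^'d"
    and hL :: "'x \<Rightarrow> real^'d \<Rightarrow> real^'d^'d"
    and gN :: "'x \<Rightarrow> real^'d \<Rightarrow> real^'d"
    and hN :: "'x \<Rightarrow> real^'d \<Rightarrow> real^'d^'d"
    and \<theta>hat :: "'x \<Rightarrow> real^'d \<Rightarrow> real^'d"
    and M :: nat
    and Ptil :: "'x \<times> (real^'d) \<Rightarrow> (nat \<Rightarrow> 'x) measure"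
    and r \<delta> \<epsilon> :: "real^'d \<Rightarrow> real"
    and \<theta>0 :: "real^'d"
  assumes sigma_pos: "\<sigma> > 0"
    (* Assumption 1 *)
    and Theta_open: "open \<Theta>" and Theta_convex: "convex \<Theta>"
    and f_meas: "(\<lambda>(x, \<theta>). f x \<theta>) \<in> borel_measurable (MX \<Otimes>\<^sub>M borel)"
    and R_meas: "R \<in> borel_measurable borel"
    and f_pos: "\<forall>x\<in>space MX. \<forall>\<theta>\<in>\<Theta>. f x \<theta> > 0"
    and P_prob: "\<forall>\<theta>\<in>\<Theta>. prob_space (density MX (\<lambda>x. ennreal (f x \<theta>)))"
    and L_grad: "\<forall>x\<in>space MX. \<forall>\<theta>\<in>\<Theta>.
                   ((\<lambda>t. - ln (f x t) + R t) has_derivative (\<lambda>h. gL x \<theta> \<bullet> h)) (at \<theta>)"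
    and L_hess: "\<forall>x\<in>space MX. \<forall>\<theta>\<in>\<Theta>. (gL x has_derivative (\<lambda>h. hL x \<theta> *v h)) (at \<theta>)"
    and L_C2: "\<forall>x\<in>space MX. continuous_on \<Theta> (hL x)"
    and gL_meas: "(\<lambda>(x, \<theta>). gL x \<theta>) \<in> borel_measurable (MX \<Otimes>\<^sub>M borel)"
    and hL_meas: "(\<lambda>(x, \<theta>). hL x \<theta>) \<in> borel_measurable (MX \<Otimes>\<^sub>M borel)"
    (* the estimator *)
    and est_range: "\<forall>x\<in>space MX. \<forall>w. \<theta>hat x w \<in> \<Theta>"
    and est_meas: "(\<lambda>(x, w). \<theta>hat x w) \<in> borel_measurable (MX \<Otimes>\<^sub>M borel)"
    (* the sampling kernel and condition (E) *)
    and Ptil_kernel: "Ptil \<in> MX \<Otimes>\<^sub>M restrict_space borel \<Theta>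
                              \<rightarrow>\<^sub>M prob_algebra (PiM {..<M} (\<lambda>_. MX))"
    and cond_E: "\<forall>\<theta>\<in>\<Theta>. 0 < emeasure MX (Xset MX gL hL \<sigma> \<theta>hat \<theta>)
                  \<and> (\<integral>\<^sup>+ y. cond_dens_un MX f gL hL \<sigma> \<theta>hat \<theta> \<theta> y \<partial>MX) < \<infinity>
                  \<longrightarrow> exchangeable_law MX M
                        (cond_law MX f gL hL \<sigma> \<theta>hat \<theta> \<theta> \<bind>
                          (\<lambda>x. distr (Ptil (x, \<theta>)) (tuple_space MX M) (join_tuple M x)))"
    (* Assumption 2 *)
    and r_pos: "\<forall>t\<in>\<Theta>. r t > 0" and delta_nonneg: "\<forall>t\<in>\<Theta>. \<delta> t \<ge> 0"
    and A2: "\<forall>t0\<in>\<Theta>.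
               measure (density MX (\<lambda>x. ennreal (f x t0)) \<Otimes>\<^sub>M gauss_vec)
                 {(x, w) \<in> space MX \<times> UNIV. norm (\<theta>hat x w - t0) \<le> r t0
                                          \<and> is_SSOSP gL hL \<sigma> x w (\<theta>hat x w)}
               \<ge> 1 - \<delta> t0"
    (* Assumption 3: H(theta;x) = hN x theta is the Hessian of -log f(x;.) *)
    and N_grad: "\<forall>x\<in>space MX. \<forall>\<theta>\<in>\<Theta>.
                   ((\<lambda>t. - ln (f x t)) has_derivative (\<lambda>h. gN x \<theta> \<bullet> h)) (at \<theta>)"
    and N_hess: "\<forall>x\<in>space MX. \<forall>\<theta>\<in>\<Theta>. (gN x has_derivative (\<lambda>h. hN x \<theta> *v h)) (at \<theta>)"
    and eps_nonneg: "\<forall>t\<in>\<Theta>. \<epsilon> t \<ge> 0"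
    and A3_int: "\<forall>t0\<in>\<Theta>. \<forall>\<theta>\<in>cball t0 (r t0) \<inter> \<Theta>.
                   integrable (density MX (\<lambda>x. ennreal (f x t0))) (\<lambda>x. hN x \<theta>)"
    and A3_lower: "\<forall>t0\<in>\<Theta>.
        (\<integral>\<^sup>+ x. (\<Squnion>\<theta>\<in>cball t0 (r t0) \<inter> \<Theta>.
              ennreal ((r t0)\<^sup>2 * max 0 (lmax
                ((\<integral>y. hN y \<theta> \<partial>density MX (\<lambda>x. ennreal (f x t0))) - hN x \<theta>))))
          \<partial>density MX (\<lambda>x. ennreal (f x t0))) \<le> ennreal (\<epsilon> t0)"
    and A3_upper: "\<forall>t0\<in>\<Theta>.
        (\<integral>\<^sup>+ x. (\<Squnion>\<theta>\<in>cball t0 (r t0) \<inter> \<Theta>.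
              ennreal (exp ((r t0)\<^sup>2 * max 0 (lmax
                (hN x \<theta> - (\<integral>y. hN y \<theta> \<partial>density MX (\<lambda>x. ennreal (f x t0))))))))
          \<partial>density MX (\<lambda>x. ennreal (f x t0))) \<le> ennreal (exp (\<epsilon> t0))"
    and theta0: "\<theta>0 \<in> \<Theta>"
  shows "dexch MX M (aCSS_law MX M \<sigma> gL hL \<theta>hat Ptil (density MX (\<lambda>x. ennreal (f x \<theta>0))))
           \<le> 3 * \<sigma> * r \<theta>0 + \<delta> \<theta>0 + \<epsilon> \<theta>0
         \<and> (\<forall>T \<alpha>. T \<in> borel_measurable MX \<longrightarrow> 0 \<le> \<alpha> \<longrightarrow> \<alpha> \<le> 1 \<longrightarrow>
              measure (aCSS_law MX M \<sigma> gL hL \<theta>hat Ptil (density MX (\<lambda>x. ennreal (f x \<theta>0))))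
                {z \<in> space (tuple_space MX M). pval T M z \<le> \<alpha>}
              \<le> \<alpha> + 3 * \<sigma> * r \<theta>0 + \<delta> \<theta>0 + \<epsilon> \<theta>0)"
proof -
  interpret acss MX f \<sigma> \<Theta> gL hL \<theta>hat M Ptil \<theta>0
    by (rule acss.intro[OF sigma_pos Theta_open f_meas _ _ _ gL_meas hL_meas _ est_meas Ptil_kernel theta0])
      (use f_pos P_prob theta0 L_hess est_range in blast)+
  define \<rho> where "\<rho> = r \<theta>0"
  define e where "e = \<epsilon> \<theta>0"
  define D where "D = cball \<theta>0 \<rho> \<inter> \<Theta>"
  define J where "J \<theta> = (\<integral>y. hN y \<theta> \<partial>P0)" for \<theta>
  define lo where "lo x = (\<Squnion>\<theta>\<in>D. ennreal (\<rho>\<^sup>2 * max 0 (lmax (J \<theta> - hN x \<theta>))))" for x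
  define up where "up x = (\<Squnion>\<theta>\<in>D. ennreal (exp (\<rho>\<^sup>2 * max 0 (lmax (hN x \<theta> - J \<theta>)))))" for x
  have \<rho>: "\<rho> > 0" and e: "e \<ge> 0" and \<delta>: "\<delta> \<theta>0 \<ge> 0"
    using r_pos eps_nonneg delta_nonneg theta0 by (auto simp: \<rho>_def e_def)
  have Ilo: "(\<integral>\<^sup>+x. lo x \<partial>P0) \<le> ennreal e"
    using A3_lower theta0 by (simp add: lo_def D_def J_def \<rho>_def e_def)
  have Iup: "(\<integral>\<^sup>+x. up x \<partial>P0) \<le> ennreal (exp e)"
    using A3_upper theta0 by (simp add: up_def D_def J_def \<rho>_def e_def)
  have finlo: "(\<integral>\<^sup>+x. lo x \<partial>P0) < \<infinity>" and finup: "(\<integral>\<^sup>+x. up x \<partial>P0) < \<infinity>"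
    using le_less_trans[OF Ilo] le_less_trans[OF Iup] by auto
  have ref_exch: "exchangeable_law MX M (ref_law \<theta>)" if "regular \<theta>" for \<theta>
    using cond_E that by (simp add: regular_def normalizer_def ref_law_def)
  \<comment> \<open>The curvature hypotheses are integrals under \<open>P0\<close>, while
    \<open>sep\<close> is needed under the base measure; positivity of the density gives both the
    same null sets.\<close>
  have AE_P0: "(AE x in P0. Q x) \<longleftrightarrow> (AE x in MX. Q x)" for Q
  proof -
    have "(AE x in P0. Q x) \<longleftrightarrow> (AE x in MX. 0 < ennreal (f x \<theta>0) \<longrightarrow> Q x)"
      by (rule AE_density) measurable
    also have "\<dots> \<longleftrightarrow> (AE x in MX. Q x)"
      using f_pos theta0 by (intro AE_cong) auto
    finally show ?thesis .
  qed

  \<comment> \<open>Measurable replacements for the suprema\<close>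
  obtain v1 where v1 [measurable]: "v1 \<in> borel_measurable P0" and v1le: "\<And>x. x \<in> space P0 \<Longrightarrow> v1 x \<le> lo x"
    and v1I: "(\<integral>\<^sup>+x. v1 x \<partial>P0) = (\<integral>\<^sup>+x. lo x \<partial>P0)"
    by (rule measurable_minorant[of P0 lo]) (rule that)
  obtain v2 where v2 [measurable]: "v2 \<in> borel_measurable P0" and v2le: "\<And>x. x \<in> space P0 \<Longrightarrow> v2 x \<le> up x"
    and v2I: "(\<integral>\<^sup>+x. v2 x \<partial>P0) = (\<integral>\<^sup>+x. up x \<partial>P0)"
    by (rule measurable_minorant[of P0 up]) (rule that)
  have v1M [measurable]: "v1 \<in> borel_measurable MX" and v2M [measurable]: "v2 \<in> borel_measurable MX"
    using v1 v2 by simp_all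
  have v1fin: "AE x in P0. v1 x \<noteq> \<infinity>" using v1I finlo by (intro nn_integral_PInf_AE) auto
  have v2fin: "AE x in P0. v2 x \<noteq> \<infinity>" using v2I finup by (intro nn_integral_PInf_AE) auto
  \<comment> \<open>The constant 1 lies below \<open>up\<close>, so maximality carries it over to
    the minorant; a nonnegative logarithm can then be taken.\<close>
  have v2ge: "AE x in P0. 1 \<le> v2 x"
  proof (rule measurable_minorant_maximal[OF v2 _ v2le v2I _ finup])
    fix x
    have "1 \<le> ennreal (exp (\<rho>\<^sup>2 * max 0 (lmax (hN x \<theta>0 - J \<theta>0))))" by simp
    also have "\<dots> \<le> up x" unfolding up_def using theta0 \<rho> by (intro SUP_upper) (simp add: D_def)
    finally show "1 \<le> up x" .
  qed simp_all
  \<comment> \<open>\<open>enn2real\<close> and \<open>max 1\<close> change values on null sets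
    only, and make the bounds real and nonnegative everywhere.\<close>
  define av bv where "av x = enn2real (v1 x)" and "bv x = ln (max 1 (enn2real (v2 x)))" for x
  have avm [measurable]: "av \<in> borel_measurable MX" and bvm [measurable]: "bv \<in> borel_measurable MX"
    unfolding av_def[abs_def] bv_def[abs_def] by measurable
  have Iav: "(\<integral>\<^sup>+x. ennreal (av x) \<partial>P0) \<le> ennreal e"
  proof -
    have "AE x in P0. ennreal (av x) = v1 x"
      using v1fin by eventually_elim (simp add: av_def less_top)
    then have "(\<integral>\<^sup>+x. ennreal (av x) \<partial>P0) = (\<integral>\<^sup>+x. v1 x \<partial>P0)" by (rule nn_integral_cong_AE)
    then show ?thesis using v1I Ilo by simp
  qed
  have Ibv: "(\<integral>\<^sup>+x. ennreal (exp (bv x)) \<partial>P0) \<le> ennreal (exp e)"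
  proof -
    have "(\<integral>\<^sup>+x. ennreal (exp (bv x)) \<partial>P0) = (\<integral>\<^sup>+x. v2 x \<partial>P0)"
    proof (rule nn_integral_cong_AE)
      show "AE x in P0. ennreal (exp (bv x)) = v2 x" using v2fin v2ge
      proof eventually_elim
        case (elim x)
        then obtain t where t: "v2 x = ennreal t" "0 \<le> t" by (cases "v2 x") auto
        then have "1 \<le> t" using elim by (simp add: ennreal_ge_1)
        then show ?case using t by (simp add: bv_def max_def)
      qed
    qed
    then show ?thesis using v2I Iup by simp
  qed

  have symN: "transpose (hN x \<theta>) = hN x \<theta>" if "x \<in> space MX" "\<theta> \<in> \<Theta>" for x \<theta>
    by (rule second_derivative_symmetric[OF Theta_open that(2), where f = "\<lambda>t. - ln (f x t)" and g = "gN x"])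
      (use N_grad N_hess that in auto)
  have symJ: "transpose (J \<theta>) = J \<theta>" if "\<theta> \<in> cball \<theta>0 \<rho> \<inter> \<Theta>" for \<theta>
  proof -
    have int: "integrable P0 (\<lambda>x. hN x \<theta>)" using A3_int theta0 that by (auto simp: \<rho>_def)
    have "linear (transpose :: real^'d^'d \<Rightarrow> real^'d^'d)"
      by (rule linearI) (simp_all add: transpose_def vec_eq_iff)
    then have "bounded_linear (transpose :: real^'d^'d \<Rightarrow> real^'d^'d)" by (simp add: linear_conv_bounded_linear)
    from integral_bounded_linear[OF this int]
    have "transpose (J \<theta>) = (\<integral>x. transpose (hN x \<theta>) \<partial>P0)" by (simp add: J_def)
    also have "\<dots> = J \<theta>" unfolding J_def using that symN by (intro Bochner_Integration.integral_cong) auto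
    finally show ?thesis .
  qed

  have sep: "\<exists>c. AE x in MX.
      2 * (ln (f x \<theta>0) - ln (f x \<theta>) + (\<theta>0 - \<theta>) \<bullet> gL x \<theta> - c) \<le> av x \<and>
      2 * (c - (ln (f x \<theta>0) - ln (f x \<theta>) + (\<theta>0 - \<theta>) \<bullet> gL x \<theta>)) \<le> bv x"
    if \<theta>: "\<theta> \<in> \<Theta>" "norm (\<theta> - \<theta>0) \<le> \<rho>" for \<theta>
  proof -
    have "\<exists>c. \<forall>x\<in>space MX. ennreal (2 * (- ln (f x \<theta>) - - ln (f x \<theta>0) + (\<theta>0 - \<theta>) \<bullet> gN x \<theta> - c)) \<le> lo x
        \<and> ennreal (exp (2 * (c - (- ln (f x \<theta>) - - ln (f x \<theta>0) + (\<theta>0 - \<theta>) \<bullet> gN x \<theta>)))) \<le> up x"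
      unfolding lo_def up_def D_def
    proof (rule curvature_separation[OF Theta_open Theta_convex theta0 \<theta>, where N = "\<lambda>x t. - ln (f x t)"])
      show "\<exists>x\<in>space MX. (\<Squnion>\<xi>\<in>cball \<theta>0 \<rho> \<inter> \<Theta>. ennreal (\<rho>\<^sup>2 * max 0 (lmax (J \<xi> - hN x \<xi>)))) < \<infinity>"
        using P0.exists_finite_of_nn_integral[OF finlo] by (simp add: lo_def D_def)
      show "\<exists>x\<in>space MX. (\<Squnion>\<xi>\<in>cball \<theta>0 \<rho> \<inter> \<Theta>. ennreal (exp (\<rho>\<^sup>2 * max 0 (lmax (hN x \<xi> - J \<xi>))))) < \<infinity>"
        using P0.exists_finite_of_nn_integral[OF finup] by (simp add: up_def D_def)
    qed (use N_grad N_hess symJ in auto)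
    then obtain c where c: "\<And>x. x \<in> space MX \<Longrightarrow> ennreal (2 * (ln (f x \<theta>0) - ln (f x \<theta>) + (\<theta>0 - \<theta>) \<bullet> gN x \<theta> - c)) \<le> lo x"
        "\<And>x. x \<in> space MX \<Longrightarrow> ennreal (exp (2 * (c - (ln (f x \<theta>0) - ln (f x \<theta>) + (\<theta>0 - \<theta>) \<bullet> gN x \<theta>)))) \<le> up x"
      by auto
    obtain x0 where x0: "x0 \<in> space MX" using P0.not_empty by auto
    \<comment> \<open>The gradients of the two losses differ by the gradient of the regularizer, which does not depend on the data.\<close>
    have R: "gL x \<theta> = gN x \<theta> + (gL x0 \<theta> - gN x0 \<theta>)" if x: "x \<in> space MX" for x
    proof -
      have dR: "(R has_derivative (\<lambda>h. (gL y \<theta> - gN y \<theta>) \<bullet> h)) (at \<theta>)" if "y \<in> space MX" for y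
        using has_derivative_diff[OF L_grad[rule_format, OF that \<theta>(1)] N_grad[rule_format, OF that \<theta>(1)]]
        by (simp add: inner_diff_left)
      have "(\<lambda>h. (gL x \<theta> - gN x \<theta>) \<bullet> h) = (\<lambda>h. (gL x0 \<theta> - gN x0 \<theta>) \<bullet> h)"
        by (rule has_derivative_unique[OF dR[OF x] dR[OF x0]])
      then have "gL x \<theta> - gN x \<theta> = gL x0 \<theta> - gN x0 \<theta>" by (metis vector_eq_rdot)
      then show ?thesis by (simp add: algebra_simps)
    qed
    \<comment> \<open>The regularizer contributes an inner product common to all data, hence part of
      the constant.\<close>
    define c' where "c' = c + (\<theta>0 - \<theta>) \<bullet> (gL x0 \<theta> - gN x0 \<theta>)"
    define \<psi> where "\<psi> x = ln (f x \<theta>0) - ln (f x \<theta>) + (\<theta>0 - \<theta>) \<bullet> gL x \<theta>" for x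
    have shift: "\<psi> x - c' = ln (f x \<theta>0) - ln (f x \<theta>) + (\<theta>0 - \<theta>) \<bullet> gN x \<theta> - c" if "x \<in> space MX" for x
      unfolding \<psi>_def c'_def R[OF that] by (simp add: inner_add_right)
    have [measurable]: "\<psi> \<in> borel_measurable MX" unfolding \<psi>_def[abs_def] by measurable
    \<comment> \<open>For fixed \<theta> the left side is measurable in the data, so the pointwise
      bound by \<open>lo\<close> descends to its minorant. The null set may depend on \<theta>,
      which \<open>sep\<close> permits.\<close>
    have "AE x in P0. ennreal (2 * (\<psi> x - c')) \<le> v1 x"
    proof (rule measurable_minorant_maximal[OF v1 _ v1le v1I _ finlo])
      show "ennreal (2 * (\<psi> x - c')) \<le> lo x" if "x \<in> space P0" for x
        using c(1)[of x] that by (simp add: shift)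
      show "(\<lambda>x. ennreal (2 * (\<psi> x - c'))) \<in> borel_measurable P0" by simp
    qed simp
    moreover have "AE x in P0. ennreal (exp (2 * (c' - \<psi> x))) \<le> v2 x"
    proof (rule measurable_minorant_maximal[OF v2 _ v2le v2I _ finup])
      show "ennreal (exp (2 * (c' - \<psi> x))) \<le> up x" if x: "x \<in> space P0" for x
      proof -
        have "c' - \<psi> x = c - (ln (f x \<theta>0) - ln (f x \<theta>) + (\<theta>0 - \<theta>) \<bullet> gN x \<theta>)"
          using shift[of x] x by simp
        then show ?thesis using c(2)[of x] x by simp
      qed
      show "(\<lambda>x. ennreal (exp (2 * (c' - \<psi> x)))) \<in> borel_measurable P0" by simp
    qed simp
    ultimately have "AE x in P0. 2 * (\<psi> x - c') \<le> av x \<and> 2 * (c' - \<psi> x) \<le> bv x"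
      using v1fin v2fin
    proof eventually_elim
      case (elim x)
      obtain a where a: "v1 x = ennreal a" "0 \<le> a" using elim by (cases "v1 x") auto
      obtain b where b: "v2 x = ennreal b" "0 \<le> b" using elim by (cases "v2 x") auto
      have "2 * (\<psi> x - c') \<le> a" using elim(1) a by (simp add: ennreal_le_iff)
      moreover have "exp (2 * (c' - \<psi> x)) \<le> max 1 b" using elim(2) b by (simp add: ennreal_le_iff le_max_iff_disj)
      then have "ln (exp (2 * (c' - \<psi> x))) \<le> ln (max 1 b)" by (subst ln_le_cancel_iff) auto
      ultimately show ?case using a b by (simp add: av_def bv_def)
    qed
    then show ?thesis unfolding AE_P0 \<psi>_def by blast
  qed

  \<comment> \<open>One exchangeable witness for both claims\<close>
  define B where "B = reference \<rho>"
  define d where "d = 3 * \<sigma> * r \<theta>0 + \<delta> \<theta>0 + \<epsilon> \<theta>0"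
  have B: "exchangeable_law MX M B" unfolding B_def by (rule reference_exch) (rule ref_exch)
  then have Bp: "prob_space B" "sets B = sets TS" by (simp_all add: exchangeable_law_def)
  have bound: "measure law A \<le> measure B A + d" if A: "A \<in> sets TS" for A
  proof (cases "\<sigma> * \<rho> \<le> 1/3")
    case True
    have "{(x, w) \<in> space MX \<times> UNIV. norm (\<theta>hat x w - \<theta>0) \<le> r \<theta>0 \<and> is_SSOSP gL hL \<sigma> x w (\<theta>hat x w)}
        = {z \<in> space (P0 \<Otimes>\<^sub>M W). good \<rho> (fst z) (snd z)}"
      by (auto simp: space_pair_measure good_def ssosp_def \<rho>_def)
    then have "1 - \<delta> \<theta>0 \<le> measure (P0 \<Otimes>\<^sub>M W) {z \<in> space (P0 \<Otimes>\<^sub>M W). good \<rho> (fst z) (snd z)}"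
      using A2 theta0 by auto
    moreover have "measure law A \<le> measure (reference \<rho>) A + (3 * \<sigma> * \<rho> + e
      + (1 - measure (P0 \<Otimes>\<^sub>M W) {z \<in> space (P0 \<Otimes>\<^sub>M W). good \<rho> (fst z) (snd z)}))"
      by (rule tv_bound[OF ref_exch less_imp_le[OF \<rho>] True e avm bvm _ _ Iav Ibv sep A])
        (auto simp: av_def bv_def)
    ultimately show ?thesis by (simp add: B_def d_def \<rho>_def e_def)
  next
    case False
    then have "1 \<le> d" using \<delta> e by (simp add: d_def \<rho>_def e_def)
    then show ?thesis using prob_space.prob_le_1[OF prob_space_law, of A] measure_nonneg[of B A] by linarith
  qed
  have "dTV law B \<le> d"
    by (rule dTV_le[OF prob_space_law Bp(1)]) (use Bp(2) sets_law bound in auto)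
  then have "dexch MX M law \<le> d" using dexch_le[OF prob_space_law B] by linarith
  \<comment> \<open>The explicit law \<open>B\<close> serves here directly, so the infimum in
    \<open>dexch\<close> does not have to be attained.\<close>
  moreover have "measure law {z \<in> space TS. pval T M z \<le> \<alpha>} \<le> \<alpha> + d"
    if "T \<in> borel_measurable MX" "0 \<le> \<alpha>" for T \<alpha>
    using bound[OF exchangeable_pval(1)[OF B that]] exchangeable_pval(2)[OF B that] by linarith
  ultimately show ?thesis by (simp add: d_def add.assoc)
qed

end
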